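(* Let $\alpha\in(0,1)$, $\beta\in(0,1]$, $N>4\beta$, $\gamma\in\mathbb{R}$ and $p\in[1,\infty]$, and put $p_{\rm c}=N/(N-2\beta)$. Let $f:\mathbb{R}^N\times[0,\infty)\to\mathbb{R}$ be measurable and suppose that there is $C_0>0$ with $$\|f(\cdot,t)\|_{L^1(\mathbb{R}^N)}\le \frac{C_0}{(1+t)^{\gamma}}\qquad\text{for all } t\ge 0 .$$ If $p\ge p_{\rm c}$, suppose in addition that there are $C_1,R_0>0$ with $$|f(x,t)|\le C_1|x|^{-N}(1+t)^{-\gamma}\qquad\text{for all } |x|\ge R_0,\ t\ge0 .$$ Let $g:(0,\infty)\to(0,\infty)$ satisfy $g(t)\to\infty$ and $g(t)=o(t^{\alpha/(2\beta)})$ as $t\to\infty$. Let $u$ be the mild solution of $\partial_t^\alpha u+(-\Delta)^\beta u=f$ in $\mathbb{R}^N\times(0,\infty)$, $u(\cdot,0)=0$. Then for all $0<\nu<\mu<\infty$ there are constants $C>0$ and $t_0\ge 2$ such that for all $t\ge t_0$ $$\|u(\cdot,t)\|_{L^p(\{x\in\mathbb{R}^N:\,\nu\le |x|/g(t)\le\mu\})}\le C\,\Phi(t),$$ where $$\Phi(t):=g(t)^{2\beta-N(1-\frac1p)}\begin{cases} t^{-\gamma},&\gamma<1,\\ \max\{t^{-1},\,t^{-(1+\alpha)}g(t)^{2\beta}\log t\},&\gamma=1,\\ \max\{t^{-\gamma},\,t^{-(1+\alpha)}g(t)^{2\beta}\},&\gamma>1. \end{cases}$$ These estimates are sharp: for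 all $\alpha\in(0,1)$, $\beta\in(0,1]$, $N>4\beta$, $\gamma\in\mathbb{R}$, $p\in[1,\infty]$, every $g:(0,\infty)\to(0,\infty)$ with $g(t)\to\infty$ and $g(t)=o(t^{\alpha/(2\beta)})$ as $t\to\infty$, and all $0<\nu<\mu<\infty$ there exist a measurable function $f:\mathbb{R}^N\times[0,\infty)\to\mathbb{R}$ satisfying, for some $C_0>0$, $\|f(\cdot,t)\|_{L^1(\mathbb{R}^N)}\le C_0(1+t)^{-\gamma}$ for all $t\ge0$ and, if $p\ge p_{\rm c}$, also, for some $C_1,R_0>0$, $|f(x,t)|\le C_1|x|^{-N}(1+t)^{-\gamma}$ for all $|x|\ge R_0$, $t\ge0$, and constants $c>0$, $t_1\ge2$ such that the corresponding mild solution $u$ satisfies $\|u(\cdot,t)\|_{L^p(\{\nu\le|x|/g(t)\le\mu\})}\ge c\,\Phi(t)$ for all $t\ge t_1$.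
   Context: $N$ is a positive integer (the space dimension), and $1/p=0$ when $p=\infty$. $\partial_t^\alpha$, $\alpha\in(0,1)$, is the Caputo derivative, defined for smooth functions by $$\partial_t^\alpha u(x,t)=\frac1{\Gamma(1-\alpha)}\,\partial_t\int_0^t\frac{u(x,\tau)-u(x,0)}{(t-\tau)^{\alpha}}\,{\rm d}\tau,$$ and $(-\Delta)^\beta=\mathcal{F}^{-1}(|\cdot|^{2\beta}\mathcal{F})$, with $\mathcal{F}$ the Fourier transform in space. Kernel $Y$: let $Z$ be the fundamental solution, i.e. the solution of $\partial_t^\alpha Z+(-\Delta)^\beta Z=0$ in $\mathbb{R}^N\times(0,\infty)$ with $Z(\cdot,0)=\delta_0$ (Dirac mass at the origin), and $Y(x,t)=\partial_t^{1-\alpha}Z(x,t)$ for $x\ne0$, $t>0$ (where $Z(x,0)=0$ for $x\neq 0$). Equivalently, $Y(\cdot,t)\in L^1(\mathbb{R}^N)$ is the function with $\int_{\mathbb{R}^N}e^{-ix\cdot\xi}Y(x,t)\,{\rm d}x=t^{\alpha-1}E_{\alpha,\alpha}(-|\xi|^{2\beta}t^\alpha)$ for $t>0$, where $E_{\alpha,\alpha}(z)=\sum_{k\ge0}z^k/\Gamma(\alpha k+\alpha)$. The function $Y$ is nonnegative. The mild solution of $\partial_t^\alpha u+(-\Delta)^\beta u=f$ in $\mathbb{R}^N\times(0,\infty)$, $u(\cdot,0)=0$, is the function $$u(x,t)=\int_0^t\int_{\mathbb{R}^N}Y(x-y,t-s)f(y,s)\,{\rm d}y\,{\rm d}s .$$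 *)

theory Defs
  imports
    "HOL-Analysis.Analysis"
    "HOL-Probability.Essential_Supremum"
    "HOL-Library.Landau_Symbols"
begin

text \<open>
  The space \<open>\<real>\<^sup>N\<close> is a type of class \<open>euclidean_space\<close>, with \<open>N = DIM('a)\<close>. Functions
  on \<open>\<real>\<^sup>N \<times> [0,\<infinity>)\<close> have type \<open>'a \<Rightarrow> real \<Rightarrow> real\<close>; their values at negative times are
  never used. ``Measurable'' means Lebesgue measurable. In \<open>L\<^sup>p\<close> the exponent \<open>p\<close> is an
  \<open>ennreal\<close>, so that \<open>1 / p = 0\<close> for \<open>p = \<infinity>\<close>.
\<close>

definition mittag_leffler :: "real \<Rightarrow> real \<Rightarrow> real \<Rightarrow> real" where
  "mittag_leffler a b z = (\<Sum>k. z ^ k / Gamma (a * real k + b))"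

definition fourier :: "('a::euclidean_space \<Rightarrow> real) \<Rightarrow> 'a \<Rightarrow> complex" where
  "fourier h \<xi> = (LINT x|lebesgue. exp (- (\<i> * of_real (x \<bullet> \<xi>))) * of_real (h x))"

text \<open>
  \<open>kernel_Y \<alpha> \<beta> t\<close> is \<open>Y(\<cdot>,t)\<close>, the integrable function with the prescribed Fourier
  transform. It is determined only up to a null set, for each \<open>t\<close> separately; the choice of
  representative is immaterial in \<open>mild_solution\<close>, where \<open>Y\<close> occurs only under an integral over
  the space variable.
\<close>

definition kernel_Y :: "real \<Rightarrow> real \<Rightarrow> real \<Rightarrow> 'a::euclidean_space \<Rightarrow> real" where
  "kernel_Y \<alpha> \<beta> t = (SOME h. integrable lebesgue h \<and>
     (\<forall>\<xi>. fourier h \<xi> =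
        of_real (t powr (\<alpha> - 1) * mittag_leffler \<alpha> \<alpha> (- (norm \<xi> powr (2 * \<beta>)) * t powr \<alpha>))))"

definition mild_solution ::
    "real \<Rightarrow> real \<Rightarrow> ('a::euclidean_space \<Rightarrow> real \<Rightarrow> real) \<Rightarrow> 'a \<Rightarrow> real \<Rightarrow> real" where
  "mild_solution \<alpha> \<beta> f x t =
     (LINT s:{0<..<t}|lebesgue. (LINT y|lebesgue. kernel_Y \<alpha> \<beta> (t - s) (x - y) * f y s))"

text \<open>
  The \<open>L\<^sup>p\<close> norm, with value \<open>\<infinity>\<close> allowed. For nonmeasurable functions the value has no meaning, so
  measurability is always stated separately.
\<close>

definition Lp_norm :: "ennreal \<Rightarrow> 'b measure \<Rightarrow> ('b \<Rightarrow> real) \<Rightarrow> ennreal" where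
  "Lp_norm p M h =
     (if p = \<infinity> then esssup M (\<lambda>x. ennreal \<bar>h x\<bar>)
      else let I = (\<integral>\<^sup>+ x. ennreal (\<bar>h x\<bar> powr enn2real p) \<partial>M)
           in if I = \<infinity> then \<infinity> else ennreal (enn2real I powr (1 / enn2real p)))"

definition p_crit :: "real \<Rightarrow> real \<Rightarrow> real" where
  "p_crit N \<beta> = N / (N - 2 * \<beta>)"

definition admissible_source ::
    "real \<Rightarrow> real \<Rightarrow> ennreal \<Rightarrow> ('a::euclidean_space \<Rightarrow> real \<Rightarrow> real) \<Rightarrow> bool" where
  "admissible_source \<beta> \<gamma> p f \<longleftrightarrow>
     (\<lambda>(x, t). f x t) \<in> borel_measurable (lebesgue_on (UNIV \<times> {0..})) \<and>
     (\<exists>C\<^sub>0>0. \<forall>t\<ge>0. (\<lambda>x. f x t) \<in> borel_measurable lebesgue \<and>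
        Lp_norm 1 lebesgue (\<lambda>x. f x t) \<le> ennreal (C\<^sub>0 / (1 + t) powr \<gamma>)) \<and>
     (ennreal (p_crit (real DIM('a)) \<beta>) \<le> p \<longrightarrow>
        (\<exists>C\<^sub>1>0. \<exists>R\<^sub>0>0. \<forall>x t. R\<^sub>0 \<le> norm x \<and> 0 \<le> t \<longrightarrow>
           \<bar>f x t\<bar> \<le> C\<^sub>1 * norm x powr (- real DIM('a)) * (1 + t) powr (- \<gamma>)))"

definition annulus :: "real \<Rightarrow> real \<Rightarrow> real \<Rightarrow> 'a::euclidean_space set" where
  "annulus \<nu> \<mu> r = {x. \<nu> \<le> norm x / r \<and> norm x / r \<le> \<mu>}"

definition rate :: "real \<Rightarrow> real \<Rightarrow> real \<Rightarrow> real \<Rightarrow> ennreal \<Rightarrow> (real \<Rightarrow> real) \<Rightarrow> real \<Rightarrow> real" where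
  "rate N \<alpha> \<beta> \<gamma> p g t =
     g t powr (2 * \<beta> - N * (1 - enn2real (1 / p))) *
     (if \<gamma> < 1 then t powr (- \<gamma>)
      else if \<gamma> = 1 then max (t powr (- 1)) (t powr (- (1 + \<alpha>)) * g t powr (2 * \<beta>) * ln t)
      else max (t powr (- \<gamma>)) (t powr (- (1 + \<alpha>)) * g t powr (2 * \<beta>)))"

end

theory Submission
  imports
    Defs
    "HOL-Probability.Probability"
    "HOL-Real_Asymp.Real_Asymp"
begin

text \<open>
  Everything rests on writing the kernel as a positive mixture of Gaussians. If \<open>X\<close> and \<open>S\<close> are
  independent positive stable random variables with Laplace transforms \<open>exp(-k\<^sup>\<alpha>)\<close> and
  \<open>exp(-k\<^sup>\<beta>)\<close>, then \<open>E\<^sub>\<alpha>\<^sub>,\<^sub>\<alpha>(-k\<^sup>\<beta>)\<close> is the Laplace transform in \<open>k\<close> of the law of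
  \<open>X powr (-\<alpha>/\<beta>)\<close> times \<open>S\<close>, weighted by \<open>\<alpha> X powr (-\<alpha>)\<close>: up to factorials,
  the negative moments of \<open>X\<close> are the coefficients of the Mittag-Leffler series
  (\<open>mittag_leffler_stable_mixture\<close>). Hence
  the heat kernel, averaged over its time variable against this finite measure \<open>m\<close>, has the Fourier
  transform prescribed for \<open>Y\<close>, and by injectivity of the Fourier transform on integrable
  functions (\<open>fourier_inj_AE\<close>) it is \<open>Y\<close>.

  Positivity of \<open>m\<close> turns every pointwise question about \<open>Y\<close> into one about its Laplace
  transform. A Gaussian, as a function of its time variable, lies below a positive combination of
  decaying exponentials and above a signed one, so that the two-sided bound
  \<open>E\<^sub>\<alpha>\<^sub>,\<^sub>\<alpha>(-z) \<approx> z powr (-2)\<close> for large \<open>z\<close> (\<open>mittag_leffler_two_sided\<close>), itself proved in this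
  way from the Laplace transform of \<open>X\<close>, gives
  \<open>Y(x,t) \<approx> t powr (-1-\<alpha>) |x| powr (4\<beta>-N)\<close> inside the diffusive region
  \<open>|x| \<le> t powr (\<alpha>/(2\<beta>))\<close>, and in the whole space the interpolated upper bounds
  \<open>t powr (\<alpha>-1-2\<alpha>\<theta>) |x| powr (4\<beta>\<theta>-N)\<close> with \<open>0 < \<theta> \<le> 1\<close> (\<open>ex_fundamental_kernel\<close>). The
  condition \<open>N > 4\<beta>\<close> enters here.

  For the estimate at distance \<open>R\<close>, a fixed multiple of \<open>g(t)\<close>, one uses the bound with
  \<open>\<theta> = 1\<close> after the diffusive time \<open>T = R powr (2\<beta>/\<alpha>)\<close> and with some \<open>\<theta> < 1/2\<close> before it.
  This separates the variables: \<open>Y(z,\<tau>)\<close> is at most a time factor times a spatial profile which is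
  constant for \<open>|z| \<ge> R\<close> and has the singularity \<open>|z| powr (4\<beta>\<theta>-N)\<close> for \<open>|z| < R\<close>. Integrated
  against \<open>(1+s) powr (-\<gamma>)\<close> the time factor gives \<open>R powr (2\<beta>)\<close> times the three-case decay rate
  (\<open>memory_source_upper\<close>): the recent past contributes \<open>t powr (-\<gamma>)\<close>, the remote past
  \<open>t powr (-1-\<alpha>) R powr (2\<beta>)\<close> times the total mass of the source up to time \<open>t\<close>. In space,
  if \<open>p < p\<^sub>c\<close> then \<open>\<theta>\<close> can be chosen so that the profile lies locally in \<open>L\<^sup>p\<close>, and Young's
  inequality applies; if \<open>p \<ge> p\<^sub>c\<close> the decay of \<open>f\<close> bounds the source where the profile is
  singular, and the solution is bounded uniformly on the annulus.

  The estimates are attained by \<open>f(y,s) = (1+s) powr (-\<gamma>)\<close> on the unit ball, as the lower bound for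
  \<open>Y\<close> reverses each of these inequalities up to constants.
\<close>

section \<open>One-sided stable laws\<close>

lemma gbinomial_alternating_nonneg:
  fixes a :: real
  assumes "0 < a" "a \<le> 1"
  shows "0 \<le> (-1) ^ j * (a gchoose Suc j)"
proof (induction j)
  case 0
  then show ?case using assms by simp
next
  case (Suc j)
  have "a gchoose Suc (Suc j) = (a gchoose Suc j) * ((a - real (Suc j)) / real (Suc (Suc j)))"
    using gbinomial_absorption'[of "Suc (Suc j)" a] gbinomial_mult_1[of a "Suc j"]
    by (simp add: field_simps)
  then have "(-1) ^ Suc j * (a gchoose Suc (Suc j)) =
      (-1) ^ Suc j * ((a gchoose Suc j) * ((a - real (Suc j)) / real (Suc (Suc j))))"
    by (simp only:)
  also have "\<dots> = ((-1) ^ j * (a gchoose Suc j)) * ((real (Suc j) - a) / real (Suc (Suc j)))"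
    by (simp add: minus_divide_left[symmetric] del: of_nat_Suc) (simp add: algebra_simps diff_divide_distrib)
  finally have "(-1) ^ Suc j * (a gchoose Suc (Suc j)) =
      ((-1) ^ j * (a gchoose Suc j)) * ((real (Suc j) - a) / real (Suc (Suc j)))" .
  moreover have "0 \<le> (real (Suc j) - a) / real (Suc (Suc j))" using assms by simp
  ultimately show ?case using Suc.IH by (simp only: mult_nonneg_nonneg)
qed

lemma gbinomial_alternating_sums:
  fixes a s :: real
  assumes "0 \<le> s" "s < 1"
  shows "(\<lambda>j. (-1) ^ j * (a gchoose Suc j) * s ^ Suc j) sums (1 - (1 - s) powr a)"
proof -
  have "(\<lambda>n. (a gchoose n) * (-s) ^ n) sums (1 + (-s)) powr a"
    by (rule gen_binomial_real) (use assms in simp)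
  then have "(\<lambda>n. (a gchoose Suc n) * (-s) ^ Suc n) sums ((1 - s) powr a - 1)"
    by (subst sums_Suc_iff) simp
  then have "(\<lambda>n. - ((a gchoose Suc n) * (-s) ^ Suc n)) sums (- ((1 - s) powr a - 1))"
    by (rule sums_minus)
  then show ?thesis by (simp add: power_minus' power_minus[of s] mult_ac)
qed

text \<open>
  The power series of \<open>1 - (1-s)\<^sup>a\<close> has nonnegative coefficients. That they sum to \<open>1\<close> follows by
  letting \<open>s\<close> tend to \<open>1\<close>, which monotonicity permits. This is the Sibuya law; the sum of \<open>n\<close>
  independent copies, divided by \<open>n powr (1/a)\<close>, approximates the stable law of index \<open>a\<close>.
\<close>
lemma ex_sibuya_pmf:
  fixes a :: real
  assumes a: "0 < a" "a \<le> 1"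
  shows "\<exists>q :: nat pmf. \<forall>k>0.
    (\<integral>\<^sup>+ j. ennreal (exp (- k * real j)) \<partial>measure_pmf q) = ennreal (1 - (1 - exp (-k)) powr a)"
proof -
  define c where "c j = (-1) ^ j * (a gchoose Suc j)" for j
  have c0: "0 \<le> c j" for j unfolding c_def by (rule gbinomial_alternating_nonneg[OF a])
  have cs: "(\<lambda>j. c j * s ^ Suc j) sums (1 - (1 - s) powr a)" if "0 \<le> s" "s < 1" for s
    unfolding c_def by (rule gbinomial_alternating_sums[OF that])
  have part: "(\<Sum>j<n. c j) \<le> 1" for n
  proof (rule tendsto_upperbound)
    show "((\<lambda>s. \<Sum>j<n. c j * s ^ Suc j) \<longlongrightarrow> (\<Sum>j<n. c j)) (at_left 1)"
      by (rule tendsto_eq_intros refl | simp)+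
    have "(\<Sum>j<n. c j * s ^ Suc j) \<le> 1" if "s > 0" "s < 1" for s
    proof -
      have "(\<Sum>j<n. c j * s ^ Suc j) \<le> 1 - (1 - s) powr a"
        using cs[of s] that c0 sum_le_suminf[of "\<lambda>j. c j * s ^ Suc j" "{..<n}"]
        by (auto simp: sums_iff)
      then show ?thesis using powr_ge_zero[of "1 - s" a] by linarith
    qed
    then show "\<forall>\<^sub>F s in at_left 1. (\<Sum>j<n. c j * s ^ Suc j) \<le> 1"
      unfolding eventually_at_left_field by (intro exI[of _ 0]) auto
  qed auto
  have sm: "summable c"
    by (rule summableI_nonneg_bounded[OF c0 part])
  have le1: "suminf c \<le> 1"
    by (rule suminf_le_const[OF sm part])
  have ge1: "1 \<le> suminf c"
  proof (rule tendsto_upperbound)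
    show "\<forall>\<^sub>F s in at_left (1::real). 1 - (1 - s) powr a \<le> suminf c"
      unfolding eventually_at_left_field
    proof (intro exI[of _ 0] conjI allI impI)
      fix s :: real assume s: "0 < s" "s < 1"
      have "c j * s ^ Suc j \<le> c j" for j
        using mult_left_le[OF _ c0] s by (simp add: power_le_one mult_left_le c0 del: power_Suc)
      then have "(\<Sum>j. c j * s ^ Suc j) \<le> suminf c"
        using cs[of s] s sm by (intro suminf_le) (auto simp: sums_iff)
      then show "1 - (1 - s) powr a \<le> suminf c" using cs[of s] s by (simp add: sums_iff)
    qed auto
    have "((\<lambda>s. 1 - (1 - s) powr a) \<longlongrightarrow> 1 - 0) (at_left (1::real))"
      using a by real_asymp
    then show "((\<lambda>s. 1 - (1 - s) powr a) \<longlongrightarrow> 1) (at_left (1::real))" by simp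
  qed auto
  have tot: "(\<integral>\<^sup>+ j. ennreal (c j) \<partial>count_space UNIV) = 1"
  proof -
    have "(\<integral>\<^sup>+ j. ennreal (c j) \<partial>count_space UNIV) = (\<Sum>j. ennreal (c j))"
      by (rule nn_integral_count_space_nat)
    also have "\<dots> = ennreal (suminf c)" by (rule suminf_ennreal2[OF c0 sm])
    finally show ?thesis using le1 ge1 by simp
  qed
  define q0 where "q0 = embed_pmf c"
  have pq: "pmf q0 j = c j" for j
    unfolding q0_def by (rule pmf_embed_pmf) (use c0 tot in auto)
  show ?thesis
  proof (intro exI[of _ "map_pmf Suc q0"] allI impI)
    fix k :: real assume k: "k > 0"
    have "(\<integral>\<^sup>+ j. ennreal (exp (- k * real j)) \<partial>measure_pmf (map_pmf Suc q0)) =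
        (\<integral>\<^sup>+ j. ennreal (c j) * ennreal (exp (- k * real (Suc j))) \<partial>count_space UNIV)"
      by (subst nn_integral_map_pmf) (simp add: nn_integral_measure_pmf pq)
    also have "\<dots> = (\<Sum>j. ennreal (c j * exp (-k) ^ Suc j))"
      by (subst nn_integral_count_space_nat)
        (simp add: ennreal_mult' c0 exp_of_nat_mult[symmetric] mult_ac del: power_Suc of_nat_Suc)
    also have "\<dots> = ennreal (1 - (1 - exp (-k)) powr a)"
      using cs[of "exp (-k)"] k c0 by (subst suminf_ennreal2) (auto simp: sums_iff)
    finally show "(\<integral>\<^sup>+ j. ennreal (exp (- k * real j)) \<partial>measure_pmf (map_pmf Suc q0)) =
      ennreal (1 - (1 - exp (-k)) powr a)" .
  qed
qed

lemma ex_pmf_convolution_power: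
  fixes q :: "nat pmf" and L :: "real \<Rightarrow> real"
  assumes "\<And>k. k > 0 \<Longrightarrow> (\<integral>\<^sup>+ j. ennreal (exp (- k * real j)) \<partial>measure_pmf q) = ennreal (L k)"
    and "\<And>k. k > 0 \<Longrightarrow> 0 \<le> L k"
  shows "\<exists>S :: nat pmf. \<forall>k>0. (\<integral>\<^sup>+ j. ennreal (exp (- k * real j)) \<partial>measure_pmf S) = ennreal (L k ^ n)"
proof (induction n)
  case 0
  show ?case by (rule exI[of _ "return_pmf 0"]) simp
next
  case (Suc n)
  then obtain S :: "nat pmf" where S: "\<And>k. k > 0 \<Longrightarrow>
    (\<integral>\<^sup>+ j. ennreal (exp (- k * real j)) \<partial>measure_pmf S) = ennreal (L k ^ n)" by blast
  show ?case
  proof (intro exI[of _ "map_pmf (\<lambda>(x, y). x + y) (pair_pmf q S)"] allI impI)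
    fix k :: real assume k: "k > 0"
    have "(\<integral>\<^sup>+ j. ennreal (exp (- k * real j)) \<partial>measure_pmf (map_pmf (\<lambda>(x, y). x + y) (pair_pmf q S))) =
      (\<integral>\<^sup>+ x. \<integral>\<^sup>+ y. ennreal (exp (- k * real x)) * ennreal (exp (- k * real y)) \<partial>S \<partial>q)"
      by (simp add: nn_integral_map_pmf nn_integral_pair_pmf' ennreal_mult'[symmetric]
          exp_add[symmetric] algebra_simps)
    also have "\<dots> = ennreal (L k) * ennreal (L k ^ n)"
      using assms(1) S k by (simp add: nn_integral_cmult nn_integral_multc)
    finally show "(\<integral>\<^sup>+ j. ennreal (exp (- k * real j))
      \<partial>measure_pmf (map_pmf (\<lambda>(x, y). x + y) (pair_pmf q S))) = ennreal (L k ^ Suc n)"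
      using assms(2)[OF k] by (simp add: ennreal_mult')
  qed
qed

lemma stable_scaling_limit:
  fixes a k :: real
  assumes a: "0 < a" "a \<le> 1" and k: "k > 0"
  shows "(\<lambda>n. (1 - (1 - exp (- (k * real (Suc n) powr (-1/a)))) powr a) ^ Suc n)
     \<longlonglongrightarrow> exp (- (k powr a))"
proof -
  have "((\<lambda>x::real. (1 - (1 - exp (- (k * x powr (-1/a)))) powr a) powr x) \<longlongrightarrow> exp (- (k powr a))) at_top"
    using a k by real_asymp
  then have "((\<lambda>n. (1 - (1 - exp (- (k * real (Suc n) powr (-1/a)))) powr a) powr real (Suc n))
      \<longlonglongrightarrow> exp (- (k powr a)))"
    by (rule filterlim_compose[OF _ filterlim_compose[OF filterlim_real_sequentially filterlim_Suc]])
  moreover have "(1 - (1 - exp (- (k * real (Suc n) powr (-1/a)))) powr a) powr real (Suc n) =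
     (1 - (1 - exp (- (k * real (Suc n) powr (-1/a)))) powr a) ^ Suc n" for n
  proof (rule powr_realpow)
    have "(1 - exp (- (k * real (Suc n) powr (-1/a)))) powr a < 1 powr a"
      using k a by (intro powr_less_mono2) (auto simp: powr_ge_zero)
    then show "0 < 1 - (1 - exp (- (k * real (Suc n) powr (-1/a)))) powr a" by simp
  qed
  ultimately show ?thesis by simp
qed

text \<open>
  The rescaled Sibuya sums have explicit Laplace transforms, which converge to \<open>exp(-k\<^sup>a)\<close>.
  Bernoulli's inequality bounds the mass beyond \<open>R\<close> by a multiple of \<open>R powr (-a)\<close>
  uniformly in \<open>n\<close>, so Helly's theorem yields a limit law, and its Laplace transform is the limit. It
  has no atom at \<open>0\<close> because \<open>exp(-k\<^sup>a)\<close> vanishes as \<open>k\<close> tends to infinity.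
\<close>
lemma ex_stable_law:
  fixes a :: real
  assumes a: "0 < a" "a \<le> 1"
  shows "\<exists>M. real_distribution M \<and> (AE x in M. 0 < x) \<and>
    (\<forall>k>0. (LINT x|M. exp (- (k * x))) = exp (- (k powr a)))"
proof -
  define L where "L k = 1 - (1 - exp (-k)) powr a" for k :: real
  have L0: "0 \<le> L k" if "k > 0" for k
    unfolding L_def using powr_le1[of a "1 - exp (-k)"] a that by simp
  obtain q :: "nat pmf" where q: "\<And>k. k > 0 \<Longrightarrow>
      (\<integral>\<^sup>+ j. ennreal (exp (- k * real j)) \<partial>measure_pmf q) = ennreal (L k)"
    using ex_sibuya_pmf[OF a] unfolding L_def by blast
  have "\<forall>n. \<exists>S :: nat pmf. \<forall>k>0.
      (\<integral>\<^sup>+ j. ennreal (exp (- k * real j)) \<partial>measure_pmf S) = ennreal (L k ^ Suc n)"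
    using ex_pmf_convolution_power[of q L, OF q L0] by blast
  then obtain S :: "nat \<Rightarrow> nat pmf" where S: "\<And>n k. k > 0 \<Longrightarrow>
      (\<integral>\<^sup>+ j. ennreal (exp (- k * real j)) \<partial>measure_pmf (S n)) = ennreal (L k ^ Suc n)"
    by metis
  define c where "c n = real (Suc n) powr (-1/a)" for n
  have c0: "c n > 0" for n by (simp add: c_def)
  define \<mu> where "\<mu> n = distr (measure_pmf (S n)) borel (\<lambda>j. real j * c n)" for n
  have rd: "real_distribution (\<mu> n)" for n
    unfolding \<mu>_def by (rule prob_space.real_distribution_distr[OF measure_pmf.prob_space_axioms]) simp
  define f where "f k x = exp (- (k * max 0 x))" for k x :: real
  have fc: "isCont (f k) x" for k x
    unfolding f_def by (intro continuous_intros)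
  have fm[measurable]: "f k \<in> borel_measurable borel" for k
    unfolding f_def by measurable
  have fb: "norm (f k x) \<le> 1" if "k > 0" for k x
    using that unfolding f_def by simp
  have nonneg: "AE x in \<mu> n. 0 \<le> x" for n
    unfolding \<mu>_def using c0[of n] by (subst AE_distr_iff) (auto simp: less_imp_le)
  have Ef: "(LINT x|\<mu> n. f k x) = L (k * c n) ^ Suc n" if k: "k > 0" for k n
  proof -
    have "(LINT x|\<mu> n. f k x) = enn2real (\<integral>\<^sup>+ x. ennreal (f k x) \<partial>\<mu> n)"
      by (rule integral_eq_nn_integral) (auto simp: \<mu>_def f_def)
    also have "(\<integral>\<^sup>+ x. ennreal (f k x) \<partial>\<mu> n) =
        (\<integral>\<^sup>+ j. ennreal (exp (- (k * c n) * real j)) \<partial>measure_pmf (S n))"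
      unfolding \<mu>_def using c0[of n]
      by (subst nn_integral_distr) (auto intro!: nn_integral_cong simp: f_def mult_ac less_imp_le)
    also have "\<dots> = ennreal (L (k * c n) ^ Suc n)"
      by (rule S) (use k c0 in simp)
    finally show ?thesis using L0[of "k * c n"] k c0[of n] by (simp del: power_Suc)
  qed
  have int_f: "integrable (\<mu> n) (f k)" if "k > 0" for n k
  proof -
    interpret real_distribution "\<mu> n" by (rule rd)
    show ?thesis
      by (rule integrable_const_bound[of _ 1]) (use fb[OF that] in auto)
  qed
  define C :: real where "C = 1 / (1 - exp (-1))"
  have C0: "C > 0" by (simp add: C_def)
  \<comment> \<open>Beyond \<open>R\<close> the function \<open>1 - f (1/R)\<close> is at least \<open>1 - 1/e\<close>, the inverse of \<open>C\<close>.\<close>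
  have tail: "1 - C * R powr (-a) \<le> measure (\<mu> n) {-1<..R}" if R: "R > 0" for n R
  proof -
    interpret real_distribution "\<mu> n" by (rule rd)
    define u where "u = (1 - exp (- (c n / R))) powr a"
    have u1: "u \<le> 1" unfolding u_def using powr_le1[of a "1 - exp (-(c n / R))"] a c0[of n] R by simp
    have "u \<le> (c n / R) powr a"
      unfolding u_def using exp_ge_add_one_self[of "-(c n / R)"] c0[of n] R a
      by (intro powr_mono2) auto
    also have "\<dots> = c n powr a / R powr a"
      using c0[of n] R by (simp add: powr_divide)
    also have "\<dots> = R powr (-a) / real (Suc n)"
      unfolding c_def powr_powr using a
      by (simp add: powr_minus divide_inverse mult_ac powr_minus_divide del: of_nat_Suc)
    finally have u: "real (Suc n) * u \<le> R powr (-a)" by (simp add: field_simps)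
    have "1 + real (Suc n) * (-u) \<le> (1 + (-u)) ^ Suc n"
      by (rule Bernoulli_inequality) (use u1 in simp)
    then have "1 - R powr (-a) \<le> L (1/R * c n) ^ Suc n"
      using u by (simp add: L_def u_def del: power_Suc of_nat_Suc)
    then have "1 - C * R powr (-a) \<le> 1 - C * (1 - L (1/R * c n) ^ Suc n)"
      using C0 by simp
    also have "\<dots> = (LINT x|\<mu> n. 1 - C * (1 - f (1/R) x))"
      using int_f[of "1/R" n] Ef[of "1/R" n] R prob_space by simp
    also have "\<dots> \<le> (LINT x|\<mu> n. indicator {-1<..R} x)"
    proof (rule integral_mono_AE)
      show "AE x in \<mu> n. 1 - C * (1 - f (1/R) x) \<le> indicator {-1<..R} x"
        using nonneg
      proof eventually_elim
        fix x :: real assume x: "0 \<le> x"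
        show "1 - C * (1 - f (1/R) x) \<le> indicator {-1<..R} x"
        proof (cases "x \<le> R")
          case True
          then show ?thesis using x fb[of "1/R" x] R C0 by (simp add: f_def)
        next
          case False
          then have "f (1/R) x \<le> exp (-1)" using x R by (simp add: f_def field_simps)
          then have "1 \<le> C * (1 - f (1/R) x)" by (simp add: C_def field_simps)
          then show ?thesis using False by simp
        qed
      qed
    qed (use int_f[of "1/R" n] R in \<open>auto intro!: integrable_const_bound[of "indicat_real {-1<..R}" 1]\<close>)
    finally show ?thesis by simp
  qed
  have "tight \<mu>"
    unfolding tight_def
  proof (intro conjI allI impI rd)
    fix \<epsilon> :: real assume e: "\<epsilon> > 0"
    have "((\<lambda>R. C * R powr (-a)) \<longlongrightarrow> 0) at_top"
      using a by real_asymp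
    then have "\<forall>\<^sub>F R in at_top. C * R powr (-a) < \<epsilon>" by (rule order_tendstoD(2)[OF _ e])
    then obtain R where "R > 0" "C * R powr (-a) < \<epsilon>"
      by (metis (mono_tags, lifting) eventually_at_top_linorder eventually_gt_at_top eventually_conj order_refl)
    then show "\<exists>a b. a < b \<and> (\<forall>n. 1 - \<epsilon> < measure (\<mu> n) {a<..b})"
      using tail[of R]
      by (intro exI[where x = "-1"] exI[where x = R] conjI allI) (auto intro: less_le_trans[of "1 - \<epsilon>" "1 - C * R powr (-a)"])
  qed
  from tight_imp_convergent_subsubsequence[OF this strict_mono_id] obtain r M where
    r: "strict_mono r" and M: "real_distribution M" and conv: "weak_conv_m (\<mu> \<circ> r) M"
    by (auto simp: comp_assoc)
  interpret M: real_distribution M by (rule M)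
  have lim: "(\<lambda>n. LINT x|\<mu> (r n). h x) \<longlonglongrightarrow> (LINT x|M. h x)"
    if "\<And>x. isCont h x" "\<And>x. norm (h x) \<le> 1" for h :: "real \<Rightarrow> real"
    using weak_conv_imp_integral_bdd_continuous_conv[of "\<mu> \<circ> r" M h 1] rd M conv that by simp
  have EM: "(LINT x|M. f k x) = exp (- (k powr a))" if k: "k > 0" for k
  proof -
    have "(\<lambda>n. L (k * c n) ^ Suc n) \<longlonglongrightarrow> exp (- (k powr a))"
      unfolding L_def c_def by (rule stable_scaling_limit[OF a k])
    then have "(\<lambda>n. L (k * c (r n)) ^ Suc (r n)) \<longlonglongrightarrow> exp (- (k powr a))"
      using LIMSEQ_subseq_LIMSEQ[OF _ r] by (fastforce simp: comp_def)
    moreover have "(\<lambda>n. L (k * c (r n)) ^ Suc (r n)) \<longlonglongrightarrow> (LINT x|M. f k x)"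
      using lim[OF fc fb[OF k]] Ef[OF k] by simp
    ultimately show ?thesis by (rule LIMSEQ_unique[symmetric])
  qed
  \<comment> \<open>The test function measures the mass on the negative half-line, which is zero before the limit.\<close>
  have "AE x in M. 0 \<le> x"
  proof -
    define h :: "real \<Rightarrow> real" where "h x = min 1 (max 0 (-x))" for x
    have [measurable]: "h \<in> borel_measurable borel" unfolding h_def by measurable
    have "(\<lambda>n. LINT x|\<mu> (r n). h x) \<longlonglongrightarrow> (LINT x|M. h x)"
      by (rule lim) (auto simp: h_def intro!: continuous_intros)
    moreover have "(LINT x|\<mu> n. h x) = 0" for n
    proof -
      have "(LINT x|\<mu> n. h x) = (LINT x|\<mu> n. 0)"
        by (rule integral_cong_AE) (use nonneg[of n] in \<open>auto simp: h_def \<mu>_def\<close>)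
      then show ?thesis by simp
    qed
    ultimately have "(LINT x|M. h x) = 0" by (simp add: LIMSEQ_const_iff)
    moreover have "integrable M h"
      by (rule M.integrable_const_bound[of _ 1]) (auto simp: h_def)
    ultimately have "AE x in M. h x = 0"
      by (subst (asm) integral_nonneg_eq_0_iff_AE) (auto simp: h_def)
    then show ?thesis by eventually_elim (auto simp: h_def min_def max_def split: if_splits)
  qed
  moreover have "AE x in M. x \<noteq> 0"
  proof -
    have "measure M {0} \<le> exp (- (k powr a))" if k: "k > 0" for k
    proof -
      have "measure M {0} = (LINT x|M. indicator {0} x)" by simp
      also have "\<dots> \<le> (LINT x|M. f k x)"
        by (rule integral_mono) (auto simp: f_def split: split_indicator
          intro!: M.integrable_const_bound[of _ 1] fb[OF k, unfolded f_def])
      finally show ?thesis using EM[OF k] by simp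
    qed
    moreover have "((\<lambda>k. exp (- (k powr a))) \<longlongrightarrow> 0) at_top" using a by real_asymp
    ultimately have "measure M {0} \<le> 0"
      by (intro tendsto_lowerbound) (auto intro!: eventually_mono[OF eventually_gt_at_top[of 0]])
    then have "emeasure M {0} = 0" by (simp add: M.emeasure_eq_measure measure_le_0_iff)
    then show ?thesis by (intro AE_I[of _ _ "{0}"]) auto
  qed
  ultimately have pos: "AE x in M. 0 < x" by eventually_elim auto
  moreover have "(LINT x|M. exp (- (k * x))) = exp (- (k powr a))" if k: "k > 0" for k
  proof -
    have "(LINT x|M. exp (- (k * x))) = (LINT x|M. f k x)"
      by (rule integral_cong_AE) (auto simp: f_def intro: eventually_mono[OF pos])
    then show ?thesis using EM[OF k] by simp
  qed
  ultimately show ?thesis using M by blast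
qed

section \<open>The Mittag-Leffler function as a stable mixture\<close>

lemma nn_integral_Gamma_scaled:
  fixes q x :: real
  assumes "q > 0" "x > 0"
  shows "(\<integral>\<^sup>+ k. ennreal (indicator {0<..} k * (k powr (q - 1) * exp (- (k * x)))) \<partial>lborel)
    = ennreal (Gamma q * x powr (- q))"
proof -
  have "ennreal (Gamma q) = (\<integral>\<^sup>+t. ennreal (indicator {0..} t * t powr (q - 1) / exp t) \<partial>lborel)"
    by (rule Gamma_conv_nn_integral_real[OF assms(1)])
  also have "\<dots> = ennreal x * (\<integral>\<^sup>+k. ennreal (indicator {0..} (x * k) * (x * k) powr (q - 1) / exp (x * k)) \<partial>lborel)"
    using assms by (subst nn_integral_real_affine[where c = x and t = 0]) auto
  also have "\<dots> = ennreal x * (\<integral>\<^sup>+k. ennreal (x powr (q - 1)) *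
      ennreal (indicator {0<..} k * (k powr (q - 1) * exp (- (k * x)))) \<partial>lborel)"
    using assms
    by (intro arg_cong2[of _ _ _ _ "(*)"] refl nn_integral_cong)
      (auto simp: indicator_def powr_mult ennreal_mult'[symmetric] zero_le_mult_iff exp_minus field_simps)
  also have "\<dots> = ennreal (x powr q) *
      (\<integral>\<^sup>+k. ennreal (indicator {0<..} k * (k powr (q - 1) * exp (- (k * x)))) \<partial>lborel)"
    using assms by (subst nn_integral_cmult)
      (auto simp: mult.assoc[symmetric] ennreal_mult'[symmetric] powr_diff)
  finally have *: "ennreal (Gamma q) = ennreal (x powr q) *
      (\<integral>\<^sup>+k. ennreal (indicator {0<..} k * (k powr (q - 1) * exp (- (k * x)))) \<partial>lborel)" .
  have "ennreal (Gamma q * x powr (- q)) = ennreal (x powr (-q)) * ennreal (Gamma q)"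
    by (simp add: ennreal_mult'' mult.commute)
  also have "\<dots> = (ennreal (x powr (-q)) * ennreal (x powr q)) *
      (\<integral>\<^sup>+k. ennreal (indicator {0<..} k * (k powr (q - 1) * exp (- (k * x)))) \<partial>lborel)"
    by (subst *) (simp add: mult.assoc)
  also have "ennreal (x powr (-q)) * ennreal (x powr q) = 1"
    using assms by (simp add: ennreal_mult'[symmetric] powr_add[symmetric])
  finally show ?thesis by simp
qed

text \<open>
  Writing \<open>exp(-k\<^sup>a)\<close> as the integral of \<open>exp(-u)\<close> over \<open>u \<ge> k\<^sup>a\<close> and exchanging the order of
  integration takes the place of the substitution \<open>u = k\<^sup>a\<close>.
\<close>
lemma nn_integral_powr_exp_powr:
  fixes q a :: real
  assumes "q > 0" "a > 0"
  shows "(\<integral>\<^sup>+ k. ennreal (indicator {0<..} k * (k powr (q - 1) * exp (- (k powr a)))) \<partial>lborel)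
    = ennreal (Gamma (q / a + 1) / q)"
proof -
  have tailexp: "ennreal (exp (- v)) = (\<integral>\<^sup>+ u. ennreal (exp (- u)) * indicator {v..} u \<partial>lborel)" for v :: real
  proof -
    have "((\<lambda>x::real. - exp (- x)) \<longlongrightarrow> 0) at_top" by real_asymp
    then have "(\<integral>\<^sup>+ u. ennreal (exp (- u)) * indicator {v..} u \<partial>lborel) = ennreal (0 - (- exp (- v)))"
      by (intro nn_integral_FTC_atLeast) (auto intro!: derivative_eq_intros)
    then show ?thesis by simp
  qed
  have inner: "(\<integral>\<^sup>+ k. ennreal (indicator {0<..} k * k powr (q - 1)) * indicator {k powr a..} u \<partial>lborel) =
      ennreal (indicator {0..} u * (u powr (q / a)) / q)" if "u \<noteq> 0" for u :: real
  proof (cases "u > 0")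
    case True
    have "((\<lambda>k. k powr (q - 1)) has_integral ((u powr (1/a)) powr (q - 1 + 1) / (q - 1 + 1))) {0..u powr (1/a)}"
      by (rule has_integral_powr_from_0) (use assms in auto)
    then have "(\<integral>\<^sup>+ k. ennreal (indicator {0..u powr (1/a)} k * k powr (q - 1)) \<partial>lborel) =
      ennreal (u powr (q / a) / q)"
      by (subst nn_integral_has_integral_lebesgue) (auto simp: powr_powr)
    moreover have "k powr a \<le> u \<longleftrightarrow> k \<le> u powr (1/a)" if "k > 0" for k
    proof -
      have "k powr a \<le> u \<longleftrightarrow> k powr a \<le> (u powr (1/a)) powr a" using assms True by (simp add: powr_powr)
      also have "\<dots> \<longleftrightarrow> k \<le> u powr (1/a)" using assms that
        by (metis less_le_not_le linorder_linear not_le powr_ge_zero powr_less_mono2 powr_mono2 less_imp_le)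
      finally show ?thesis .
    qed
    then have "(\<integral>\<^sup>+ k. ennreal (indicator {0<..} k * k powr (q - 1)) * indicator {k powr a..} u \<partial>lborel) =
       (\<integral>\<^sup>+ k. ennreal (indicator {0..u powr (1/a)} k * k powr (q - 1)) \<partial>lborel)"
      using True by (intro nn_integral_cong) (auto simp: indicator_def less_eq_real_def[of 0])
    ultimately show ?thesis using True by simp
  next
    case False
    then have "(\<integral>\<^sup>+ k. ennreal (indicator {0<..} k * k powr (q - 1)) * indicator {k powr a..} u \<partial>lborel) =
      (\<integral>\<^sup>+ k. 0 \<partial>(lborel :: real measure))"
      using that by (intro nn_integral_cong) (auto simp: indicator_def dest: order_trans[OF powr_ge_zero])
    then show ?thesis using False that by simp
  qed
  have "(\<integral>\<^sup>+ k. ennreal (indicator {0<..} k * (k powr (q - 1) * exp (- (k powr a)))) \<partial>lborel) =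
    (\<integral>\<^sup>+ k. \<integral>\<^sup>+ u. ennreal (exp (- u)) * (ennreal (indicator {0<..} k * k powr (q - 1)) * indicator {k powr a..} u) \<partial>lborel \<partial>lborel)"
  proof (intro nn_integral_cong)
    fix k :: real
    have "(\<integral>\<^sup>+ u. ennreal (exp (- u)) * (ennreal (indicator {0<..} k * k powr (q - 1)) * indicator {k powr a..} u) \<partial>lborel)
      = (\<integral>\<^sup>+ u. ennreal (indicator {0<..} k * k powr (q - 1)) * (ennreal (exp (- u)) * indicator {k powr a..} u) \<partial>lborel)"
      by (simp add: mult_ac)
    also have "\<dots> = ennreal (indicator {0<..} k * k powr (q - 1)) * ennreal (exp (- (k powr a)))"
      by (subst nn_integral_cmult) (auto simp: tailexp[symmetric])
    finally show "ennreal (indicator {0<..} k * (k powr (q - 1) * exp (- (k powr a)))) =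
      (\<integral>\<^sup>+ u. ennreal (exp (- u)) * (ennreal (indicator {0<..} k * k powr (q - 1)) * indicator {k powr a..} u) \<partial>lborel)"
      by (simp add: ennreal_mult'[symmetric] mult.assoc)
  qed
  also have "\<dots> = (\<integral>\<^sup>+ u. \<integral>\<^sup>+ k. ennreal (exp (- u)) * (ennreal (indicator {0<..} k * k powr (q - 1)) * indicator {k powr a..} u) \<partial>lborel \<partial>lborel)"
    by (subst lborel_pair.Fubini') (auto simp: case_prod_unfold indicator_def cong: measurable_cong_sets)
  also have "\<dots> = (\<integral>\<^sup>+ u. ennreal (exp (- u)) * (\<integral>\<^sup>+ k. ennreal (indicator {0<..} k * k powr (q - 1)) * indicator {k powr a..} u \<partial>lborel) \<partial>lborel)"
    by (intro nn_integral_cong nn_integral_cmult) (auto simp: indicator_def)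
  also have "\<dots> = (\<integral>\<^sup>+ u. ennreal (1 / q) * ennreal (indicator {0..} u * u powr ((q / a + 1) - 1) / exp u) \<partial>lborel)"
    by (rule nn_integral_cong_AE, rule eventually_mono[OF AE_lborel_singleton[of 0]])
      (subst inner, use assms in \<open>auto simp: ennreal_mult'[symmetric] exp_minus field_simps\<close>)
  also have "\<dots> = ennreal (1 / q) * ennreal (Gamma (q / a + 1))"
    using assms by (subst nn_integral_cmult) (auto simp: Gamma_conv_nn_integral_real add_pos_pos)
  finally show ?thesis using assms by (simp add: ennreal_mult'[symmetric] field_simps)
qed

text \<open>
  Keep only the part \<open>t \<ge> R\<close> of Euler's integral. As \<open>R\<close> is free, the Gamma function grows faster
  than any exponential, which is all that the convergence of the Mittag-Leffler series requires.
\<close>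
lemma Gamma_ge_powr:
  fixes x R :: real
  assumes "x \<ge> 1" "R > 0"
  shows "R powr (x - 1) * exp (- R) \<le> Gamma x"
proof -
  have "((\<lambda>x::real. - exp (- x)) \<longlongrightarrow> 0) at_top" by real_asymp
  then have "(\<integral>\<^sup>+ u. ennreal (exp (- u)) * indicator {R..} u \<partial>lborel) = ennreal (0 - (- exp (- R)))"
    by (intro nn_integral_FTC_atLeast) (auto intro!: derivative_eq_intros)
  then have "ennreal (R powr (x - 1) * exp (- R)) =
      (\<integral>\<^sup>+ u. ennreal (R powr (x - 1)) * (ennreal (exp (- u)) * indicator {R..} u) \<partial>lborel)"
    by (subst nn_integral_cmult) (auto simp: ennreal_mult')
  also have "\<dots> \<le> (\<integral>\<^sup>+t. ennreal (indicator {0..} t * t powr (x - 1) / exp t) \<partial>lborel)"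
    using assms by (intro nn_integral_mono)
      (auto simp: indicator_def ennreal_mult'[symmetric] exp_minus field_simps intro!: ennreal_leI powr_mono2)
  also have "\<dots> = ennreal (Gamma x)"
    by (rule Gamma_conv_nn_integral_real[symmetric]) (use assms in simp)
  finally show ?thesis using assms by (subst (asm) ennreal_le_iff) auto
qed

lemma summable_mittag_leffler:
  fixes a b z :: real
  assumes "a > 0"
  shows "summable (\<lambda>n. z ^ n / Gamma (a * real n + b))"
proof (cases "z = 0")
  case True
  then show ?thesis by (auto intro!: summable_finite[of "{0}"] simp: power_0_left split: if_splits)
next
  case False
  define R where "R = (2 * \<bar>z\<bar>) powr (1 / a)"
  have R: "R > 0" "R powr a = 2 * \<bar>z\<bar>" using False assms by (auto simp: R_def powr_powr)
  show ?thesis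
  proof (rule summable_comparison_test_ev)
    show "summable (\<lambda>n. (exp R * R powr (1 - b)) * (1 / 2 :: real) ^ n)"
      by (intro summable_mult summable_geometric) simp
    have "\<forall>\<^sub>F n in sequentially. a * real n + b \<ge> 1"
      using assms by real_asymp
    then show "\<forall>\<^sub>F n in sequentially. norm (z ^ n / Gamma (a * real n + b)) \<le> (exp R * R powr (1 - b)) * (1 / 2) ^ n"
    proof eventually_elim
      case (elim n)
      have "R powr (a * real n) = (2 * \<bar>z\<bar>) ^ n"
        using R False by (simp add: powr_powr[symmetric] powr_realpow del: powr_powr)
      then have "(2 * \<bar>z\<bar>) ^ n * R powr (b - 1) * exp (-R) \<le> Gamma (a * real n + b)"
        using Gamma_ge_powr[OF elim R(1)] by (simp add: add_diff_eq[symmetric] powr_add del: add_diff_eq)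
      then have "\<bar>z\<bar> ^ n \<le> Gamma (a * real n + b) * ((exp R * R powr (1 - b)) * (1 / 2) ^ n)"
        using R(1) by (simp add: field_simps powr_diff exp_minus power_mult_distrib)
      moreover have "Gamma (a * real n + b) > 0" using elim by (intro Gamma_real_pos) auto
      ultimately show ?case by (simp add: field_simps power_abs)
    qed
  qed
qed

text \<open>
  Integrate the Laplace transform against \<open>k powr (q-1)\<close>: for fixed \<open>x\<close> this produces
  \<open>\<Gamma>(q) x powr (-q)\<close>.
\<close>
lemma stable_negative_moment:
  fixes a q :: real
  assumes M: "real_distribution M" and pos: "AE x in M. 0 < x"
    and L: "\<And>k. k > 0 \<Longrightarrow> (LINT x|M. exp (- (k * x))) = exp (- (k powr a))"
    and q: "q > 0" and a: "a > 0"
  shows "(\<integral>\<^sup>+ x. ennreal (x powr (- q)) \<partial>M) = ennreal (Gamma (q / a + 1) / (q * Gamma q))"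
proof -
  interpret real_distribution M by (rule M)
  have G: "Gamma q > 0" using q by (rule Gamma_real_pos)
  have "ennreal (Gamma q) * (\<integral>\<^sup>+ x. ennreal (x powr (- q)) \<partial>M) =
      (\<integral>\<^sup>+ x. ennreal (Gamma q * x powr (- q)) \<partial>M)"
    by (subst nn_integral_cmult[symmetric]) (auto simp: ennreal_mult'')
  also have "\<dots> = (\<integral>\<^sup>+ x. \<integral>\<^sup>+ k. ennreal (indicator {0<..} k * (k powr (q - 1) * exp (- (k * x)))) \<partial>lborel \<partial>M)"
    by (rule nn_integral_cong_AE, rule eventually_mono[OF pos])
      (simp add: nn_integral_Gamma_scaled[OF q])
  also have "\<dots> = (\<integral>\<^sup>+ k. \<integral>\<^sup>+ x. ennreal (indicator {0<..} k * (k powr (q - 1) * exp (- (k * x)))) \<partial>M \<partial>lborel)"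
    by (rule pair_sigma_finite.Fubini')
      (auto intro!: pair_sigma_finite.intro sigma_finite_lborel sigma_finite_measure_axioms
        simp: case_prod_unfold)
  also have "\<dots> = (\<integral>\<^sup>+ k. ennreal (indicator {0<..} k * (k powr (q - 1) * exp (- (k powr a)))) \<partial>lborel)"
  proof (intro nn_integral_cong)
    fix k :: real
    show "(\<integral>\<^sup>+ x. ennreal (indicator {0<..} k * (k powr (q - 1) * exp (- (k * x)))) \<partial>M) =
      ennreal (indicator {0<..} k * (k powr (q - 1) * exp (- (k powr a))))"
    proof (cases "k > 0")
      case True
      have "integrable M (\<lambda>x. exp (- (k * x)))"
        by (rule integrable_const_bound[of _ 1])
          (use pos True in \<open>auto elim!: eventually_mono\<close>)
      then have "(\<integral>\<^sup>+ x. ennreal (exp (- (k * x))) \<partial>M) = ennreal (exp (- (k powr a)))"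
        using L[OF True] by (subst nn_integral_eq_integral) auto
      then show ?thesis using True
        by (simp add: ennreal_mult' nn_integral_cmult)
    qed simp
  qed
  also have "\<dots> = ennreal (Gamma (q / a + 1) / q)"
    by (rule nn_integral_powr_exp_powr[OF q a])
  finally have *: "ennreal (Gamma q) * (\<integral>\<^sup>+ x. ennreal (x powr (- q)) \<partial>M) = ennreal (Gamma (q / a + 1) / q)" .
  have "(\<integral>\<^sup>+ x. ennreal (x powr (- q)) \<partial>M) =
      (ennreal (1 / Gamma q) * ennreal (Gamma q)) * (\<integral>\<^sup>+ x. ennreal (x powr (- q)) \<partial>M)"
    using G by (simp add: ennreal_mult'[symmetric])
  also have "\<dots> = ennreal (1 / Gamma q) * ennreal (Gamma (q / a + 1) / q)"
    by (simp add: * mult.assoc)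
  finally show ?thesis using G q by (simp add: ennreal_mult'[symmetric] mult.commute)
qed

text \<open>
  Expand the exponential. By the formula for negative moments, the term of order \<open>n\<close> has the integral
  \<open>(-z)\<^sup>n / \<Gamma>(an+a)\<close>, and the series of absolute values is again a convergent
  Mittag-Leffler series, so that sum and integral may be exchanged.
\<close>
lemma mittag_leffler_stable_mixture:
  fixes a z :: real
  assumes M: "real_distribution M" and pos: "AE x in M. 0 < x"
    and L: "\<And>k. k > 0 \<Longrightarrow> (LINT x|M. exp (- (k * x))) = exp (- (k powr a))"
    and a: "a > 0" and z: "z \<ge> 0"
  shows "(\<integral>\<^sup>+ x. ennreal (a * x powr (-a) * exp (- (z * x powr (-a)))) \<partial>M) = ennreal (mittag_leffler a a (- z))"
    and "0 \<le> mittag_leffler a a (- z)"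
proof -
  interpret real_distribution M by (rule M)
  have mom: "(\<integral>\<^sup>+ x. ennreal (a * x powr (-a) * (x powr (-a)) ^ n) \<partial>M) = ennreal (fact n / Gamma (a * real n + a))" for n
  proof -
    define q where "q = a * real n + a"
    have q: "q > 0" "q / a = real n + 1"
      using a by (auto simp: q_def field_simps intro: add_pos_nonneg)
    have G: "Gamma (q / a + 1) = fact (Suc n)"
      unfolding q(2) using Gamma_fact[of "Suc n", where 'a = real] by (simp add: add_ac)
    have "(\<integral>\<^sup>+ x. ennreal (a * x powr (-a) * (x powr (-a)) ^ n) \<partial>M) = (\<integral>\<^sup>+ x. ennreal a * ennreal (x powr (-q)) \<partial>M)"
      by (rule nn_integral_cong_AE, rule eventually_mono[OF pos])
        (use a in \<open>auto simp: q_def ennreal_mult'[symmetric] powr_realpow[symmetric] powr_powr powr_add[symmetric] algebra_simps\<close>)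
    also have "\<dots> = ennreal (a * (Gamma (q / a + 1) / (q * Gamma q)))"
      using stable_negative_moment[OF M pos L q(1) a] a
      by (subst nn_integral_cmult) (simp_all add: ennreal_mult'[symmetric])
    also have "a * (Gamma (q / a + 1) / (q * Gamma q)) = fact n / Gamma q"
    proof -
      have "q = a * (real n + 1)" by (simp add: q_def algebra_simps)
      moreover have "a * ((real n + 1) * f / (a * (real n + 1) * y)) = f / y" for f y :: real
      proof -
        have "a * (real n + 1) \<noteq> 0" using a by (simp add: add_nonneg_eq_0_iff)
        then show ?thesis by simp
      qed
      ultimately show ?thesis unfolding G by (simp add: add.commute)
    qed
    finally show ?thesis by (simp add: q_def)
  qed
  define g where "g n x = a * x powr (-a) * ((- (z * x powr (-a))) ^ n / fact n)" for n x
  have gm[measurable]: "g n \<in> borel_measurable borel" for n unfolding g_def by measurable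
  have Gpos: "Gamma (a * real n + a) > 0" for n using a by (intro Gamma_real_pos) (simp add: add_nonneg_pos)
  have gnn: "(\<integral>\<^sup>+ x. ennreal (norm (g n x)) \<partial>M) = ennreal (z ^ n / Gamma (a * real n + a))" for n
  proof -
    have "(\<integral>\<^sup>+ x. ennreal (norm (g n x)) \<partial>M) =
      (\<integral>\<^sup>+ x. ennreal (z ^ n / fact n) * ennreal (a * x powr (-a) * (x powr (-a)) ^ n) \<partial>M)"
      using a z by (intro nn_integral_cong)
        (simp add: g_def abs_mult power_abs ennreal_mult'[symmetric] power_mult_distrib mult_ac)
    also have "\<dots> = ennreal (z ^ n / fact n) * ennreal (fact n / Gamma (a * real n + a))"
      by (subst nn_integral_cmult) (auto simp: mom)
    finally show ?thesis using z Gpos[of n] by (simp add: ennreal_mult'[symmetric])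
  qed
  have gint: "integrable M (g n)" for n
  proof (rule integrableI_bounded)
    show "(\<integral>\<^sup>+ x. ennreal (norm (g n x)) \<partial>M) < \<infinity>" unfolding gnn by simp
  qed simp
  have gnorm: "(LINT x|M. norm (g n x)) = z ^ n / Gamma (a * real n + a)" for n
    using gnn[of n] gint[of n] Gpos[of n] z
    by (subst integral_eq_nn_integral) auto
  have gval: "(LINT x|M. g n x) = (- z) ^ n / Gamma (a * real n + a)" for n
  proof -
    have "(LINT x|M. g n x) = (LINT x|M. (-1) ^ n * norm (g n x))"
      using a z by (intro Bochner_Integration.integral_cong)
        (auto simp: g_def abs_mult power_abs power_minus[of "z * _"])
    also have "\<dots> = (-1) ^ n * (z ^ n / Gamma (a * real n + a))" using gnorm by simp
    finally show ?thesis by (simp add: power_minus[of z])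
  qed
  have gsum: "(\<lambda>n. g n x) sums (a * x powr (-a) * exp (- (z * x powr (-a))))" for x
    unfolding g_def using exp_converges[of "- (z * x powr (-a))"]
    by (intro sums_mult) (simp add: scaleR_conv_of_real divide_inverse mult.commute)
  have gsumn: "summable (\<lambda>n. norm (g n x))" for x
  proof -
    have "norm (g n x) = norm (a * x powr (-a)) * norm ((- (z * x powr (-a))) ^ n /\<^sub>R fact n)" for n
      by (simp add: g_def abs_mult divide_inverse)
    then show ?thesis
      using summable_mult[OF summable_norm_exp[of "- (z * x powr (-a))"]] by simp
  qed
  have sm: "summable (\<lambda>n. LINT x|M. norm (g n x))"
    unfolding gnorm by (rule summable_mittag_leffler[OF a])
  have I: "(\<lambda>n. LINT x|M. g n x) sums (LINT x|M. (\<Sum>n. g n x))"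
    by (rule sums_integral[OF gint _ sm]) (use gsumn in simp)
  have int: "integrable M (\<lambda>x. \<Sum>n. g n x)"
    by (rule integrable_suminf[OF gint _ sm]) (use gsumn in simp)
  have "(LINT x|M. (\<Sum>n. g n x)) = mittag_leffler a a (- z)"
    using I unfolding gval mittag_leffler_def by (simp add: sums_iff)
  moreover have eq: "(\<Sum>n. g n x) = a * x powr (-a) * exp (- (z * x powr (-a)))" for x
    using gsum[of x] by (simp add: sums_iff)
  ultimately have val: "(LINT x|M. a * x powr (-a) * exp (- (z * x powr (-a)))) = mittag_leffler a a (- z)"
    by simp
  show "0 \<le> mittag_leffler a a (- z)"
    unfolding val[symmetric] using a by (intro Bochner_Integration.integral_nonneg) auto
  show "(\<integral>\<^sup>+ x. ennreal (a * x powr (-a) * exp (- (z * x powr (-a)))) \<partial>M) = ennreal (mittag_leffler a a (- z))"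
    using int a unfolding val[symmetric] eq by (subst nn_integral_eq_integral) auto
qed

lemma powr_exp_bound:
  fixes w p :: real
  assumes "w > 0" "p > 0"
  shows "w powr p * exp (- w) \<le> p powr p"
proof -
  have "w / p \<le> exp (w / p)" using exp_ge_add_one_self[of "w / p"] by linarith
  then have "w \<le> p * exp (w / p)" using assms by (simp add: field_simps)
  then have "w powr p \<le> (p * exp (w / p)) powr p" using assms by (intro powr_mono2) auto
  also have "\<dots> = p powr p * exp w" using assms by (simp add: powr_mult exp_powr_real)
  finally show ?thesis by (simp add: exp_minus field_simps)
qed

lemma one_minus_exp_ge:
  fixes v :: real
  assumes "0 \<le> v" "v \<le> 1"
  shows "v / 2 \<le> 1 - exp (- v)"
proof -
  have "exp (- v) \<le> 1 / (1 + v)"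
    using exp_ge_add_one_self[of v] assms by (simp add: exp_minus field_simps)
  also have "\<dots> \<le> 1 - v / 2"
  proof -
    have "v * v \<le> v * 1" using assms by (intro mult_left_mono) auto
    then show ?thesis using assms by (simp add: field_simps)
  qed
  finally show ?thesis by simp
qed

text \<open>
  The left side is at most \<open>1\<close>, and for \<open>v \<ge> 1\<close> the right side is bounded below. For small \<open>v\<close> the
  left side vanishes faster than any power, while the right side is of order \<open>v\<close>.
\<close>
lemma wright_profile_upper:
  fixes a :: real
  assumes a: "a > 0"
  obtains C where "C > 0" "\<And>v. v > 0 \<Longrightarrow> v powr (-a) * exp (- (v powr (-a))) \<le> C * (1 - exp (- v))"
proof
  define p where "p = 1 + 1 / a"
  have p: "p > 0" using a by (simp add: p_def add_pos_pos)
  show "2 * p powr p + 2 > 0" by (simp add: add_nonneg_pos)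
  fix v :: real assume v: "v > 0"
  define w where "w = v powr (-a)"
  have w: "w > 0" "w powr (-1 / a) = v" using v a by (auto simp: w_def powr_powr)
  show "v powr (-a) * exp (- (v powr (-a))) \<le> (2 * p powr p + 2) * (1 - exp (- v))"
  proof (cases "v \<le> 1")
    case True
    have "w * exp (- w) = (w powr p * exp (- w)) * v"
    proof -
      have "w powr p * v = w powr (p + (-1 / a))" by (simp only: powr_add w(2))
      also have "\<dots> = w" using w(1) by (simp add: p_def)
      finally show ?thesis by (simp add: mult_ac)
    qed
    also have "\<dots> \<le> p powr p * v"
      using powr_exp_bound[OF w(1) p] v by (intro mult_right_mono) auto
    also have "\<dots> \<le> (2 * p powr p + 2) * (v / 2)" using v by (simp add: field_simps)
    also have "\<dots> \<le> (2 * p powr p + 2) * (1 - exp (- v))"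
      using one_minus_exp_ge[of v] v True by (intro mult_left_mono) (auto simp: add_nonneg_nonneg)
    finally show ?thesis by (simp add: w_def)
  next
    case False
    have "w * exp (- w) \<le> 1"
    proof -
      have "w \<le> exp w" using exp_ge_add_one_self[of w] by linarith
      then show ?thesis by (simp add: exp_minus field_simps)
    qed
    also have "1 \<le> 2 * (1 - exp (- v))"
    proof -
      have "exp (-v) \<le> exp (-1)" using False by simp
      also have "exp (-1) \<le> (1/2::real)" using one_minus_exp_ge[of 1] by simp
      finally show ?thesis by simp
    qed
    also have "\<dots> \<le> (2 * p powr p + 2) * (1 - exp (- v))" using v by (intro mult_right_mono) auto
    finally show ?thesis by (simp add: w_def)
  qed
qed

text \<open>
  In terms of \<open>v = x z powr (-1/a)\<close> the integrand of the mixture is, up to the factor \<open>a/z\<close>, the function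
  \<open>W(v) = v powr (-a) exp(-v powr (-a))\<close>. It is enclosed between combinations of exponentials
  \<open>exp(-kv)\<close>, whose means \<open>exp(-k\<^sup>a/z)\<close> are known. The combinations vanish at \<open>v = 0\<close>, so their
  means are of order \<open>1/z\<close>.
\<close>
lemma mittag_leffler_two_sided:
  fixes a :: real
  assumes a: "0 < a" "a < 1"
  obtains c C where "c > 0" "C > 0"
    "\<And>z. z > 0 \<Longrightarrow> mittag_leffler a a (- z) \<le> C * z powr (-2)"
    "\<And>z. z \<ge> 1 \<Longrightarrow> c * z powr (-2) \<le> mittag_leffler a a (- z)"
proof -
  obtain M where M: "real_distribution M" and pos: "AE x in M. 0 < x"
    and L: "\<And>k. k > 0 \<Longrightarrow> (LINT x|M. exp (- (k * x))) = exp (- (k powr a))"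
    using ex_stable_law[of a] a by auto
  interpret real_distribution M by (rule M)
  note mix = mittag_leffler_stable_mixture[OF M pos L a(1)]
  define W where "W v = v powr (-a) * exp (- (v powr (-a)))" for v :: real
  have Wm[measurable]: "W \<in> borel_measurable borel" unfolding W_def by measurable
  have Wn: "0 \<le> W v" for v by (simp add: W_def)
  have scaled: "(LINT x|M. W (z powr (-1/a) * x)) = z / a * mittag_leffler a a (- z)"
    "integrable M (\<lambda>x. W (z powr (-1/a) * x))" if z: "z > 0" for z
  proof -
    have "(\<integral>\<^sup>+ x. ennreal (W (z powr (-1/a) * x)) \<partial>M) =
      (\<integral>\<^sup>+ x. ennreal (z / a) * ennreal (a * x powr (-a) * exp (- (z * x powr (-a)))) \<partial>M)"
      by (rule nn_integral_cong_AE, rule eventually_mono[OF pos])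
        (use z a in \<open>auto simp: W_def powr_mult powr_powr ennreal_mult'[symmetric]\<close>)
    also have "\<dots> = ennreal (z / a * mittag_leffler a a (- z))"
      using mix[of z] z a by (subst nn_integral_cmult) (simp_all add: ennreal_mult'[symmetric])
    finally have I: "(\<integral>\<^sup>+ x. ennreal (W (z powr (-1/a) * x)) \<partial>M) = ennreal (z / a * mittag_leffler a a (- z))" .
    show "(LINT x|M. W (z powr (-1/a) * x)) = z / a * mittag_leffler a a (- z)"
      using I z a mix(2)[of z] by (subst integral_eq_nn_integral) (auto simp: Wn)
    show "integrable M (\<lambda>x. W (z powr (-1/a) * x))"
      using I by (intro integrableI_nonneg) (auto simp: Wn)
  qed
  have expint: "integrable M (\<lambda>x. exp (- (k * x)))" if "k > 0" for k
    by (rule integrable_const_bound[of _ 1]) (use pos that in \<open>auto elim!: eventually_mono\<close>)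
  have Lz: "(LINT x|M. exp (- (e * z powr (-1/a) * x))) = exp (- (e powr a / z))" if "z > 0" "e > 0" for e z
  proof -
    have "(z powr (-1/a)) powr a = 1 / z"
      unfolding powr_powr using a that by (simp add: powr_minus_divide)
    then show ?thesis using L[of "e * z powr (-1/a)"] that a by (simp add: powr_mult)
  qed
  obtain C where C: "C > 0" "\<And>v. v > 0 \<Longrightarrow> W v \<le> C * (1 - exp (- v))"
    using wright_profile_upper[OF a(1)] unfolding W_def by blast
  have upper: "mittag_leffler a a (- z) \<le> (a * C) * z powr (-2)" if z: "z > 0" for z
  proof -
    have "(LINT x|M. W (z powr (-1/a) * x)) \<le> (LINT x|M. C * (1 - exp (- (1 * z powr (-1/a) * x))))"
    proof (intro integral_mono_AE scaled(2)[OF z])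
      have "integrable M (\<lambda>x. 1 - exp (- (z powr (-1/a) * x)))"
        by (rule Bochner_Integration.integrable_diff[OF _ expint]) (use z in auto)
      then show "integrable M (\<lambda>x. C * (1 - exp (- (1 * z powr (-1/a) * x))))" by simp
      show "AE x in M. W (z powr (-1/a) * x) \<le> C * (1 - exp (- (1 * z powr (-1/a) * x)))"
        by (rule eventually_mono[OF pos]) (use C(2) z in auto)
    qed
    also have "\<dots> = C * (1 - exp (- (1 / z)))"
      using Lz[OF z, of 1] expint[of "z powr (-1/a)"] z prob_space by simp
    also have "\<dots> \<le> C * (1 / z)"
      using exp_ge_add_one_self[of "- (1 / z)"] C(1) by (intro mult_left_mono) auto
    finally have "z / a * mittag_leffler a a (- z) \<le> C * (1 / z)" unfolding scaled(1)[OF z] .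
    then show ?thesis using z a by (simp add: field_simps powr_minus power2_eq_square)
  qed
  \<comment> \<open>In the lower function \<open>\<phi>\<close> the last term makes \<open>\<phi> \<le> 0\<close> near \<open>v = 0\<close>, where \<open>W\<close> is tiny. Its
    mean is at most \<open>2 l powr (a-1) / z\<close>, which is small for large \<open>l\<close> because \<open>a < 1\<close>; the values
    chosen leave a mean of at least \<open>1 / (8 z)\<close>.\<close>
  define e where "e = (1 / 4) powr (1 / a)"
  define l where "l = 16 powr (1 / (1 - a))"
  have e: "e > 0" "e powr a = 1 / 4" "e < 1"
    using a powr_less_mono2[of "1/a" "1/4" 1] by (auto simp: e_def powr_powr)
  have l: "l > 0" "l powr (a - 1) = 1 / 16"
  proof -
    have "l powr (a - 1) = 16 powr (-1)"
      unfolding l_def powr_powr using a by (intro arg_cong[of _ _ "(powr) 16"]) (simp add: field_simps)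
    then show "l powr (a - 1) = 1 / 16" by (simp add: powr_minus)
  qed (simp add: l_def)
  define \<phi> where "\<phi> v = exp (- (e * v)) - exp (- (1 * v)) - 2 / l * (1 - exp (- (l * v)))" for v
  define D where "D = (1 + 1 / e) * exp (l powr a)"
  have D: "D > 0" using e by (simp add: D_def add_pos_pos)
  have \<phi>: "\<phi> v \<le> D * W v" if v: "v > 0" for v
  proof (cases "l * v \<le> 1")
    case True
    have "exp (- (e * v)) \<le> 1" using e v by simp
    moreover have "1 - exp (- v) \<le> v" using exp_ge_add_one_self[of "- v"] by simp
    moreover have "2 / l * (l * v / 2) \<le> 2 / l * (1 - exp (- (l * v)))"
      using one_minus_exp_ge[of "l * v"] True v l by (intro mult_left_mono) auto
    moreover have "2 / l * (l * v / 2) = v" using l by simp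
    ultimately have "\<phi> v \<le> 0" unfolding \<phi>_def mult_1 by linarith
    also have "0 \<le> D * W v" using D Wn by simp
    finally show ?thesis .
  next
    case False
    have "0 \<le> 2 / l * (1 - exp (- (l * v)))" using l v by simp
    then have "\<phi> v \<le> exp (- (e * v))"
      unfolding \<phi>_def mult_1 using exp_gt_zero[of "- v"] by linarith
    also have "\<dots> \<le> D * W v"
    proof -
      have va: "v powr a > 0" using v by simp
      have "v powr (-a) \<le> l powr a"
      proof -
        have "v powr (-a) \<le> (1 / l) powr (-a)" using False v l a
          by (intro powr_mono2') (auto simp: field_simps)
        then show ?thesis using l by (simp add: powr_divide powr_minus field_simps)
      qed
      then have w: "v powr (-a) * exp (- (l powr a)) \<le> W v" by (auto simp: W_def intro!: mult_left_mono)
      have "v powr a \<le> (1 + v) powr a" using v a by (intro powr_mono2) auto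
      also have "\<dots> \<le> (1 + v) powr 1" using v a by (intro powr_mono) auto
      also have "\<dots> \<le> (1 + 1 / e) * exp (e * v)"
      proof -
        have "e * v \<le> exp (e * v)" using exp_ge_add_one_self[of "e * v"] by linarith
        then have "v \<le> exp (e * v) / e" using e by (simp add: field_simps)
        moreover have "1 \<le> exp (e * v)" using e v by simp
        ultimately have "1 + v \<le> exp (e * v) + exp (e * v) / e" by linarith
        then show ?thesis using v by (simp add: algebra_simps)
      qed
      finally have "exp (- (e * v)) \<le> (1 + 1 / e) * v powr (-a)"
        using va by (simp add: exp_minus powr_minus divide_simps mult_ac)
      also have "\<dots> = D * (v powr (-a) * exp (- (l powr a)))" by (simp add: D_def exp_minus)
      also have "\<dots> \<le> D * W v" using w D by simp
      finally show ?thesis .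
    qed
    finally show ?thesis .
  qed
  have lower: "(a / (8 * D)) * z powr (-2) \<le> mittag_leffler a a (- z)" if z: "z \<ge> 1" for z
  proof -
    define y where "y = 1 / z"
    have y: "0 < y" "y \<le> 1" using z by (auto simp: y_def)
    define s where "s = z powr (-1/a)"
    have s: "s > 0" using z by (simp add: s_def)
    have k1: "y / 4 \<le> exp (- (y / 4)) - exp (- y)"
    proof -
      have "exp (-y) * (3 / 4 * y) \<le> exp (- y) * (exp (3 / 4 * y) - 1)"
      proof (rule mult_left_mono)
        show "3 / 4 * y \<le> exp (3 / 4 * y) - 1" using exp_ge_add_one_self[of "3 / 4 * y"] by linarith
      qed simp
      also have "\<dots> = exp (- (y / 4)) - exp (- y)" by (simp add: algebra_simps exp_add[symmetric])
      finally have "exp (-y) * (3 / 4 * y) \<le> exp (- (y / 4)) - exp (- y)" .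
      moreover have "1 / 3 \<le> exp (- y)"
      proof -
        have "exp y \<le> exp 1" using y by simp
        also have "\<dots> \<le> 3" by (rule exp_le)
        finally show ?thesis by (simp add: exp_minus field_simps)
      qed
      then have "1 / 3 * (3 / 4 * y) \<le> exp (-y) * (3 / 4 * y)" using y by (intro mult_right_mono) auto
      ultimately show ?thesis by simp
    qed
    have k2: "2 / l * (1 - exp (- (l powr a * y))) \<le> y / 8"
    proof -
      have "2 / l * (1 - exp (- (l powr a * y))) \<le> 2 / l * (l powr a * y)"
        using exp_ge_add_one_self[of "- (l powr a * y)"] l by (intro mult_left_mono) auto
      also have "\<dots> = 2 * l powr (a - 1) * y" using l by (simp add: powr_diff)
      finally show ?thesis using l by simp
    qed
    have "y / 8 \<le> exp (- (y / 4)) - exp (- y) - 2 / l * (1 - exp (- (l powr a * y)))"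
      using k1 k2 by simp
    also have "\<dots> = (LINT x|M. \<phi> (s * x))"
      using Lz[of z e] Lz[of z 1] Lz[of z l] z e l s expint[of "e * s"] expint[of s] expint[of "l * s"] prob_space
      by (simp add: \<phi>_def y_def s_def mult.assoc)
    also have "\<dots> \<le> (LINT x|M. D * W (s * x))"
    proof (rule integral_mono_AE)
      show "integrable M (\<lambda>x. \<phi> (s * x))"
        using expint[of "e * s"] expint[of s] expint[of "l * s"] e l s by (simp add: \<phi>_def mult.assoc)
      show "integrable M (\<lambda>x. D * W (s * x))" using scaled(2)[of z] z by (simp add: s_def)
      show "AE x in M. \<phi> (s * x) \<le> D * W (s * x)"
        by (rule eventually_mono[OF pos]) (use s \<phi> in auto)
    qed
    also have "\<dots> = D * (z / a * mittag_leffler a a (- z))"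
      using scaled(1)[of z] z by (simp add: s_def)
    finally have "y / 8 \<le> D * (z / a * mittag_leffler a a (- z))" .
    then show ?thesis using z D a by (simp add: y_def field_simps powr_minus power2_eq_square)
  qed
  show ?thesis
    by (rule that[of "a / (8 * D)" "a * C"]) (use a C(1) D upper lower in auto)
qed

text \<open>
  Condition on the \<open>\<alpha>\<close>-stable variable \<open>x\<close>: averaging over the independent \<open>\<beta>\<close>-stable variable
  \<open>s\<close> turns \<open>exp(-k x powr (-\<alpha>/\<beta>) s)\<close> into \<open>exp(-k\<^sup>\<beta> x powr (-\<alpha>))\<close>, the integrand of the mixture
  at \<open>z = k\<^sup>\<beta>\<close>. Index \<open>\<beta> = 1\<close> is included; the stable law is then the unit mass at \<open>1\<close>.
\<close>
lemma ex_mixing_measure: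
  fixes \<alpha> \<beta> :: real
  assumes \<alpha>: "0 < \<alpha>" "\<alpha> \<le> 1" and \<beta>: "0 < \<beta>" "\<beta> \<le> 1"
  shows "\<exists>m :: real measure. sets m = sets borel \<and> (AE r in m. 0 < r) \<and>
    (\<forall>k\<ge>0. (\<integral>\<^sup>+ r. ennreal (exp (- (k * r))) \<partial>m) = ennreal (mittag_leffler \<alpha> \<alpha> (- (k powr \<beta>))))"
proof -
  obtain A where A: "real_distribution A" and Apos: "AE x in A. 0 < x"
    and LA: "\<And>k. k > 0 \<Longrightarrow> (LINT x|A. exp (- (k * x))) = exp (- (k powr \<alpha>))"
    using ex_stable_law[OF \<alpha>] by auto
  obtain B where B: "real_distribution B" and Bpos: "AE x in B. 0 < x"
    and LB: "\<And>k. k > 0 \<Longrightarrow> (LINT x|B. exp (- (k * x))) = exp (- (k powr \<beta>))"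
    using ex_stable_law[OF \<beta>] by auto
  interpret A: real_distribution A by (rule A)
  interpret B: real_distribution B by (rule B)
  interpret AB: pair_prob_space A B ..
  define P where "P = density (A \<Otimes>\<^sub>M B) (\<lambda>(x, s). ennreal (\<alpha> * x powr (-\<alpha>)))"
  define T where "T = (\<lambda>(x, s). x powr (-\<alpha>/\<beta>) * s :: real)"
  have [measurable]: "T \<in> borel_measurable (A \<Otimes>\<^sub>M B)" "T \<in> borel_measurable P"
    unfolding T_def P_def by measurable
  have both: "AE \<omega> in A \<Otimes>\<^sub>M B. 0 < fst \<omega> \<and> 0 < snd \<omega>"
  proof -
    have "AE \<omega> in A \<Otimes>\<^sub>M B. 0 < fst \<omega>" by (rule AB.AE_pair_measure) (measurable, auto intro!: eventually_mono[OF Apos])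
    moreover have "AE \<omega> in A \<Otimes>\<^sub>M B. 0 < snd \<omega>" by (rule AB.AE_pair_measure) (measurable, use Bpos in auto)
    ultimately show ?thesis by eventually_elim auto
  qed
  show ?thesis
  proof (intro exI[of _ "distr P borel T"] conjI allI impI)
    have "AE \<omega> in P. 0 < T \<omega>"
      unfolding P_def by (subst AE_density) (auto intro!: eventually_mono[OF both] simp: T_def case_prod_unfold)
    then show "AE r in distr P borel T. 0 < r" by (subst AE_distr_iff) auto
    fix k :: real assume k: "k \<ge> 0"
    have "(\<integral>\<^sup>+ r. ennreal (exp (- (k * r))) \<partial>distr P borel T) =
      (\<integral>\<^sup>+ \<omega>. ennreal (\<alpha> * fst \<omega> powr (-\<alpha>)) * ennreal (exp (- (k * fst \<omega> powr (-\<alpha>/\<beta>) * snd \<omega>))) \<partial>(A \<Otimes>\<^sub>M B))"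
      by (simp add: nn_integral_distr) (simp add: P_def nn_integral_density case_prod_unfold T_def mult.assoc)
    also have "\<dots> = (\<integral>\<^sup>+ x. \<integral>\<^sup>+ s. ennreal (\<alpha> * x powr (-\<alpha>)) * ennreal (exp (- (k * x powr (-\<alpha>/\<beta>) * s))) \<partial>B \<partial>A)"
      by (subst B.nn_integral_fst[symmetric]) auto
    also have "\<dots> = (\<integral>\<^sup>+ x. ennreal (\<alpha> * x powr (-\<alpha>) * exp (- (k powr \<beta> * x powr (-\<alpha>)))) \<partial>A)"
    proof (rule nn_integral_cong_AE, rule eventually_mono[OF Apos])
      fix x :: real assume x: "0 < x"
      have "(\<integral>\<^sup>+ s. ennreal (exp (- (k * x powr (-\<alpha>/\<beta>) * s))) \<partial>B) = ennreal (exp (- (k powr \<beta> * x powr (-\<alpha>))))"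
      proof (cases "k = 0")
        case True
        then show ?thesis using B.emeasure_space_1 by simp
      next
        case False
        then have k': "k * x powr (-\<alpha>/\<beta>) > 0" using k x by simp
        have "integrable B (\<lambda>s. exp (- (k * x powr (-\<alpha>/\<beta>) * s)))"
          by (rule B.integrable_const_bound[of _ 1])
            (use Bpos k' in \<open>auto elim!: eventually_mono\<close>)
        then show ?thesis using LB[OF k'] x k False \<beta>
          by (subst nn_integral_eq_integral) (auto simp: powr_mult powr_powr)
      qed
      then show "(\<integral>\<^sup>+ s. ennreal (\<alpha> * x powr (-\<alpha>)) * ennreal (exp (- (k * x powr (-\<alpha>/\<beta>) * s))) \<partial>B) =
        ennreal (\<alpha> * x powr (-\<alpha>) * exp (- (k powr \<beta> * x powr (-\<alpha>))))"
        using \<alpha> by (subst nn_integral_cmult) (auto simp: ennreal_mult'[symmetric])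
    qed
    also have "\<dots> = ennreal (mittag_leffler \<alpha> \<alpha> (- (k powr \<beta>)))"
      by (rule mittag_leffler_stable_mixture(1)[OF A Apos LA \<alpha>(1)]) auto
    finally show "(\<integral>\<^sup>+ r. ennreal (exp (- (k * r))) \<partial>distr P borel T) =
      ennreal (mittag_leffler \<alpha> \<alpha> (- (k powr \<beta>)))" .
  qed simp
qed

section \<open>Gaussians and the injectivity of the Fourier transform\<close>

definition heat :: "real \<Rightarrow> 'a::euclidean_space \<Rightarrow> real" where
  "heat s x = (4 * pi * s) powr (- real DIM('a) / 2) * exp (- (norm x)\<^sup>2 / (4 * s))"

lemma heat_measurable [measurable]: "heat s \<in> borel_measurable borel"
  unfolding heat_def by measurable

lemma heat_nonneg: "0 \<le> heat s x"
  by (simp add: heat_def)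

lemma fourier_normal_density:
  fixes t s :: real
  assumes s: "s > 0"
  shows "(CLINT u|lborel. exp (- (\<i> * of_real (u * t))) * of_real (normal_density 0 (sqrt (2 * s)) u))
    = of_real (exp (- (s * t\<^sup>2)))"
    and "integrable lborel (\<lambda>u. exp (- (\<i> * of_real (u * t))) * complex_of_real (normal_density 0 (sqrt (2 * s)) u))"
proof -
  define \<sigma> where "\<sigma> = sqrt (2 * s)"
  have \<sigma>: "\<sigma> > 0" "\<sigma>\<^sup>2 = 2 * s" using s by (auto simp: \<sigma>_def)
  have nd: "normal_density 0 \<sigma> (\<sigma> * v) = std_normal_density v / \<sigma>" for v
    using \<sigma>(1) by (simp add: normal_density_def power_mult_distrib real_sqrt_mult)
  show int: "integrable lborel (\<lambda>u. exp (- (\<i> * of_real (u * t))) * complex_of_real (normal_density 0 (sqrt (2 * s)) u))"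
  proof (rule Bochner_Integration.integrable_bound)
    show "integrable lborel (normal_density 0 \<sigma>)" using \<sigma> by (intro integrable_normal_density) auto
  qed (auto simp: norm_mult \<sigma>_def)
  have "(CLINT u|lborel. exp (- (\<i> * of_real (u * t))) * of_real (normal_density 0 \<sigma> u)) =
    \<sigma> *\<^sub>R (CLINT v|lborel. exp (- (\<i> * of_real ((0 + \<sigma> * v) * t))) * of_real (normal_density 0 \<sigma> (0 + \<sigma> * v)))"
    using \<sigma>(1) by (subst lborel_integral_real_affine[where c = \<sigma> and t = 0]) auto
  also have "\<dots> = (CLINT v|lborel. \<sigma> *\<^sub>R (exp (- (\<i> * of_real (\<sigma> * v * t))) * of_real (std_normal_density v / \<sigma>)))"
    by (subst Bochner_Integration.integral_scaleR_right) (simp add: nd)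
  also have "\<dots> = (CLINT v|lborel. std_normal_density v *\<^sub>R iexp ((- (\<sigma> * t)) * v))"
    using \<sigma>(1) by (intro Bochner_Integration.integral_cong)
      (auto simp: scaleR_conv_of_real mult_ac)
  also have "\<dots> = char std_normal_distribution (- (\<sigma> * t))"
    unfolding char_def by (subst integral_density) (auto simp: normal_density_nonneg)
  also have "\<dots> = of_real (exp (- (s * t\<^sup>2)))"
    by (simp add: char_std_normal_distribution power_mult_distrib \<sigma>(2))
  finally show "(CLINT u|lborel. exp (- (\<i> * of_real (u * t))) * of_real (normal_density 0 (sqrt (2 * s)) u))
    = of_real (exp (- (s * t\<^sup>2)))" by (simp add: \<sigma>_def)
qed

lemma norm_square_eq_sum_Basis: "(norm x)\<^sup>2 = (\<Sum>b\<in>Basis. (x \<bullet> b)\<^sup>2)"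
  unfolding power2_norm_eq_inner by (subst euclidean_inner) (simp add: power2_eq_square)

lemma heat_eq_prod:
  fixes x :: "'a::euclidean_space"
  assumes s: "s > 0"
  shows "heat s x = (\<Prod>b\<in>Basis. normal_density 0 (sqrt (2 * s)) (x \<bullet> b))"
proof -
  have nd: "normal_density 0 (sqrt (2 * s)) u = (1 / sqrt (4 * pi * s)) * exp (- u\<^sup>2 / (4 * s))" for u
    using s by (simp add: normal_density_def)
  have "(\<Prod>b\<in>(Basis :: 'a set). normal_density 0 (sqrt (2 * s)) (x \<bullet> b)) =
    (1 / sqrt (4 * pi * s)) ^ DIM('a) * exp (\<Sum>b\<in>Basis. - (x \<bullet> b)\<^sup>2 / (4 * s))"
    unfolding nd prod.distrib prod_constant by (subst exp_sum) auto
  also have "(\<Sum>b\<in>Basis. - (x \<bullet> b)\<^sup>2 / (4 * s)) = - (norm x)\<^sup>2 / (4 * s)"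
    unfolding norm_square_eq_sum_Basis sum_negf[symmetric] sum_divide_distrib[symmetric] ..
  also have "(1 / sqrt (4 * pi * s)) ^ DIM('a) = (4 * pi * s) powr (- real DIM('a) / 2)"
  proof -
    have "1 / sqrt (4 * pi * s) = (4 * pi * s) powr (- 1 / 2)"
      using s by (simp add: powr_half_sqrt[symmetric] powr_minus_divide)
    then show ?thesis using s by (simp add: powr_realpow[symmetric] powr_powr)
  qed
  finally show ?thesis by (simp add: heat_def)
qed

lemma fourier_heat:
  fixes \<xi> :: "'a::euclidean_space"
  assumes s: "s > 0"
  shows "(CLINT x|lborel. exp (- (\<i> * of_real (x \<bullet> \<xi>))) * of_real (heat s x)) = of_real (exp (- (s * (norm \<xi>)\<^sup>2)))"
    and "integrable lborel (\<lambda>x. exp (- (\<i> * of_real (x \<bullet> \<xi>))) * complex_of_real (heat s x))"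
proof -
  let ?g = "\<lambda>b u. exp (- (\<i> * of_real (u * (\<xi> \<bullet> b)))) * complex_of_real (normal_density 0 (sqrt (2 * s)) u)"
  let ?F = "\<lambda>x::'a. exp (- (\<i> * of_real (x \<bullet> \<xi>))) * complex_of_real (heat s x)"
  let ?T = "\<lambda>f. \<Sum>b\<in>(Basis::'a set). f b *\<^sub>R b"
  interpret product_sigma_finite "\<lambda>b::'a. lborel :: real measure" ..
  have prod: "?F (?T f) = (\<Prod>b\<in>Basis. ?g b (f b))" for f
  proof -
    have "?T f \<bullet> \<xi> = (\<Sum>b\<in>Basis. f b * (\<xi> \<bullet> b))"
      by (simp only: inner_sum_left inner_scaleR_left inner_commute[of \<xi>])
    moreover have "?T f \<bullet> b = f b" if "b \<in> Basis" for b using that by simp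
    ultimately show ?thesis
      by (simp add: heat_eq_prod[OF s] prod.distrib exp_sum[symmetric] sum_distrib_left sum_negf del: inner_sum_left_Basis)
  qed
  have Tm: "?T \<in> measurable (\<Pi>\<^sub>M b\<in>Basis. lborel) borel" by measurable
  have Fm: "?F \<in> borel_measurable borel" by measurable
  have "integrable (\<Pi>\<^sub>M b\<in>(Basis::'a set). lborel) (\<lambda>f. \<Prod>b\<in>Basis. ?g b (f b))"
    by (intro product_integrable_prod fourier_normal_density(2)[OF s]) auto
  then show "integrable lborel ?F"
    by (subst lborel_eq) (subst integrable_distr_eq[OF Tm Fm], simp only: prod)
  have "(CLINT x|lborel. ?F x) = (CLINT f|(\<Pi>\<^sub>M b\<in>(Basis::'a set). lborel). ?F (?T f))"
    by (subst lborel_eq) (rule integral_distr[OF Tm Fm])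
  also have "\<dots> = (\<Prod>b\<in>Basis. CLINT u|lborel. ?g b u)"
    unfolding prod by (intro product_integral_prod fourier_normal_density(2)[OF s]) auto
  also have "\<dots> = (\<Prod>b\<in>Basis. of_real (exp (- (s * (\<xi> \<bullet> b)\<^sup>2))))"
    by (intro prod.cong refl fourier_normal_density(1)[OF s])
  also have "\<dots> = of_real (exp (- (s * (norm \<xi>)\<^sup>2)))"
  proof -
    have "(norm \<xi>)\<^sup>2 = (\<Sum>b\<in>Basis. (\<xi> \<bullet> b)\<^sup>2)"
      by (rule norm_square_eq_sum_Basis)
    then show ?thesis
      by (simp add: exp_sum[symmetric] sum_distrib_left sum_negf del: of_real_exp flip: of_real_prod)
  qed
  finally show "(CLINT x|lborel. ?F x) = of_real (exp (- (s * (norm \<xi>)\<^sup>2)))" .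
qed

lemma heat_integral:
  assumes s: "s > 0"
  shows "integrable lborel (heat s :: 'a::euclidean_space \<Rightarrow> real)" "(LINT x|lborel. heat s (x::'a)) = 1"
    and "(\<integral>\<^sup>+ x. ennreal (heat s (x::'a)) \<partial>lborel) = 1"
proof -
  have "integrable lborel (\<lambda>x::'a. complex_of_real (heat s x))"
    using fourier_heat(2)[OF s, of 0] by simp
  then show i: "integrable lborel (heat s :: 'a \<Rightarrow> real)"
    by (simp add: complex_of_real_integrable_eq)
  have "complex_of_real (LINT x|lborel. heat s (x::'a)) = 1"
    using fourier_heat(1)[OF s, of 0] by simp
  then show v: "(LINT x|lborel. heat s (x::'a)) = 1" by (simp only: of_real_eq_1_iff)
  show "(\<integral>\<^sup>+ x. ennreal (heat s (x::'a)) \<partial>lborel) = 1"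
    using i v by (subst nn_integral_eq_integral) (auto simp: heat_nonneg)
qed

text \<open>
  A Gaussian is, up to a constant, the Fourier transform of another Gaussian. This lets the Fourier
  transform of \<open>h\<close> appear in the Gaussian means of \<open>h\<close>.
\<close>
lemma heat_self_dual:
  fixes w :: "'a::euclidean_space"
  assumes e: "e > 0"
  shows "complex_of_real (heat e w) = of_real ((4 * pi * e) powr (- real DIM('a) / 2)) *
    (CLINT \<xi>|lborel. exp (- (\<i> * of_real (\<xi> \<bullet> w))) * of_real (heat (1 / (4 * e)) \<xi>))"
  using fourier_heat(1)[of "1 / (4 * e)" w] e by (simp add: heat_def flip: of_real_mult)

lemma integral_heat_eq_0_of_fourier_eq_0:
  fixes h :: "'a::euclidean_space \<Rightarrow> real"
  assumes h: "integrable lborel h"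
    and F: "\<And>\<xi>. (CLINT x|lborel. exp (- (\<i> * of_real (x \<bullet> \<xi>))) * of_real (h x)) = 0"
    and e: "e > 0"
  shows "(LINT y|lborel. h y * heat e (z - y)) = 0"
proof -
  define s where "s = 1 / (4 * e)"
  have s: "s > 0" using e by (simp add: s_def)
  define K where "K = complex_of_real ((4 * pi * e) powr (- real DIM('a) / 2))"
  note [measurable] = borel_measurable_integrable[OF h]
  let ?k = "\<lambda>y \<xi>. complex_of_real (h y) * (exp (- (\<i> * of_real (\<xi> \<bullet> (z - y)))) * of_real (heat s \<xi>))"
  have int: "integrable (lborel \<Otimes>\<^sub>M lborel) (\<lambda>(y, \<xi>). ?k y \<xi>)"
  proof (rule lborel_pair.Fubini_integrable)
    show "(\<lambda>(y, \<xi>). ?k y \<xi>) \<in> borel_measurable (lborel \<Otimes>\<^sub>M lborel)" by measurable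
    have "(LINT \<xi>|lborel. norm (case (y, \<xi>) of (y, \<xi>) \<Rightarrow> ?k y \<xi>)) = \<bar>h y\<bar>" for y
      by (simp add: norm_mult heat_nonneg heat_integral(2)[OF s])
    then show "integrable lborel (\<lambda>y. LINT \<xi>|lborel. norm (case (y, \<xi>) of (y, \<xi>) \<Rightarrow> ?k y \<xi>))"
      using h by simp
    show "AE y in lborel. integrable lborel (\<lambda>\<xi>. case (y, \<xi>) of (y, \<xi>) \<Rightarrow> ?k y \<xi>)"
      unfolding prod.case by (intro AE_I2 integrable_mult_right fourier_heat(2)[OF s])
  qed
  have "complex_of_real (LINT y|lborel. h y * heat e (z - y)) = (CLINT y|lborel. of_real (h y) * of_real (heat e (z - y)))"
    by (simp flip: of_real_mult)
  also have "\<dots> = (CLINT y|lborel. K * (CLINT \<xi>|lborel. ?k y \<xi>))"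
    by (simp add: heat_self_dual[OF e] K_def s_def mult_ac)
  also have "\<dots> = K * (CLINT y|lborel. CLINT \<xi>|lborel. ?k y \<xi>)" by simp
  also have "(CLINT y|lborel. CLINT \<xi>|lborel. ?k y \<xi>) = (CLINT \<xi>|lborel. CLINT y|lborel. ?k y \<xi>)"
    using lborel_pair.Fubini_integral[of ?k] int by simp
  also have "\<dots> = (CLINT \<xi>|lborel. (exp (- (\<i> * of_real (\<xi> \<bullet> z))) * of_real (heat s \<xi>)) *
      (CLINT y|lborel. exp (- (\<i> * of_real (y \<bullet> (- \<xi>)))) * of_real (h y)))"
  proof (intro Bochner_Integration.integral_cong refl)
    fix \<xi> :: 'a
    have "?k y \<xi> = (exp (- (\<i> * of_real (\<xi> \<bullet> z))) * of_real (heat s \<xi>)) *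
        (exp (- (\<i> * of_real (y \<bullet> (- \<xi>)))) * of_real (h y))" for y
    proof -
      have "exp (- (\<i> * of_real (\<xi> \<bullet> (z - y)))) = exp (- (\<i> * of_real (\<xi> \<bullet> z))) * exp (- (\<i> * complex_of_real (y \<bullet> (- \<xi>))))"
        unfolding exp_add[symmetric] by (simp add: inner_diff_right inner_commute[of y] right_diff_distrib)
      then show ?thesis by (simp only: mult_ac)
    qed
    then show "(CLINT y|lborel. ?k y \<xi>) = (exp (- (\<i> * of_real (\<xi> \<bullet> z))) * of_real (heat s \<xi>)) *
      (CLINT y|lborel. exp (- (\<i> * of_real (y \<bullet> (- \<xi>)))) * of_real (h y))"
      by (simp only: integral_mult_right_zero)
  qed
  also have "\<dots> = 0" unfolding F by simp
  finally show ?thesis by simp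
qed

text \<open>
  Integrate the vanishing Gaussian means of \<open>h\<close> over the box. By Fubini this is the integral of
  \<open>h\<close> times the Gaussian means \<open>\<psi> n\<close> of the indicator of the box, which converge to the indicator off
  the boundary of the box.
\<close>
lemma integral_box_eq_0_of_fourier_eq_0:
  fixes h :: "'a::euclidean_space \<Rightarrow> real"
  assumes h: "integrable lborel h"
    and F: "\<And>\<xi>. (CLINT x|lborel. exp (- (\<i> * of_real (x \<bullet> \<xi>))) * of_real (h x)) = 0"
  shows "(LINT y|lborel. h y * indicator (box a b) y) = 0"
proof -
  note [measurable] = borel_measurable_integrable[OF h]
  define \<delta> where "\<delta> n = 1 / real (Suc n)" for n
  have \<delta>: "\<delta> n > 0" "\<delta> \<longlonglongrightarrow> 0" for n
    unfolding \<delta>_def using LIMSEQ_inverse_real_of_nat by (auto simp: inverse_eq_divide)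
  define \<psi> where "\<psi> n y = (LINT w|lborel. heat 1 w * indicator (box a b) (y + \<delta> n *\<^sub>R w))" for n and y :: 'a
  have \<psi>m[measurable]: "\<psi> n \<in> borel_measurable borel" for n
    unfolding \<psi>_def by measurable
  have \<psi>_bound: "norm (\<psi> n y) \<le> 1" for n y
  proof -
    have "norm (\<psi> n y) \<le> (LINT w|lborel. norm (heat 1 w * indicator (box a b) (y + \<delta> n *\<^sub>R w)))"
      unfolding \<psi>_def by (rule integral_norm_bound)
    also have "\<dots> \<le> (LINT w|lborel. heat 1 (w :: 'a))"
      by (rule integral_mono') (auto simp: heat_integral heat_nonneg indicator_def)
    finally show ?thesis by (simp add: heat_integral)
  qed
  \<comment> \<open>The same mean after the substitution \<open>z = y + \<delta> w\<close>, in the form needed for Fubini.\<close>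
  have \<psi>_alt: "\<psi> n y = (LINT z|lborel. indicator (box a b) z * heat ((\<delta> n)\<^sup>2) (z - y))" for n y
  proof -
    have d: "\<delta> n \<noteq> 0" using \<delta>(1)[of n] by simp
    have hs: "(\<delta> n) ^ DIM('a) * heat ((\<delta> n)\<^sup>2) (\<delta> n *\<^sub>R w) = heat 1 w" for w :: 'a
    proof -
      have "(4 * pi * (\<delta> n)\<^sup>2) powr (- real DIM('a) / 2) = (4 * pi) powr (- real DIM('a) / 2) * ((\<delta> n)\<^sup>2) powr (- real DIM('a) / 2)"
        by (simp add: powr_mult)
      also have "((\<delta> n)\<^sup>2) powr (- real DIM('a) / 2) = 1 / (\<delta> n) ^ DIM('a)"
      proof -
        have "((\<delta> n)\<^sup>2) powr (- real DIM('a) / 2) = \<delta> n powr (- real DIM('a))"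
          using \<delta>(1)[of n] by (simp add: powr_powr flip: powr_numeral)
        then show ?thesis using \<delta>(1)[of n] by (simp add: powr_minus_divide powr_realpow)
      qed
      finally show ?thesis using d
        by (simp add: heat_def power_mult_distrib)
    qed
    have "(LINT z|lborel. indicator (box a b) z * heat ((\<delta> n)\<^sup>2) (z - y)) =
      (LINT z|density (distr lborel borel (\<lambda>x. y + \<delta> n *\<^sub>R x)) (\<lambda>_. \<bar>\<delta> n\<bar> ^ DIM('a)).
        indicator (box a b) z * heat ((\<delta> n)\<^sup>2) (z - y))"
      by (subst lborel_affine[OF d, of y]) simp
    also have "\<dots> = (LINT w|lborel. (\<delta> n) ^ DIM('a) *
        (indicator (box a b) (y + \<delta> n *\<^sub>R w) * heat ((\<delta> n)\<^sup>2) (\<delta> n *\<^sub>R w)))"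
      using \<delta>(1)[of n] by (subst integral_density) (auto simp: integral_distr less_imp_le)
    also have "\<dots> = \<psi> n y"
      unfolding \<psi>_def by (intro Bochner_Integration.integral_cong refl) (simp add: hs[symmetric] mult_ac)
    finally show ?thesis ..
  qed
  have zero: "(LINT y|lborel. h y * \<psi> n y) = 0" for n
  proof -
    have e: "(\<delta> n)\<^sup>2 > 0" using \<delta>(1)[of n] by simp
    let ?k = "\<lambda>y z. h y * (indicator (box a b) z * heat ((\<delta> n)\<^sup>2) (z - y))"
    have int: "integrable (lborel \<Otimes>\<^sub>M lborel) (\<lambda>(z, y). ?k y z)"
    proof (rule lborel_pair.integrable_product_swap_iff[THEN iffD1], simp, rule lborel_pair.Fubini_integrable)
      show "(\<lambda>(y, z). ?k y z) \<in> borel_measurable (lborel \<Otimes>\<^sub>M lborel)" by measurable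
      have hi: "integrable lborel (\<lambda>z. indicator (box a b) z * heat ((\<delta> n)\<^sup>2) (z - y))" for y
      proof -
        have "integrable lborel (\<lambda>z. heat ((\<delta> n)\<^sup>2) (z - y))"
          using integrable_distr[of "(+) (- y)" lborel borel "heat ((\<delta> n)\<^sup>2)"] heat_integral(1)[OF e]
          by (simp add: lborel_distr_plus)
        then show ?thesis by (rule Bochner_Integration.integrable_bound) (auto simp: indicator_def heat_nonneg)
      qed
      then show "AE y in lborel. integrable lborel (\<lambda>z. case (y, z) of (y, z) \<Rightarrow> ?k y z)" by simp
      have "(LINT z|lborel. norm (?k y z)) = \<bar>h y\<bar> * \<psi> n y" for y
        by (simp add: abs_mult \<psi>_alt heat_nonneg)
      then show "integrable lborel (\<lambda>y. LINT z|lborel. norm (case (y, z) of (y, z) \<Rightarrow> ?k y z))"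
        using h \<psi>_bound[of n]
        by simp (rule Bochner_Integration.integrable_bound[OF h], auto simp: abs_mult intro!: mult_right_le_one_le)
    qed
    have "(LINT y|lborel. h y * \<psi> n y) = (LINT y|lborel. LINT z|lborel. ?k y z)"
      by (simp add: \<psi>_alt)
    also have "\<dots> = (LINT z|lborel. LINT y|lborel. ?k y z)"
      using lborel_pair.Fubini_integral[of "\<lambda>z y. ?k y z"] int by simp
    also have "\<dots> = (LINT z|lborel. indicator (box a b) z * (LINT y|lborel. h y * heat ((\<delta> n)\<^sup>2) (z - y)))"
      by (subst integral_mult_right_zero[symmetric]) (simp add: mult_ac)
    also have "\<dots> = 0"
      by (simp add: integral_heat_eq_0_of_fourier_eq_0[OF h F e])
    finally show ?thesis .
  qed
  have conv: "(\<lambda>n. \<psi> n y) \<longlonglongrightarrow> indicator (box a b) y" if y: "y \<notin> frontier (box a b)" for y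
  proof -
    have "(\<lambda>n. LINT w|lborel. heat 1 w * indicator (box a b) (y + \<delta> n *\<^sub>R w)) \<longlonglongrightarrow>
      (LINT w|lborel. heat 1 (w :: 'a) * indicator (box a b) y)"
    proof (rule integral_dominated_convergence[where w = "heat 1 :: 'a \<Rightarrow> real"])
      show "AE w in lborel. (\<lambda>n. heat 1 w * indicator (box a b) (y + \<delta> n *\<^sub>R w)) \<longlonglongrightarrow> heat 1 w * indicator (box a b) y"
      proof (intro AE_I2 tendsto_mult tendsto_const)
        fix w :: 'a
        have lim: "(\<lambda>n. y + \<delta> n *\<^sub>R w) \<longlonglongrightarrow> y"
          using tendsto_add[OF tendsto_const[of y] tendsto_scaleR[OF \<delta>(2) tendsto_const[of w]]] by simp
        have "isCont (indicator (box a b) :: 'a \<Rightarrow> real) y"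
          using y by (simp add: isCont_indicator)
        then show "(\<lambda>n. indicator (box a b) (y + \<delta> n *\<^sub>R w) :: real) \<longlonglongrightarrow> indicator (box a b) y"
          by (rule isCont_tendsto_compose[OF _ lim])
      qed
    qed (auto simp: heat_integral heat_nonneg indicator_def)
    then show ?thesis by (simp add: \<psi>_def heat_integral)
  qed
  have "(\<lambda>n. LINT y|lborel. h y * \<psi> n y) \<longlonglongrightarrow> (LINT y|lborel. h y * indicator (box a b) y)"
  proof (rule integral_dominated_convergence[where w = "\<lambda>y. \<bar>h y\<bar>"])
    have "frontier (box a b) \<in> null_sets lborel"
      using negligible_convex_frontier[OF convex_box(2)[of a b]]
      by (subst null_sets_completion_iff[symmetric]) (auto simp: negligible_iff_null_sets)
    then have "AE y in lborel. y \<notin> frontier (box a b)" by (rule AE_not_in)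
    then show "AE y in lborel. (\<lambda>n. h y * \<psi> n y) \<longlonglongrightarrow> h y * indicator (box a b) y"
      by eventually_elim (intro tendsto_mult tendsto_const conv)
    show "AE y in lborel. norm (h y * \<psi> n y) \<le> \<bar>h y\<bar>" for n
      using \<psi>_bound[of n] by (auto simp: abs_mult intro!: mult_right_le_one_le)
  qed (use h in auto)
  then show ?thesis by (simp add: zero LIMSEQ_const_iff)
qed

text \<open>
  The positive and the negative part of \<open>h\<close> are densities of finite measures that agree on the
  \<open>\<pi>\<close>-system of boxes, hence everywhere, and densities are unique.
\<close>
lemma AE_eq_0_of_integral_box_eq_0:
  fixes h :: "'a::euclidean_space \<Rightarrow> real"
  assumes h: "integrable lborel h"
    and box: "\<And>a b. (LINT y|lborel. h y * indicator (box a b) y) = 0"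
  shows "AE x in lborel. h x = 0"
proof -
  note [measurable] = borel_measurable_integrable[OF h]
  define P where "P = density lborel (\<lambda>x. ennreal (h x))"
  define Q where "Q = density lborel (\<lambda>x. ennreal (- h x))"
  let ?E = "range (\<lambda>(a, b). box a b :: 'a set)"
  have fin: "(\<integral>\<^sup>+ x. ennreal (h x) * indicator A x \<partial>lborel) \<noteq> \<infinity>"
    "(\<integral>\<^sup>+ x. ennreal (- h x) * indicator A x \<partial>lborel) \<noteq> \<infinity>" for A
  proof -
    have "(\<integral>\<^sup>+ x. ennreal (h x) * indicator A x \<partial>lborel) \<le> (\<integral>\<^sup>+ x. ennreal (norm (h x)) \<partial>lborel)"
      "(\<integral>\<^sup>+ x. ennreal (- h x) * indicator A x \<partial>lborel) \<le> (\<integral>\<^sup>+ x. ennreal (norm (h x)) \<partial>lborel)"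
      by (intro nn_integral_mono; auto simp: indicator_def intro!: ennreal_leI)+
    moreover have "(\<integral>\<^sup>+ x. ennreal (norm (h x)) \<partial>lborel) < \<infinity>"
      using h by (simp add: integrable_iff_bounded)
    ultimately show "(\<integral>\<^sup>+ x. ennreal (h x) * indicator A x \<partial>lborel) \<noteq> \<infinity>"
      "(\<integral>\<^sup>+ x. ennreal (- h x) * indicator A x \<partial>lborel) \<noteq> \<infinity>" by (auto simp: top_unique)
  qed
  have eq: "emeasure P A = emeasure Q A" if A: "A \<in> ?E" for A
  proof -
    obtain a b where ab: "A = box a b" using A by auto
    have hi: "integrable lborel (\<lambda>y. h y * indicator A y)"
      unfolding ab by (rule Bochner_Integration.integrable_bound[OF h]) (auto simp: indicator_def)
    have "(LINT y|lborel. h y * indicator A y) =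
      enn2real (\<integral>\<^sup>+ y. ennreal (h y * indicator A y) \<partial>lborel) - enn2real (\<integral>\<^sup>+ y. ennreal (- (h y * indicator A y)) \<partial>lborel)"
      by (rule real_lebesgue_integral_def[OF hi])
    also have "(\<integral>\<^sup>+ y. ennreal (h y * indicator A y) \<partial>lborel) = (\<integral>\<^sup>+ y. ennreal (h y) * indicator A y \<partial>lborel)"
      by (intro nn_integral_cong) (auto simp: indicator_def)
    also have "(\<integral>\<^sup>+ y. ennreal (- (h y * indicator A y)) \<partial>lborel) = (\<integral>\<^sup>+ y. ennreal (- h y) * indicator A y \<partial>lborel)"
      by (intro nn_integral_cong) (auto simp: indicator_def)
    finally have "enn2real (\<integral>\<^sup>+ y. ennreal (h y) * indicator A y \<partial>lborel) = enn2real (\<integral>\<^sup>+ y. ennreal (- h y) * indicator A y \<partial>lborel)"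
      using box[of a b] ab by simp
    then have "(\<integral>\<^sup>+ y. ennreal (h y) * indicator A y \<partial>lborel) = (\<integral>\<^sup>+ y. ennreal (- h y) * indicator A y \<partial>lborel)"
      using fin[of A] by (metis ennreal_enn2real infinity_ennreal_def less_top)
    then show ?thesis using ab by (simp add: P_def Q_def emeasure_density)
  qed
  have "P = Q"
  proof (rule measure_eqI_generator_eq[where E = ?E and \<Omega> = UNIV and A = "\<lambda>n::nat. box (- (real n *\<^sub>R One)) (real n *\<^sub>R One)"])
    show "Int_stable ?E" by (auto simp: Int_stable_def box_Int_box)
    show "sets P = sigma_sets UNIV ?E" "sets Q = sigma_sets UNIV ?E"
      by (simp_all add: P_def Q_def borel_eq_box)
    show "(\<Union>n::nat. box (- (real n *\<^sub>R One)) (real n *\<^sub>R One)) = (UNIV :: 'a set)"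
      by (rule UN_box_eq_UNIV)
    show "emeasure P (box (- (real n *\<^sub>R One)) (real n *\<^sub>R One)) \<noteq> \<infinity>" for n :: nat
      using fin(1) by (simp add: P_def emeasure_density)
  qed (use eq in auto)
  then have "AE x in lborel. ennreal (h x) = ennreal (- h x)"
    unfolding P_def Q_def by (intro sigma_finite_measure.density_unique[OF sigma_finite_lborel]) auto
  then show ?thesis
  proof eventually_elim
    case (elim x)
    then show ?case by (cases "h x \<ge> 0") (auto simp: ennreal_neg)
  qed
qed

lemma fourier_inj_AE:
  fixes h k :: "'a::euclidean_space \<Rightarrow> real"
  assumes h: "integrable lebesgue h" and k: "integrable lebesgue k"
    and eq: "\<And>\<xi>. fourier h \<xi> = fourier k \<xi>"
  shows "AE x in lebesgue. h x = k x"
proof -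
  have hk: "integrable lebesgue (\<lambda>x. h x - k x)" using h k by simp
  obtain g where g[measurable]: "g \<in> borel_measurable lborel" and ae: "AE x in lborel. h x - k x = g x"
    using completion_ex_borel_measurable_real[OF borel_measurable_integrable[OF hk]] by blast
  have ae': "AE x in lebesgue. h x - k x = g x" using ae by (rule AE_completion)
  have gm: "g \<in> borel_measurable lebesgue" by (rule measurable_completion) (rule g)
  have "integrable lebesgue g"
    by (rule integrable_cong_AE_imp[OF hk gm]) (use ae' in \<open>auto elim!: eventually_mono\<close>)
  then have gi: "integrable lborel g" by (simp add: integrable_completion)
  have int: "integrable lebesgue (\<lambda>x. exp (- (\<i> * of_real (x \<bullet> \<xi>))) * complex_of_real (u x))"
    if "integrable lebesgue u" for u :: "'a \<Rightarrow> real" and \<xi>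
  proof (rule Bochner_Integration.integrable_bound[OF that])
    note [measurable] = borel_measurable_integrable[OF that]
    have e: "(\<lambda>x. exp (- (\<i> * complex_of_real (x \<bullet> \<xi>)))) \<in> borel_measurable lebesgue"
      by (rule measurable_completion) measurable
    then show "(\<lambda>x. exp (- (\<i> * of_real (x \<bullet> \<xi>))) * complex_of_real (u x)) \<in> borel_measurable lebesgue"
      by measurable
  qed (auto simp: norm_mult)
  have "(CLINT x|lborel. exp (- (\<i> * of_real (x \<bullet> \<xi>))) * of_real (g x)) = 0" for \<xi>
  proof -
    have "(CLINT x|lborel. exp (- (\<i> * of_real (x \<bullet> \<xi>))) * of_real (g x)) =
      (CLINT x|lebesgue. exp (- (\<i> * of_real (x \<bullet> \<xi>))) * of_real (g x))"
      by (rule integral_completion[symmetric]) measurable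
    also have "\<dots> = (CLINT x|lebesgue. exp (- (\<i> * of_real (x \<bullet> \<xi>))) * complex_of_real (h x - k x))"
      by (rule integral_cong_AE)
        (use ae' int[OF hk, of \<xi>] int[OF \<open>integrable lebesgue g\<close>, of \<xi>] in \<open>auto elim!: eventually_mono simp del: of_real_diff\<close>)
    also have "\<dots> = fourier h \<xi> - fourier k \<xi>"
      unfolding fourier_def using int[OF h, of \<xi>] int[OF k, of \<xi>]
      by (subst Bochner_Integration.integral_diff[symmetric]) (auto simp: right_diff_distrib)
    finally show ?thesis by (simp add: eq)
  qed
  then have "AE x in lborel. g x = 0"
    by (intro AE_eq_0_of_integral_box_eq_0 gi integral_box_eq_0_of_fourier_eq_0)
  then have "AE x in lebesgue. g x = 0" by (rule AE_completion)
  with ae' show ?thesis by eventually_elim simp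
qed

section \<open>The kernel as a mixture of Gaussians\<close>

lemma measurable_heat [measurable (raw)]:
  assumes [measurable]: "f \<in> borel_measurable M" "g \<in> borel_measurable M"
  shows "(\<lambda>z. heat (f z) (g z :: 'a::euclidean_space)) \<in> borel_measurable M"
  unfolding heat_def by measurable

text \<open>
  Apart from \<open>|x| powr (-N)\<close> the Gaussian depends only on \<open>s / |x|\<^sup>2\<close>.
\<close>
lemma heat_profile:
  fixes x :: "'a::euclidean_space"
  assumes s: "s > 0" and x: "x \<noteq> 0"
  defines "n \<equiv> real DIM('a) / 2"
  shows "heat s x = (4 * pi) powr (-n) * norm x powr (- real DIM('a)) *
     ((s / (norm x)\<^sup>2) powr (-n) * exp (- (1 / (4 * (s / (norm x)\<^sup>2)))))"
proof -
  have n: "norm x powr (- real DIM('a)) = ((norm x)\<^sup>2) powr (-n)"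
    using x by (simp add: n_def powr_powr flip: powr_numeral)
  have "(4 * pi * s) powr (-n) = (4 * pi) powr (-n) * (((norm x)\<^sup>2) powr (-n) * (s / (norm x)\<^sup>2) powr (-n))"
    using s x by (simp add: powr_mult[symmetric])
  then show ?thesis unfolding heat_def n using s x by (simp add: n_def)
qed

lemma heat_le_norm_powr:
  fixes x :: "'a::euclidean_space"
  assumes s: "s > 0" and x: "x \<noteq> 0"
  shows "heat s x \<le> real DIM('a) powr (real DIM('a) / 2) * norm x powr (- real DIM('a))"
proof -
  define n where "n = real DIM('a) / 2"
  have n: "n > 0" by (simp add: n_def)
  define w where "w = (norm x)\<^sup>2 / (4 * s)"
  have w: "w > 0" using s x by (simp add: w_def)
  have u: "s / (norm x)\<^sup>2 = 1 / (4 * w)" using s x by (simp add: w_def)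
  have "(1 / (4 * w)) powr (-n) * exp (- (1 / (4 * (1 / (4 * w))))) = 4 powr n * (w powr n * exp (- w))"
    using w by (simp add: powr_minus powr_divide powr_mult)
  also have "\<dots> \<le> 4 powr n * n powr n"
    using powr_exp_bound[OF w n] by (intro mult_left_mono) auto
  finally have "heat s x \<le> (4 * pi) powr (-n) * norm x powr (- real DIM('a)) * (4 powr n * n powr n)"
    unfolding heat_profile[OF s x] n_def[symmetric] u by (intro mult_left_mono) auto
  also have "\<dots> = (n / pi) powr n * norm x powr (- real DIM('a))"
    using n by (simp add: powr_mult powr_minus powr_divide field_simps)
  also have "\<dots> \<le> real DIM('a) powr n * norm x powr (- real DIM('a))"
  proof (intro mult_right_mono powr_mono2)
    show "n / pi \<le> real DIM('a)" using pi_ge_two n by (simp add: n_def field_simps)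
  qed (use n in auto)
  finally show ?thesis by (simp add: n_def)
qed

text \<open>
  For \<open>s \<le> |x|\<^sup>2\<close> the first term suffices, as the exponential is then bounded below. For
  \<open>s > |x|\<^sup>2\<close> the Gaussian is at most \<open>s powr (-N/2)\<close>, and the part \<open>k \<le> 1/s\<close> of the integral already
  has that size. Only exponentials in \<open>s\<close> occur on the right, so integrating over \<open>s\<close> with any positive
  measure leads to its Laplace transform.
\<close>
lemma heat_le_exponential_mixture:
  obtains K where "K > 0" "\<And>s (x :: 'a::euclidean_space). s > 0 \<Longrightarrow> x \<noteq> 0 \<Longrightarrow>
    ennreal (heat s x) \<le> ennreal (K * norm x powr (- real DIM('a))) * ennreal (exp (- (1 / (norm x)\<^sup>2 * s))) +
      (\<integral>\<^sup>+ k. ennreal (indicator {0..1 / (norm x)\<^sup>2} k * (K * k powr (real DIM('a) / 2 - 1))) * ennreal (exp (- (k * s))) \<partial>lborel)"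
proof -
  define n where "n = real DIM('a) / 2"
  have n: "n > 0" by (simp add: n_def)
  define K where "K = exp 1 * real DIM('a) powr n + exp 1 * n"
  have K: "K > 0" using n by (simp add: K_def add_nonneg_pos)
  have K1: "exp 1 * real DIM('a) powr n \<le> K" and K2: "exp 1 * n \<le> K" using n by (auto simp: K_def)
  show thesis
  proof (rule that[OF K])
    fix s :: real and x :: 'a assume s: "s > 0" and x: "x \<noteq> 0"
    let ?A = "ennreal (K * norm x powr (- real DIM('a))) * ennreal (exp (- (1 / (norm x)\<^sup>2 * s)))"
    let ?B = "\<integral>\<^sup>+ k. ennreal (indicator {0..1 / (norm x)\<^sup>2} k * (K * k powr (real DIM('a) / 2 - 1))) * ennreal (exp (- (k * s))) \<partial>lborel"
    show "ennreal (heat s x) \<le> ?A + ?B"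
    proof (cases "s \<le> (norm x)\<^sup>2")
      case True
      have "heat s x \<le> real DIM('a) powr n * norm x powr (- real DIM('a)) * 1"
        using heat_le_norm_powr[OF s x] by (simp add: n_def)
      also have "\<dots> \<le> real DIM('a) powr n * norm x powr (- real DIM('a)) * (exp 1 * exp (- (1 / (norm x)\<^sup>2 * s)))"
        using True x by (intro mult_left_mono) (auto simp: exp_add[symmetric] field_simps)
      also have "\<dots> = (exp 1 * real DIM('a) powr n) * (norm x powr (- real DIM('a)) * exp (- (1 / (norm x)\<^sup>2 * s)))"
        by (simp add: mult_ac)
      also have "\<dots> \<le> K * (norm x powr (- real DIM('a)) * exp (- (1 / (norm x)\<^sup>2 * s)))"
        by (intro mult_right_mono K1) auto
      finally have "ennreal (heat s x) \<le> ?A"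
        using K by (simp add: ennreal_mult'[symmetric] mult.assoc ennreal_leI)
      then show ?thesis by (rule order_trans) simp
    next
      case False
      have i: "((\<lambda>k. k powr (n - 1)) has_integral ((1 / s) powr (n - 1 + 1) / (n - 1 + 1))) {0..1 / s}"
        by (rule has_integral_powr_from_0) (use n s in auto)
      have "heat s x \<le> (4 * pi * s) powr (-n) * 1"
        unfolding heat_def n_def using s by (intro mult_mono) auto
      also have "\<dots> \<le> s powr (-n)"
        using s n pi_ge_two by (simp add: powr_mono2')
      also have "\<dots> \<le> (K * exp (-1)) * (s powr (-n) / n)"
        using K2 n mult_right_mono[OF K2, of "exp (-1) * s powr (-n) / n"] by (simp add: exp_minus field_simps)
      finally have "ennreal (heat s x) \<le> ennreal (K * exp (-1)) * ennreal (s powr (-n) / n)"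
        using K by (simp add: ennreal_mult'[symmetric] ennreal_leI)
      also have "ennreal (s powr (-n) / n) = (\<integral>\<^sup>+ k. ennreal (indicator {0..1 / s} k * k powr (n - 1)) \<partial>lborel)"
        using s n by (subst nn_integral_has_integral_lebesgue[OF _ i]) (auto simp: powr_divide powr_minus_divide)
      also have "ennreal (K * exp (-1)) * \<dots> = (\<integral>\<^sup>+ k. ennreal (K * exp (-1)) * ennreal (indicator {0..1 / s} k * k powr (n - 1)) \<partial>lborel)"
        by (rule nn_integral_cmult[symmetric]) auto
      also have "\<dots> \<le> ?B"
      proof (rule nn_integral_mono)
        fix k :: real
        show "ennreal (K * exp (-1)) * ennreal (indicator {0..1 / s} k * k powr (n - 1)) \<le>
          ennreal (indicator {0..1 / (norm x)\<^sup>2} k * (K * k powr (real DIM('a) / 2 - 1))) * ennreal (exp (- (k * s)))"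
        proof (cases "k \<in> {0..1 / s}")
          case True
          have "1 / s \<le> 1 / (norm x)\<^sup>2" using False x s by (intro divide_left_mono) auto
          then have "k \<in> {0..1 / (norm x)\<^sup>2}" using True by auto
          moreover have "exp (-1) \<le> exp (- (k * s))" using True s by (simp add: field_simps)
          ultimately show ?thesis using True K
            by (auto simp: ennreal_mult'[symmetric] n_def mult_ac intro!: ennreal_leI mult_left_mono mult_right_mono)
        qed simp
      qed
      finally show ?thesis by (rule order_trans) simp
    qed
  qed
qed

text \<open>
  The last term makes the combination nonpositive for small \<open>s / |x|\<^sup>2\<close>, where the Gaussian
  vanishes to infinite order. For large \<open>s / |x|\<^sup>2\<close> the combination decays exponentially, the
  Gaussian only like a power.
\<close>
lemma heat_ge_exponential_combination:
  fixes l e :: real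
  assumes l: "l > 0" and e: "e > 0"
  obtains D where "D > 0" "\<And>s (x :: 'a::euclidean_space). s > 0 \<Longrightarrow> x \<noteq> 0 \<Longrightarrow>
    norm x powr (- real DIM('a)) * (exp (- (s / (norm x)\<^sup>2)) - exp (- (l * (s / (norm x)\<^sup>2))) - e * exp (- (1 / 2 * (s / (norm x)\<^sup>2))))
     \<le> D * heat s x"
proof -
  define n where "n = real DIM('a) / 2"
  have n: "n > 0" by (simp add: n_def)
  define u1 where "u1 = min 1 (e * exp (-1/2) / l)"
  have u1: "u1 > 0" "u1 \<le> 1" "l * u1 \<le> e * exp (-1/2)"
    using l e by (auto simp: u1_def min_def field_simps)
  define D where "D = n powr n * exp (1 / (4 * u1)) * (4 * pi) powr n"
  have D: "D > 0" using n by (simp add: D_def)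
  have main: "exp (- u) - exp (- (l * u)) - e * exp (- (1/2 * u)) \<le> n powr n * exp (1 / (4 * u1)) * (u powr (-n) * exp (- (1 / (4 * u))))"
    if u: "u > 0" for u
  proof (cases "u \<le> u1")
    case True
    have "exp (- u) \<le> 1" using u by simp
    moreover have "1 - exp (- (l * u)) \<le> l * u" using exp_ge_add_one_self[of "- (l * u)"] by simp
    moreover have "l * u \<le> l * u1" using True l by simp
    moreover have "e * exp (-1/2) \<le> e * exp (- (1/2 * u))" using True u1 e by simp
    moreover have "0 \<le> n powr n * exp (1 / (4 * u1)) * (u powr (-n) * exp (- (1 / (4 * u))))" by simp
    ultimately show ?thesis using u1(3) by linarith
  next
    case False
    have "exp (- u) - exp (- (l * u)) - e * exp (- (1/2 * u)) \<le> exp (- u)"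
      using e exp_gt_zero[of "- (l * u)"] mult_pos_pos[OF e exp_gt_zero[of "- (1/2 * u)"]] by linarith
    also have "\<dots> = u powr (-n) * (u powr n * exp (- u))" using u by (simp add: powr_minus)
    also have "\<dots> \<le> u powr (-n) * n powr n" using powr_exp_bound[OF u n] by (intro mult_left_mono) auto
    also have "\<dots> \<le> u powr (-n) * n powr n * (exp (1 / (4 * u1)) * exp (- (1 / (4 * u))))"
    proof -
      have "1 \<le> exp (1 / (4 * u1)) * exp (- (1 / (4 * u)))"
        using False u1 u by (simp add: exp_add[symmetric] frac_le)
      then have "u powr (-n) * n powr n * 1 \<le> u powr (-n) * n powr n * (exp (1 / (4 * u1)) * exp (- (1 / (4 * u))))"
        by (rule mult_left_mono) simp
      then show ?thesis by simp
    qed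
    finally show ?thesis by (simp add: mult_ac)
  qed
  show thesis
  proof (rule that[OF D])
    fix s :: real and x :: 'a assume s: "s > 0" and x: "x \<noteq> 0"
    have u: "s / (norm x)\<^sup>2 > 0" using s x by simp
    let ?u = "s / (norm x)\<^sup>2"
    have "norm x powr (- real DIM('a)) * (exp (- ?u) - exp (- (l * ?u)) - e * exp (- (1 / 2 * ?u))) \<le>
      norm x powr (- real DIM('a)) * (n powr n * exp (1 / (4 * u1)) * (?u powr (-n) * exp (- (1 / (4 * ?u)))))"
      by (intro mult_left_mono main[OF u]) auto
    also have "\<dots> = D * heat s x"
      unfolding heat_profile[OF s x] D_def n_def[symmetric] by (simp add: powr_minus)
    finally show "norm x powr (- real DIM('a)) * (exp (- ?u) - exp (- (l * ?u)) - e * exp (- (1 / 2 * ?u))) \<le> D * heat s x" .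
  qed
qed

text \<open>
  A finite measure on positive times and its Laplace transform. The kernel is the case where \<open>H k\<close> is
  the Mittag-Leffler function at \<open>-k\<^sup>\<beta>\<close>, but the estimates only depend on power bounds for \<open>H\<close>.
\<close>
locale heat_mixture =
  fixes m :: "real measure" and H :: "real \<Rightarrow> real"
  assumes sets_m [measurable_cong]: "sets m = sets borel"
    and m_pos: "AE r in m. 0 < r"
    and laplace: "\<And>k. k \<ge> 0 \<Longrightarrow> (\<integral>\<^sup>+ r. ennreal (exp (- (k * r))) \<partial>m) = ennreal (H k)"
    and H_nonneg: "\<And>k. k \<ge> 0 \<Longrightarrow> 0 \<le> H k"
begin

lemma finite_mixing_measure: "finite_measure m"
proof
  have "emeasure m (space m) = ennreal (H 0)" using laplace[of 0] by simp
  then show "emeasure m (space m) \<noteq> \<infinity>" by simp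
qed

sublocale finite_measure m by (rule finite_mixing_measure)

lemma H_antimono: "0 \<le> j \<Longrightarrow> j \<le> k \<Longrightarrow> H k \<le> H j"
proof -
  assume jk: "0 \<le> j" "j \<le> k"
  have "ennreal (H k) \<le> ennreal (H j)"
    unfolding laplace[OF jk(1), symmetric] laplace[OF order_trans[OF jk], symmetric]
    by (rule nn_integral_mono_AE, rule eventually_mono[OF m_pos])
      (use jk in \<open>auto intro!: ennreal_leI mult_right_mono\<close>)
  then show ?thesis using H_nonneg[OF jk(1)] by simp
qed

definition mix :: "real \<Rightarrow> 'a::euclidean_space \<Rightarrow> real" where
  "mix s x = (LINT r|m. heat (r * s) x)"

lemma mix_measurable [measurable (raw)]:
  assumes [measurable]: "f \<in> borel_measurable M" "g \<in> borel_measurable M"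
  shows "(\<lambda>z. mix (f z) (g z :: 'a::euclidean_space)) \<in> borel_measurable M"
  unfolding mix_def by measurable

lemma mix_nonneg: "0 \<le> mix s x"
  unfolding mix_def by (intro Bochner_Integration.integral_nonneg heat_nonneg)

lemma heat_integrable:
  fixes x :: "'a::euclidean_space"
  assumes s: "s > 0" and x: "x \<noteq> 0"
  shows "integrable m (\<lambda>r. heat (r * s) x)"
proof (rule integrable_const_bound)
  show "AE r in m. norm (heat (r * s) x) \<le> real DIM('a) powr (real DIM('a) / 2) * norm x powr (- real DIM('a))"
    by (rule eventually_mono[OF m_pos]) (use s x in \<open>auto simp: heat_nonneg intro!: heat_le_norm_powr\<close>)
qed measurable

lemma ennreal_mix:
  fixes x :: "'a::euclidean_space"
  assumes s: "s > 0" and x: "x \<noteq> 0"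
  shows "ennreal (mix s x) = (\<integral>\<^sup>+ r. ennreal (heat (r * s) x) \<partial>m)"
  unfolding mix_def by (rule nn_integral_eq_integral[symmetric]) (auto simp: heat_integrable[OF s x] heat_nonneg)

lemma exp_integrable:
  assumes "k \<ge> 0"
  shows "integrable m (\<lambda>r. exp (- (k * r)))" "(LINT r|m. exp (- (k * r))) = H k"
proof -
  show i: "integrable m (\<lambda>r. exp (- (k * r)))"
    by (rule integrableI_nonneg) (auto simp: laplace[OF assms])
  show "(LINT r|m. exp (- (k * r))) = H k"
    using laplace[OF assms] H_nonneg[OF assms] by (subst integral_eq_nn_integral) auto
qed

lemma fourier_mix:
  fixes \<xi> :: "'a::euclidean_space"
  assumes s: "s > 0"
  shows "integrable lborel (mix s :: 'a \<Rightarrow> real)"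
    and "(CLINT x|lborel. exp (- (\<i> * of_real (x \<bullet> \<xi>))) * of_real (mix s x)) = of_real (H (s * (norm \<xi>)\<^sup>2))"
proof -
  interpret P: pair_sigma_finite m "lborel :: 'a measure" ..
  have hpos: "AE r in m. 0 < r * s" by (rule eventually_mono[OF m_pos]) (use s in auto)
  have int0: "integrable (m \<Otimes>\<^sub>M lborel) (\<lambda>(r, x :: 'a). heat (r * s) x)"
  proof (rule P.Fubini_integrable)
    show "(\<lambda>(r, x :: 'a). heat (r * s) x) \<in> borel_measurable (m \<Otimes>\<^sub>M lborel)" by measurable
    show "AE r in m. integrable lborel (\<lambda>x :: 'a. case (r, x) of (r, x) \<Rightarrow> heat (r * s) x)"
      by (rule eventually_mono[OF hpos]) (simp add: heat_integral(1))
    have "AE r in m. (LINT x|lborel. norm (case (r, x :: 'a) of (r, x) \<Rightarrow> heat (r * s) x)) = 1"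
      by (rule eventually_mono[OF hpos]) (simp add: heat_integral(2) heat_nonneg)
    then show "integrable m (\<lambda>r. LINT x|lborel. norm (case (r, x :: 'a) of (r, x) \<Rightarrow> heat (r * s) x))"
      by (intro integrable_const_bound[of _ 1]) (auto elim!: eventually_mono)
  qed
  then show "integrable lborel (mix s :: 'a \<Rightarrow> real)"
    unfolding mix_def by (rule P.integrable_snd)
  let ?k = "\<lambda>r x. exp (- (\<i> * of_real (x \<bullet> \<xi>))) * complex_of_real (heat (r * s) x)"
  have int: "integrable (m \<Otimes>\<^sub>M lborel) (\<lambda>(r, x). ?k r x)"
    by (rule Bochner_Integration.integrable_bound[OF int0]) (auto simp: norm_mult heat_nonneg)
  have "(CLINT x|lborel. exp (- (\<i> * of_real (x \<bullet> \<xi>))) * of_real (mix s x)) = (CLINT x|lborel. CLINT r|m. ?k r x)"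
    by (simp add: mix_def)
  also have "\<dots> = (CLINT r|m. CLINT x|lborel. ?k r x)"
    using P.Fubini_integral[of ?k] int by simp
  also have "\<dots> = (CLINT r|m. of_real (exp (- (s * (norm \<xi>)\<^sup>2 * r))))"
  proof (rule integral_cong_AE)
    show "AE r in m. (CLINT x|lborel. ?k r x) = of_real (exp (- (s * (norm \<xi>)\<^sup>2 * r)))"
      by (rule eventually_mono[OF hpos]) (subst fourier_heat(1), auto simp: mult_ac)
  qed measurable
  also have "\<dots> = of_real (H (s * (norm \<xi>)\<^sup>2))"
    using exp_integrable(2)[of "s * (norm \<xi>)\<^sup>2"] s by simp
  finally show "(CLINT x|lborel. exp (- (\<i> * of_real (x \<bullet> \<xi>))) * of_real (mix s x)) = of_real (H (s * (norm \<xi>)\<^sup>2))" .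
qed

text \<open>
  Integrate the exponential majorant of the Gaussian. Both terms have the asserted order, the
  second because \<open>k powr (N/2-1-\<sigma>)\<close> is integrable at \<open>0\<close>.
\<close>
lemma mix_upper:
  assumes C: "C > 0" and \<sigma>: "0 \<le> \<sigma>" "\<sigma> < real DIM('a) / 2"
    and H: "\<And>k. k > 0 \<Longrightarrow> H k \<le> C * k powr (- \<sigma>)"
  obtains K where "K > 0" "\<And>s (x :: 'a::euclidean_space). s > 0 \<Longrightarrow> x \<noteq> 0 \<Longrightarrow>
    mix s x \<le> K * s powr (- \<sigma>) * norm x powr (2 * \<sigma> - real DIM('a))"
proof -
  define n where "n = real DIM('a) / 2"
  have n: "n > 0" "n - \<sigma> > 0" using \<sigma> by (auto simp: n_def)
  obtain K where K: "K > 0" and heat_le: "\<And>s (x :: 'a). s > 0 \<Longrightarrow> x \<noteq> 0 \<Longrightarrow>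
    ennreal (heat s x) \<le> ennreal (K * norm x powr (- real DIM('a))) * ennreal (exp (- (1 / (norm x)\<^sup>2 * s))) +
      (\<integral>\<^sup>+ k. ennreal (indicator {0..1 / (norm x)\<^sup>2} k * (K * k powr (n - 1))) * ennreal (exp (- (k * s))) \<partial>lborel)"
    using heat_le_exponential_mixture[where 'a = 'a] unfolding n_def by blast
  define K' where "K' = K * C + K * C / (n - \<sigma>)"
  have K': "K' > 0" using K C n by (auto simp: K'_def intro!: add_pos_pos)
  show thesis
  proof (rule that[OF K'])
    fix s :: real and x :: 'a assume s: "s > 0" and x: "x \<noteq> 0"
    define R where "R = 1 / (norm x)\<^sup>2"
    have R: "R > 0" using x by (simp add: R_def)
    have Rn: "R powr p = norm x powr (- 2 * p)" for p
      using x by (simp add: R_def powr_divide powr_powr powr_minus_divide flip: powr_numeral)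
    interpret P: pair_sigma_finite m "lborel :: real measure" ..
    have "ennreal (mix s x) = (\<integral>\<^sup>+ r. ennreal (heat (r * s) x) \<partial>m)" by (rule ennreal_mix[OF s x])
    also have "\<dots> \<le> (\<integral>\<^sup>+ r. ennreal (K * norm x powr (- real DIM('a))) * ennreal (exp (- (R * s * r))) +
      (\<integral>\<^sup>+ k. ennreal (indicator {0..R} k * (K * k powr (n - 1))) * ennreal (exp (- (k * s * r))) \<partial>lborel) \<partial>m)"
    proof (rule nn_integral_mono_AE, rule eventually_mono[OF m_pos])
      fix r :: real assume "0 < r"
      then show "ennreal (heat (r * s) x) \<le> ennreal (K * norm x powr (- real DIM('a))) * ennreal (exp (- (R * s * r))) +
        (\<integral>\<^sup>+ k. ennreal (indicator {0..R} k * (K * k powr (n - 1))) * ennreal (exp (- (k * s * r))) \<partial>lborel)"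
        using heat_le[of "r * s" x] s x by (simp add: R_def mult_ac)
    qed
    also have "\<dots> = ennreal (K * norm x powr (- real DIM('a))) * ennreal (H (R * s)) +
      (\<integral>\<^sup>+ r. \<integral>\<^sup>+ k. ennreal (indicator {0..R} k * (K * k powr (n - 1))) * ennreal (exp (- (k * s * r))) \<partial>lborel \<partial>m)"
      using R s by (subst nn_integral_add) (auto simp: nn_integral_cmult laplace)
    also have "(\<integral>\<^sup>+ r. \<integral>\<^sup>+ k. ennreal (indicator {0..R} k * (K * k powr (n - 1))) * ennreal (exp (- (k * s * r))) \<partial>lborel \<partial>m)
      = (\<integral>\<^sup>+ k. \<integral>\<^sup>+ r. ennreal (indicator {0..R} k * (K * k powr (n - 1))) * ennreal (exp (- (k * s * r))) \<partial>m \<partial>lborel)"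
      by (rule P.Fubini'[symmetric]) measurable
    also have "\<dots> = (\<integral>\<^sup>+ k. ennreal (indicator {0..R} k * (K * k powr (n - 1))) * ennreal (H (k * s)) \<partial>lborel)"
    proof (rule nn_integral_cong)
      fix k :: real
      show "(\<integral>\<^sup>+ r. ennreal (indicator {0..R} k * (K * k powr (n - 1))) * ennreal (exp (- (k * s * r))) \<partial>m) =
        ennreal (indicator {0..R} k * (K * k powr (n - 1))) * ennreal (H (k * s))"
        using s by (subst nn_integral_cmult) (auto simp: laplace split: split_indicator)
    qed
    also have "\<dots> \<le> (\<integral>\<^sup>+ k. ennreal (K * C * s powr (- \<sigma>)) * ennreal (indicator {0..R} k * k powr (n - \<sigma> - 1)) \<partial>lborel)"
    proof (rule nn_integral_mono_AE, rule eventually_mono[OF AE_lborel_singleton[of 0]])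
      fix k :: real assume k: "k \<noteq> 0"
      show "ennreal (indicator {0..R} k * (K * k powr (n - 1))) * ennreal (H (k * s)) \<le>
        ennreal (K * C * s powr (- \<sigma>)) * ennreal (indicator {0..R} k * k powr (n - \<sigma> - 1))"
      proof (cases "k \<in> {0..R}")
        case True
        then have k': "k > 0" using k by simp
        have "K * k powr (n - 1) * H (k * s) \<le> K * k powr (n - 1) * (C * (k * s) powr (- \<sigma>))"
          using k' s K by (intro mult_left_mono H) auto
        also have "\<dots> = K * C * s powr (- \<sigma>) * k powr (n - \<sigma> - 1)"
        proof -
          have "k powr (n - \<sigma> - 1) = k powr (n - 1) * k powr (- \<sigma>)"
            by (simp add: powr_add[symmetric] algebra_simps)
          moreover have "(k * s) powr (- \<sigma>) = k powr (- \<sigma>) * s powr (- \<sigma>)"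
            using k' s by (simp add: powr_mult)
          ultimately show ?thesis by (simp only: mult_ac)
        qed
        finally show ?thesis using True K C
          by (simp add: ennreal_mult'[symmetric] ennreal_leI)
      qed simp
    qed
    also have "\<dots> = ennreal (K * C * s powr (- \<sigma>)) * ennreal (R powr (n - \<sigma>) / (n - \<sigma>))"
    proof -
      have "((\<lambda>k. k powr (n - \<sigma> - 1)) has_integral (R powr (n - \<sigma> - 1 + 1) / (n - \<sigma> - 1 + 1))) {0..R}"
        by (rule has_integral_powr_from_0) (use n R in auto)
      then have "(\<integral>\<^sup>+ k. ennreal (indicator {0..R} k * k powr (n - \<sigma> - 1)) \<partial>lborel) = ennreal (R powr (n - \<sigma>) / (n - \<sigma>))"
        by (subst nn_integral_has_integral_lebesgue) auto
      then show ?thesis by (subst nn_integral_cmult) auto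
    qed
    also have "ennreal (K * norm x powr (- real DIM('a))) * ennreal (H (R * s)) \<le>
      ennreal (K * norm x powr (- real DIM('a))) * ennreal (C * (R * s) powr (- \<sigma>))"
      using R s by (intro mult_left_mono ennreal_leI H) auto
    finally have "ennreal (mix s x) \<le> ennreal (K * norm x powr (- real DIM('a))) * ennreal (C * (R * s) powr (- \<sigma>)) +
        ennreal (K * C * s powr (- \<sigma>)) * ennreal (R powr (n - \<sigma>) / (n - \<sigma>))"
      by (auto intro: add_right_mono order_trans)
    also have "\<dots> = ennreal (K * norm x powr (- real DIM('a)) * (C * (R * s) powr (- \<sigma>)) +
        K * C * s powr (- \<sigma>) * (R powr (n - \<sigma>) / (n - \<sigma>)))"
      using K C n by (simp add: ennreal_mult'[symmetric] ennreal_plus[symmetric] del: ennreal_plus)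
    also have "K * norm x powr (- real DIM('a)) * (C * (R * s) powr (- \<sigma>)) +
        K * C * s powr (- \<sigma>) * (R powr (n - \<sigma>) / (n - \<sigma>)) = K' * s powr (- \<sigma>) * norm x powr (2 * \<sigma> - real DIM('a))"
    proof -
      have "norm x powr (2 * \<sigma> - real DIM('a)) = norm x powr (- real DIM('a)) * R powr (- \<sigma>)"
        unfolding Rn by (simp add: powr_add[symmetric])
      moreover have Rns: "R powr (n - \<sigma>) = norm x powr (2 * \<sigma> - real DIM('a))"
        unfolding Rn by (simp add: n_def algebra_simps)
      moreover have "(R * s) powr (- \<sigma>) = R powr (- \<sigma>) * s powr (- \<sigma>)" using R s by (simp add: powr_mult)
      ultimately have "K * norm x powr (- real DIM('a)) * (C * (R * s) powr (- \<sigma>)) = K * C * s powr (- \<sigma>) * norm x powr (2 * \<sigma> - real DIM('a))"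
        by (simp only: mult_ac)
      then show ?thesis unfolding Rns K'_def by (simp add: algebra_simps add_divide_distrib)
    qed
    finally show "mix s x \<le> K' * s powr (- \<sigma>) * norm x powr (2 * \<sigma> - real DIM('a))"
      using K' by (simp add: mix_nonneg)
  qed
qed

text \<open>
  The combination of exponentials below the Gaussian has mean
  \<open>H \<kappa> - H (l \<kappa>) - e H (\<kappa>/2)\<close> with \<open>\<kappa> = s / |x|\<^sup>2\<close>. For large \<open>l\<close> and small \<open>e\<close> the upper bound on \<open>H\<close>
  makes the last two terms at most half of the lower bound for the first.
\<close>
lemma mix_lower:
  assumes c: "c > 0" and C: "C > 0" and \<sigma>: "0 < \<sigma>"
    and up: "\<And>k. k > 0 \<Longrightarrow> H k \<le> C * k powr (- \<sigma>)"
    and low: "\<And>k. k \<ge> 1 \<Longrightarrow> c * k powr (- \<sigma>) \<le> H k"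
  obtains K where "K > 0" "\<And>s (x :: 'a::euclidean_space). x \<noteq> 0 \<Longrightarrow> (norm x)\<^sup>2 \<le> s \<Longrightarrow>
    K * s powr (- \<sigma>) * norm x powr (2 * \<sigma> - real DIM('a)) \<le> mix s x"
proof -
  define l where "l = (c / (4 * C)) powr (-1 / \<sigma>)"
  define e where "e = c / (4 * C * 2 powr \<sigma>)"
  have l: "l > 0" "l powr (- \<sigma>) = c / (4 * C)" using c C \<sigma> by (auto simp: l_def powr_powr)
  have e: "e > 0" using c C by (simp add: e_def)
  obtain D where D: "D > 0" and heat_ge: "\<And>s (x :: 'a). s > 0 \<Longrightarrow> x \<noteq> 0 \<Longrightarrow>
    norm x powr (- real DIM('a)) * (exp (- (s / (norm x)\<^sup>2)) - exp (- (l * (s / (norm x)\<^sup>2))) - e * exp (- (1 / 2 * (s / (norm x)\<^sup>2))))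
     \<le> D * heat s x"
    using heat_ge_exponential_combination[OF l(1) e, where 'a = 'a] by blast
  show thesis
  proof (rule that[of "c / (2 * D)"])
    show "c / (2 * D) > 0" using c D by simp
    fix s :: real and x :: 'a assume x: "x \<noteq> 0" and xs: "(norm x)\<^sup>2 \<le> s"
    have s: "s > 0" using x xs by (meson less_le_trans zero_less_norm_iff zero_less_power)
    define \<kappa> where "\<kappa> = s / (norm x)\<^sup>2"
    have \<kappa>: "\<kappa> \<ge> 1" using x xs by (simp add: \<kappa>_def)
    have "c / 2 * \<kappa> powr (- \<sigma>) = c * \<kappa> powr (- \<sigma>) - C * (l * \<kappa>) powr (- \<sigma>) - e * (C * (1 / 2 * \<kappa>) powr (- \<sigma>))"
    proof -
      have "(l * \<kappa>) powr (- \<sigma>) = c / (4 * C) * \<kappa> powr (- \<sigma>)" using l \<kappa> by (simp add: powr_mult)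
      moreover have "(1 / 2 * \<kappa>) powr (- \<sigma>) = 2 powr \<sigma> * \<kappa> powr (- \<sigma>)"
      proof -
        have "(1 / 2 :: real) powr (- \<sigma>) = 2 powr \<sigma>" by (simp add: powr_divide powr_minus field_simps)
        moreover have "(1 / 2 * \<kappa>) powr (- \<sigma>) = (1 / 2) powr (- \<sigma>) * \<kappa> powr (- \<sigma>)"
          by (rule powr_mult)
        ultimately show ?thesis by (simp only:)
      qed
      ultimately show ?thesis using C by (simp add: e_def field_simps)
    qed
    also have "\<dots> \<le> H \<kappa> - H (l * \<kappa>) - e * H (1 / 2 * \<kappa>)"
    proof -
      have "c * \<kappa> powr (- \<sigma>) \<le> H \<kappa>" "H (l * \<kappa>) \<le> C * (l * \<kappa>) powr (- \<sigma>)"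
        using \<kappa> l by (auto intro!: low up)
      moreover have "e * H (1 / 2 * \<kappa>) \<le> e * (C * (1 / 2 * \<kappa>) powr (- \<sigma>))"
        using \<kappa> e by (intro mult_left_mono up) auto
      ultimately show ?thesis by linarith
    qed
    also have "\<dots> = (LINT r|m. exp (- (\<kappa> * r)) - exp (- (l * \<kappa> * r)) - e * exp (- (1 / 2 * \<kappa> * r)))"
    proof -
      have "0 \<le> \<kappa>" "0 \<le> l * \<kappa>" "0 \<le> 1 / 2 * \<kappa>" using \<kappa> l by auto
      note i = exp_integrable[OF this(1)] exp_integrable[OF this(2)] exp_integrable[OF this(3)]
      have "(LINT r|m. exp (- (\<kappa> * r)) - exp (- (l * \<kappa> * r)) - e * exp (- (1 / 2 * \<kappa> * r))) =
        (LINT r|m. exp (- (\<kappa> * r)) - exp (- (l * \<kappa> * r))) - (LINT r|m. e * exp (- (1 / 2 * \<kappa> * r)))"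
        by (intro Bochner_Integration.integral_diff Bochner_Integration.integrable_diff integrable_mult_right i)
      also have "(LINT r|m. exp (- (\<kappa> * r)) - exp (- (l * \<kappa> * r))) = H \<kappa> - H (l * \<kappa>)"
        unfolding i(2,4)[symmetric] by (intro Bochner_Integration.integral_diff i)
      also have "(LINT r|m. e * exp (- (1 / 2 * \<kappa> * r))) = e * H (1 / 2 * \<kappa>)"
        unfolding integral_mult_right_zero i(6) ..
      finally show ?thesis ..
    qed
    finally have "norm x powr (- real DIM('a)) * (c / 2 * \<kappa> powr (- \<sigma>)) \<le>
      norm x powr (- real DIM('a)) * (LINT r|m. exp (- (\<kappa> * r)) - exp (- (l * \<kappa> * r)) - e * exp (- (1 / 2 * \<kappa> * r)))"
      by (rule mult_left_mono) simp
    also have "\<dots> = (LINT r|m. norm x powr (- real DIM('a)) * (exp (- (\<kappa> * r)) - exp (- (l * \<kappa> * r)) - e * exp (- (1 / 2 * \<kappa> * r))))"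
      by simp
    also have "\<dots> \<le> (LINT r|m. D * heat (r * s) x)"
    proof (rule integral_mono_AE)
      show "integrable m (\<lambda>r. norm x powr (- real DIM('a)) * (exp (- (\<kappa> * r)) - exp (- (l * \<kappa> * r)) - e * exp (- (1 / 2 * \<kappa> * r))))"
        by (intro Bochner_Integration.integrable_diff integrable_mult_right exp_integrable) (use \<kappa> l in auto)
      show "integrable m (\<lambda>r. D * heat (r * s) x)" using heat_integrable[OF s x] by simp
      show "AE r in m. norm x powr (- real DIM('a)) * (exp (- (\<kappa> * r)) - exp (- (l * \<kappa> * r)) - e * exp (- (1 / 2 * \<kappa> * r))) \<le> D * heat (r * s) x"
      proof (rule eventually_mono[OF m_pos])
        fix r :: real assume "0 < r"
        then show "norm x powr (- real DIM('a)) * (exp (- (\<kappa> * r)) - exp (- (l * \<kappa> * r)) - e * exp (- (1 / 2 * \<kappa> * r))) \<le> D * heat (r * s) x"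
          using heat_ge[of "r * s" x] s x by (simp add: \<kappa>_def mult_ac)
      qed
    qed
    also have "\<dots> = D * mix s x" by (simp add: mix_def)
    finally have *: "norm x powr (- real DIM('a)) * (c / 2 * \<kappa> powr (- \<sigma>)) \<le> D * mix s x" .
    have "\<kappa> powr (- \<sigma>) = s powr (- \<sigma>) * norm x powr (2 * \<sigma>)"
    proof -
      have "\<kappa> powr (- \<sigma>) = s powr (- \<sigma>) / ((norm x)\<^sup>2) powr (- \<sigma>)" using s x by (simp add: \<kappa>_def powr_divide)
      also have "((norm x)\<^sup>2) powr (- \<sigma>) = norm x powr (- (2 * \<sigma>))" using x by (simp add: powr_powr flip: powr_numeral)
      finally show ?thesis using x by (simp add: powr_minus field_simps)
    qed
    then have "norm x powr (- real DIM('a)) * (c / 2 * \<kappa> powr (- \<sigma>)) = c / 2 * s powr (- \<sigma>) * norm x powr (2 * \<sigma> - real DIM('a))"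
      using x by (simp add: powr_diff powr_minus field_simps)
    with * have "c / 2 * s powr (- \<sigma>) * norm x powr (2 * \<sigma> - real DIM('a)) \<le> D * mix s x" by (simp only:)
    then show "c / (2 * D) * s powr (- \<sigma>) * norm x powr (2 * \<sigma> - real DIM('a)) \<le> mix s x"
      using D by (simp add: field_simps)
  qed
qed

end

text \<open>
  The time \<open>s = t powr (\<alpha>/\<beta>)\<close> makes the Laplace transform of the mixing measure at \<open>s |\<xi>|\<^sup>2\<close> equal to
  \<open>E\<^sub>\<alpha>\<^sub>,\<^sub>\<alpha>(-|\<xi>| powr (2\<beta>) t\<^sup>\<alpha>)\<close>. The exponents \<open>\<theta>\<close> interpolate between boundedness of \<open>H\<close>
  (\<open>\<theta> = 0\<close>) and its decay of order \<open>k powr (-2\<beta>)\<close> at infinity (\<open>\<theta> = 1\<close>).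
\<close>
lemma ex_fundamental_kernel:
  fixes \<alpha> \<beta> :: real
  assumes \<alpha>: "0 < \<alpha>" "\<alpha> < 1" and \<beta>: "0 < \<beta>" "\<beta> \<le> 1" and N: "real DIM('a::euclidean_space) > 4 * \<beta>"
  obtains Y :: "real \<Rightarrow> 'a::euclidean_space \<Rightarrow> real" where
    "(\<lambda>(t, x). Y t x) \<in> borel_measurable borel"
    "\<And>t x. 0 \<le> Y t x"
    "\<And>t. t > 0 \<Longrightarrow> AE x in lborel. kernel_Y \<alpha> \<beta> t x = Y t x"
    "\<And>\<theta>. 0 < \<theta> \<Longrightarrow> \<theta> \<le> 1 \<Longrightarrow> \<exists>C>0. \<forall>t>0. \<forall>x. x \<noteq> 0 \<longrightarrow>
       Y t x \<le> C * t powr (\<alpha> - 1 - 2 * \<alpha> * \<theta>) * norm x powr (4 * \<beta> * \<theta> - real DIM('a))"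
    "\<exists>c>0. \<forall>t>0. \<forall>x. x \<noteq> 0 \<and> norm x \<le> t powr (\<alpha> / (2 * \<beta>)) \<longrightarrow>
       c * t powr (- 1 - \<alpha>) * norm x powr (4 * \<beta> - real DIM('a)) \<le> Y t x"
proof -
  define H where "H k = mittag_leffler \<alpha> \<alpha> (- (k powr \<beta>))" for k
  obtain m where m: "sets m = sets borel" "AE r in m. 0 < r"
    "\<And>k. k \<ge> 0 \<Longrightarrow> (\<integral>\<^sup>+ r. ennreal (exp (- (k * r))) \<partial>m) = ennreal (H k)"
    using ex_mixing_measure[of \<alpha> \<beta>] \<alpha> \<beta> unfolding H_def by auto
  obtain M where M: "real_distribution M" "AE x in M. 0 < x"
    "\<And>k. k > 0 \<Longrightarrow> (LINT x|M. exp (- (k * x))) = exp (- (k powr \<alpha>))"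
    using ex_stable_law[of \<alpha>] \<alpha> by auto
  have H0: "0 \<le> H k" if "k \<ge> 0" for k
    unfolding H_def by (rule mittag_leffler_stable_mixture(2)[OF M]) (use \<alpha> in auto)
  interpret heat_mixture m H
    by standard (use m H0 in auto)
  obtain c C where c: "c > 0" and C: "C > 0"
    and up: "\<And>z. z > 0 \<Longrightarrow> mittag_leffler \<alpha> \<alpha> (- z) \<le> C * z powr (-2)"
    and low: "\<And>z. z \<ge> 1 \<Longrightarrow> c * z powr (-2) \<le> mittag_leffler \<alpha> \<alpha> (- z)"
    using mittag_leffler_two_sided[OF \<alpha>] by blast
  have Hup: "H k \<le> (C + H 0) * k powr (- (2 * \<beta> * \<theta>))" if k: "k > 0" and \<theta>: "0 < \<theta>" "\<theta> \<le> 1" for k \<theta>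
  proof (cases "k \<le> 1")
    case True
    have "H k \<le> H 0 * 1" using H_antimono[of 0 k] k by simp
    also have "\<dots> \<le> (C + H 0) * k powr (- (2 * \<beta> * \<theta>))"
    proof (intro mult_mono)
      have "1 powr (- (2 * \<beta> * \<theta>)) \<le> k powr (- (2 * \<beta> * \<theta>))"
        by (rule powr_mono2') (use True k \<theta> \<beta> in auto)
      then show "1 \<le> k powr (- (2 * \<beta> * \<theta>))" by simp
    qed (use H0[of 0] C in auto)
    finally show ?thesis .
  next
    case False
    have "H k \<le> C * k powr (- (2 * \<beta>))"
      using up[of "k powr \<beta>"] k unfolding H_def by (simp add: powr_powr mult.commute)
    also have "\<dots> \<le> (C + H 0) * k powr (- (2 * \<beta> * \<theta>))"
      using H0[of 0] C False \<theta> \<beta> by (intro mult_mono powr_mono) (auto simp: mult_le_cancel_left1)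
    finally show ?thesis .
  qed
  have CH: "C + H 0 > 0" using C H0[of 0] by simp
  have Hlow: "c * k powr (- (2 * \<beta>)) \<le> H k" if "k \<ge> 1" for k
    using low[of "k powr \<beta>"] that \<beta> unfolding H_def by (simp add: powr_powr mult.commute ge_one_powr_ge_zero)
  define Y :: "real \<Rightarrow> 'a \<Rightarrow> real" where "Y t x = t powr (\<alpha> - 1) * mix (t powr (\<alpha> / \<beta>)) x" for t x
  have sp: "t powr (\<alpha> / \<beta>) > 0" if "t > 0" for t :: real using that by simp
  show thesis
  proof (rule that[of Y])
    have "(\<lambda>(t, x). Y t x) \<in> borel_measurable (borel \<Otimes>\<^sub>M borel)"
      unfolding Y_def by measurable
    then show "(\<lambda>(t, x). Y t x) \<in> borel_measurable borel" by (simp add: borel_prod)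
    show "0 \<le> Y t x" for t x unfolding Y_def by (simp add: mix_nonneg)
    show "\<exists>C>0. \<forall>t>0. \<forall>x. x \<noteq> 0 \<longrightarrow>
       Y t x \<le> C * t powr (\<alpha> - 1 - 2 * \<alpha> * \<theta>) * norm x powr (4 * \<beta> * \<theta> - real DIM('a))"
      if \<theta>: "0 < \<theta>" "\<theta> \<le> 1" for \<theta>
    proof -
      have s: "0 \<le> 2 * \<beta> * \<theta>" "2 * \<beta> * \<theta> < real DIM('a) / 2"
      proof -
        have "2 * \<beta> * \<theta> \<le> 2 * \<beta> * 1" using \<theta> \<beta> by (intro mult_left_mono) auto
        then show "2 * \<beta> * \<theta> < real DIM('a) / 2" using N by linarith
      qed (use \<theta> \<beta> in simp)
      obtain K where K: "K > 0" "\<And>s (x :: 'a). s > 0 \<Longrightarrow> x \<noteq> 0 \<Longrightarrow>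
        mix s x \<le> K * s powr (- (2 * \<beta> * \<theta>)) * norm x powr (2 * (2 * \<beta> * \<theta>) - real DIM('a))"
        using mix_upper[OF CH s Hup[OF _ \<theta>]] by blast
      show ?thesis
      proof (intro exI[of _ K] conjI allI impI K(1))
        fix t :: real and x :: 'a assume t: "0 < t" and x: "x \<noteq> 0"
        have "Y t x \<le> t powr (\<alpha> - 1) * (K * (t powr (\<alpha> / \<beta>)) powr (- (2 * \<beta> * \<theta>)) * norm x powr (2 * (2 * \<beta> * \<theta>) - real DIM('a)))"
          unfolding Y_def by (intro mult_left_mono K(2) sp t x) auto
        also have "(t powr (\<alpha> / \<beta>)) powr (- (2 * \<beta> * \<theta>)) = t powr (- (2 * \<alpha> * \<theta>))"
          using \<beta> by (simp add: powr_powr mult_ac)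
        also have "2 * (2 * \<beta> * \<theta>) = 4 * \<beta> * \<theta>" by simp
        finally have "Y t x \<le> t powr (\<alpha> - 1) * (K * t powr (- (2 * \<alpha> * \<theta>)) * norm x powr (4 * \<beta> * \<theta> - real DIM('a)))" .
        also have "\<dots> = K * (t powr (\<alpha> - 1) * t powr (- (2 * \<alpha> * \<theta>))) * norm x powr (4 * \<beta> * \<theta> - real DIM('a))"
          by (simp only: mult_ac)
        also have "t powr (\<alpha> - 1) * t powr (- (2 * \<alpha> * \<theta>)) = t powr (\<alpha> - 1 - 2 * \<alpha> * \<theta>)"
          by (simp add: powr_add[symmetric])
        finally show "Y t x \<le> K * t powr (\<alpha> - 1 - 2 * \<alpha> * \<theta>) * norm x powr (4 * \<beta> * \<theta> - real DIM('a))" .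
      qed
    qed
    obtain K where K: "K > 0" "\<And>s (x :: 'a). x \<noteq> 0 \<Longrightarrow> (norm x)\<^sup>2 \<le> s \<Longrightarrow>
      K * s powr (- (2 * \<beta>)) * norm x powr (2 * (2 * \<beta>) - real DIM('a)) \<le> mix s x"
      using mix_lower[OF c CH, of "2 * \<beta>"] Hup[of _ 1] Hlow \<beta> by auto
    show "\<exists>c>0. \<forall>t>0. \<forall>x. x \<noteq> 0 \<and> norm x \<le> t powr (\<alpha> / (2 * \<beta>)) \<longrightarrow>
       c * t powr (- 1 - \<alpha>) * norm x powr (4 * \<beta> - real DIM('a)) \<le> Y t x"
    proof (intro exI[of _ K] conjI allI impI K(1))
      fix t :: real and x :: 'a assume t: "0 < t" and x: "x \<noteq> 0 \<and> norm x \<le> t powr (\<alpha> / (2 * \<beta>))"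
      have "(norm x)\<^sup>2 \<le> (t powr (\<alpha> / (2 * \<beta>)))\<^sup>2" using x by (intro power_mono) auto
      also have "\<dots> = t powr (\<alpha> / \<beta>)" using t by (simp add: powr_powr flip: powr_numeral)
      finally have le: "(norm x)\<^sup>2 \<le> t powr (\<alpha> / \<beta>)" .
      have "K * t powr (- 1 - \<alpha>) * norm x powr (4 * \<beta> - real DIM('a)) =
        t powr (\<alpha> - 1) * (K * (t powr (\<alpha> / \<beta>)) powr (- (2 * \<beta>)) * norm x powr (2 * (2 * \<beta>) - real DIM('a)))"
      proof -
        have "(t powr (\<alpha> / \<beta>)) powr (- (2 * \<beta>)) = t powr (- (2 * \<alpha>))"
          using \<beta> by (simp add: powr_powr mult_ac)
        moreover have "t powr (- 1 - \<alpha>) = t powr (\<alpha> - 1) * t powr (- (2 * \<alpha>))"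
          unfolding powr_add[symmetric] by (rule arg_cong[of _ _ "(powr) t"]) simp
        ultimately show ?thesis by simp
      qed
      also have "\<dots> \<le> Y t x"
        unfolding Y_def by (intro mult_left_mono K(2) le) (use x in auto)
      finally show "K * t powr (- 1 - \<alpha>) * norm x powr (4 * \<beta> - real DIM('a)) \<le> Y t x" .
    qed
    fix t :: real assume t: "t > 0"
    have Yi: "integrable lebesgue (Y t)"
      unfolding Y_def by (subst integrable_completion) (auto intro!: integrable_mult_right fourier_mix(1) sp t)
    have Yf: "fourier (Y t) \<xi> = of_real (t powr (\<alpha> - 1) * mittag_leffler \<alpha> \<alpha> (- (norm \<xi> powr (2 * \<beta>)) * t powr \<alpha>))" for \<xi>
    proof -
      have "fourier (Y t) \<xi> = (CLINT x|lborel. exp (- (\<i> * of_real (x \<bullet> \<xi>))) * of_real (Y t x))"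
        unfolding fourier_def Y_def by (rule integral_completion) measurable
      also have "\<dots> = (CLINT x|lborel. of_real (t powr (\<alpha> - 1)) * (exp (- (\<i> * of_real (x \<bullet> \<xi>))) * of_real (mix (t powr (\<alpha> / \<beta>)) x)))"
        by (simp add: Y_def mult_ac)
      also have "\<dots> = of_real (t powr (\<alpha> - 1)) * of_real (H (t powr (\<alpha> / \<beta>) * (norm \<xi>)\<^sup>2))"
        unfolding integral_mult_right_zero fourier_mix(2)[OF sp[OF t]] ..
      also have "H (t powr (\<alpha> / \<beta>) * (norm \<xi>)\<^sup>2) = mittag_leffler \<alpha> \<alpha> (- (norm \<xi> powr (2 * \<beta>)) * t powr \<alpha>)"
      proof -
        have "((norm \<xi>)\<^sup>2) powr \<beta> = norm \<xi> powr (2 * \<beta>)"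
          by (cases "\<xi> = 0") (auto simp: powr_powr simp flip: powr_numeral)
        then have "(t powr (\<alpha> / \<beta>) * (norm \<xi>)\<^sup>2) powr \<beta> = norm \<xi> powr (2 * \<beta>) * t powr \<alpha>"
          using t \<beta> by (simp add: powr_mult powr_powr)
        then show ?thesis by (simp add: H_def)
      qed
      finally show ?thesis by simp
    qed
    have "integrable lebesgue (kernel_Y \<alpha> \<beta> t :: 'a \<Rightarrow> real) \<and>
      (\<forall>\<xi> :: 'a. fourier (kernel_Y \<alpha> \<beta> t) \<xi> = of_real (t powr (\<alpha> - 1) * mittag_leffler \<alpha> \<alpha> (- (norm \<xi> powr (2 * \<beta>)) * t powr \<alpha>)))"
      unfolding kernel_Y_def by (rule someI[of _ "Y t"]) (use Yi Yf in auto)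
    then have "AE x in lebesgue. kernel_Y \<alpha> \<beta> t x = Y t x"
      using fourier_inj_AE[of "kernel_Y \<alpha> \<beta> t" "Y t"] Yi Yf by auto
    then show "AE x in lborel. kernel_Y \<alpha> \<beta> t x = Y t x" by (simp add: AE_completion_iff)
  qed
qed

section \<open>Time integrals with memory\<close>

lemma nn_integral_powr_tail:
  fixes d T :: real
  assumes d: "d > 0" and T: "T > 0"
  shows "(\<integral>\<^sup>+ x. ennreal (x powr (- 1 - d)) * indicator {T..} x \<partial>lborel) = ennreal (T powr (- d) / d)"
proof -
  have lim: "((\<lambda>x. - (x powr (- d) / d)) \<longlongrightarrow> 0) at_top"
    using d by real_asymp
  have "(\<integral>\<^sup>+ x. ennreal (x powr (- 1 - d)) * indicator {T..} x \<partial>lborel) = ennreal (0 - (- (T powr (- d) / d)))"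
  proof (rule nn_integral_FTC_atLeast[OF _ _ _ lim])
    fix x :: real assume x: "T \<le> x"
    have "((\<lambda>x. - (x powr (- d) / d)) has_real_derivative - ((- d * x powr (- d - 1)) / d)) (at x)"
      by (intro DERIV_minus DERIV_cdivide has_real_derivative_powr) (use x T in auto)
    moreover have "- ((- d * x powr (- d - 1)) / d) = x powr (- 1 - d)"
    proof -
      have "x powr (- d - 1) = x powr (- 1 - d)" by (rule arg_cong[of _ _ "(powr) x"]) simp
      then show ?thesis using d by simp
    qed
    ultimately show "((\<lambda>x. - (x powr (- d) / d)) has_real_derivative x powr (- 1 - d)) (at x)" by simp
  qed auto
  then show ?thesis by simp
qed

text \<open>
  The time factor in the majorant of the kernel at the length scale whose diffusive time is \<open>T\<close>. It
  is the bound with exponent \<open>\<theta>\<close> before \<open>T\<close> and the one with exponent \<open>1\<close> afterwards.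
\<close>
definition memory :: "real \<Rightarrow> real \<Rightarrow> real \<Rightarrow> real \<Rightarrow> real" where
  "memory \<alpha> \<theta> T \<tau> = (if \<tau> < T then \<tau> powr (\<alpha> - 1 - 2 * \<alpha> * \<theta>) * T powr (2 * \<alpha> * \<theta>)
     else \<tau> powr (- 1 - \<alpha>) * T powr (2 * \<alpha>))"

text \<open>
  The factor of the rate that depends on \<open>t\<close>, with \<open>V\<close> in the place of \<open>g(t) powr (2\<beta>)\<close>.
\<close>
definition decay :: "real \<Rightarrow> real \<Rightarrow> real \<Rightarrow> real \<Rightarrow> real" where
  "decay \<alpha> \<gamma> t V = (if \<gamma> < 1 then t powr (- \<gamma>)
      else if \<gamma> = 1 then max (t powr (- 1)) (t powr (- (1 + \<alpha>)) * V * ln t)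
      else max (t powr (- \<gamma>)) (t powr (- (1 + \<alpha>)) * V))"

lemma memory_measurable [measurable]: "memory \<alpha> \<theta> T \<in> borel_measurable borel"
  unfolding memory_def by measurable

lemma memory_nonneg: "0 \<le> memory \<alpha> \<theta> T \<tau>"
  by (simp add: memory_def)

lemma decay_pos: "t > 0 \<Longrightarrow> 0 < decay \<alpha> \<gamma> t V"
  by (auto simp: decay_def less_max_iff_disj)

lemma decay_ge_powr: "t powr (- \<gamma>) \<le> decay \<alpha> \<gamma> t V"
  by (auto simp: decay_def)

lemma decay_scale:
  assumes "t \<ge> 1" "a \<ge> 1" "V \<ge> 0"
  shows "decay \<alpha> \<gamma> t (a * V) \<le> a * decay \<alpha> \<gamma> t V"
proof -
  have m: "max x (a * y) \<le> a * max x y" if "0 \<le> x" for x y :: real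
  proof -
    have "1 * x \<le> a * x" using assms that by (intro mult_right_mono) auto
    moreover have "a * x \<le> a * max x y" "a * y \<le> a * max x y" using assms by (auto intro!: mult_left_mono)
    ultimately show ?thesis by simp
  qed
  have "1 * t powr (-\<gamma>) \<le> a * t powr (- \<gamma>)" using assms by (intro mult_right_mono) auto
  then show ?thesis
    using m[of "t powr (- 1)" "t powr (- (1 + \<alpha>)) * V * ln t"] m[of "t powr (- \<gamma>)" "t powr (- (1 + \<alpha>)) * V"]
    by (auto simp: decay_def mult_ac)
qed

lemma decay_mono:
  assumes "t \<ge> 1" "V \<le> W"
  shows "decay \<alpha> \<gamma> t V \<le> decay \<alpha> \<gamma> t W"
proof -
  have "t powr (- (1 + \<alpha>)) * V \<le> t powr (- (1 + \<alpha>)) * W" using assms by (intro mult_left_mono) auto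
  moreover from this have "t powr (- (1 + \<alpha>)) * V * ln t \<le> t powr (- (1 + \<alpha>)) * W * ln t"
    using assms by (intro mult_right_mono) auto
  ultimately show ?thesis unfolding decay_def by (simp add: max.coboundedI1 max.coboundedI2)
qed

lemma nn_integral_memory:
  assumes \<alpha>: "0 < \<alpha>" and \<theta>: "\<theta> < 1 / 2" and T: "0 < T"
  shows "(\<integral>\<^sup>+ \<tau>. ennreal (indicator {0<..} \<tau> * memory \<alpha> \<theta> T \<tau>) \<partial>lborel) \<le>
    ennreal ((1 / (\<alpha> - 2 * \<alpha> * \<theta>) + 1 / \<alpha>) * T powr \<alpha>)"
proof -
  have d: "\<alpha> - 2 * \<alpha> * \<theta> > 0"
  proof -
    have "\<alpha> * (2 * \<theta>) < \<alpha> * 1" using \<alpha> \<theta> by (intro mult_strict_left_mono) auto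
    then show ?thesis by simp
  qed
  have i: "((\<lambda>k. k powr (\<alpha> - 1 - 2 * \<alpha> * \<theta>)) has_integral (T powr (\<alpha> - 1 - 2 * \<alpha> * \<theta> + 1) / (\<alpha> - 1 - 2 * \<alpha> * \<theta> + 1))) {0..T}"
    by (rule has_integral_powr_from_0) (use d T in auto)
  have A: "(\<integral>\<^sup>+ \<tau>. ennreal (indicator {0..T} \<tau> * \<tau> powr (\<alpha> - 1 - 2 * \<alpha> * \<theta>)) \<partial>lborel) = ennreal (T powr (\<alpha> - 2 * \<alpha> * \<theta>) / (\<alpha> - 2 * \<alpha> * \<theta>))"
    by (subst nn_integral_has_integral_lebesgue[OF _ i]) (auto simp: algebra_simps)
  have B: "(\<integral>\<^sup>+ \<tau>. ennreal (\<tau> powr (- 1 - \<alpha>)) * indicator {T..} \<tau> \<partial>lborel) = ennreal (T powr (- \<alpha>) / \<alpha>)"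
    by (rule nn_integral_powr_tail[OF \<alpha> T])
  have "(\<integral>\<^sup>+ \<tau>. ennreal (indicator {0<..} \<tau> * memory \<alpha> \<theta> T \<tau>) \<partial>lborel) \<le>
    (\<integral>\<^sup>+ \<tau>. ennreal (T powr (2 * \<alpha> * \<theta>)) * ennreal (indicator {0..T} \<tau> * \<tau> powr (\<alpha> - 1 - 2 * \<alpha> * \<theta>)) +
      ennreal (T powr (2 * \<alpha>)) * (ennreal (\<tau> powr (- 1 - \<alpha>)) * indicator {T..} \<tau>) \<partial>lborel)"
    by (intro nn_integral_mono) (auto simp: memory_def ennreal_mult'[symmetric] mult_ac split: split_indicator)
  also have "\<dots> = ennreal (T powr (2 * \<alpha> * \<theta>)) * ennreal (T powr (\<alpha> - 2 * \<alpha> * \<theta>) / (\<alpha> - 2 * \<alpha> * \<theta>)) +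
      ennreal (T powr (2 * \<alpha>)) * ennreal (T powr (- \<alpha>) / \<alpha>)"
    by (subst nn_integral_add) (auto simp: nn_integral_cmult A B)
  also have "\<dots> = ennreal (T powr (2 * \<alpha> * \<theta>) * T powr (\<alpha> - 2 * \<alpha> * \<theta>) / (\<alpha> - 2 * \<alpha> * \<theta>) + T powr (2 * \<alpha>) * T powr (- \<alpha>) / \<alpha>)"
    using d \<alpha> by (simp add: ennreal_mult'[symmetric] ennreal_plus[symmetric] del: ennreal_plus)
  also have "T powr (2 * \<alpha> * \<theta>) * T powr (\<alpha> - 2 * \<alpha> * \<theta>) / (\<alpha> - 2 * \<alpha> * \<theta>) + T powr (2 * \<alpha>) * T powr (- \<alpha>) / \<alpha>
    = (1 / (\<alpha> - 2 * \<alpha> * \<theta>) + 1 / \<alpha>) * T powr \<alpha>"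
    by (simp add: powr_add[symmetric] algebra_simps)
  finally show ?thesis .
qed

lemma nn_integral_source_decay:
  assumes t: "t \<ge> 2"
  shows "\<gamma> < 1 \<Longrightarrow> (\<integral>\<^sup>+ s. ennreal (indicator {0<..<t} s * (1 + s) powr (- \<gamma>)) \<partial>lborel) \<le> ennreal (2 powr (1 - \<gamma>) / (1 - \<gamma>) * t powr (1 - \<gamma>))"
    and "\<gamma> = 1 \<Longrightarrow> (\<integral>\<^sup>+ s. ennreal (indicator {0<..<t} s * (1 + s) powr (- \<gamma>)) \<partial>lborel) \<le> ennreal (2 * ln t)"
    and "\<gamma> > 1 \<Longrightarrow> (\<integral>\<^sup>+ s. ennreal (indicator {0<..<t} s * (1 + s) powr (- \<gamma>)) \<partial>lborel) \<le> ennreal (1 / (\<gamma> - 1))"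
proof -
  have le: "(\<integral>\<^sup>+ s. ennreal (indicator {0<..<t} s * (1 + s) powr (- \<gamma>)) \<partial>lborel) \<le>
    (\<integral>\<^sup>+ s. ennreal ((1 + s) powr (- \<gamma>)) * indicator {0..t} s \<partial>lborel)"
    by (intro nn_integral_mono) (auto split: split_indicator)
  have ne: "(\<integral>\<^sup>+ s. ennreal ((1 + s) powr (- \<gamma>)) * indicator {0..t} s \<partial>lborel) =
    ennreal ((1 + t) powr (1 - \<gamma>) / (1 - \<gamma>) - (1 + 0) powr (1 - \<gamma>) / (1 - \<gamma>))" if "\<gamma> \<noteq> 1"
  proof (rule nn_integral_FTC_Icc[where F = "\<lambda>s. (1 + s) powr (1 - \<gamma>) / (1 - \<gamma>)"])
    fix s :: real assume s: "s \<in> {0..t}"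
    have "((\<lambda>s. (1 + s) powr (1 - \<gamma>) / (1 - \<gamma>)) has_real_derivative ((1 - \<gamma>) * (1 + s) powr (1 - \<gamma> - of_nat 1) * 1) / (1 - \<gamma>)) (at s)"
      by (intro DERIV_cdivide DERIV_fun_powr) (use s in \<open>auto intro!: derivative_eq_intros\<close>)
    then show "((\<lambda>s. (1 + s) powr (1 - \<gamma>) / (1 - \<gamma>)) has_real_derivative (1 + s) powr (- \<gamma>)) (at s)"
      using that by simp
  next
    show "0 \<le> t" using t by simp
  qed auto
  show "(\<integral>\<^sup>+ s. ennreal (indicator {0<..<t} s * (1 + s) powr (- \<gamma>)) \<partial>lborel) \<le> ennreal (2 powr (1 - \<gamma>) / (1 - \<gamma>) * t powr (1 - \<gamma>))"
    if g: "\<gamma> < 1"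
  proof -
    have "(1 + t) powr (1 - \<gamma>) \<le> (2 * t) powr (1 - \<gamma>)" using t g by (intro powr_mono2) auto
    then have "(1 + t) powr (1 - \<gamma>) / (1 - \<gamma>) - 1 / (1 - \<gamma>) \<le> (2 * t) powr (1 - \<gamma>) / (1 - \<gamma>)"
      unfolding diff_divide_distrib[symmetric] using g by (intro divide_right_mono) auto
    also have "\<dots> = 2 powr (1 - \<gamma>) / (1 - \<gamma>) * t powr (1 - \<gamma>)" by (simp add: powr_mult)
    finally show ?thesis using ne g by (intro order_trans[OF le]) (auto intro!: ennreal_leI)
  qed
  show "(\<integral>\<^sup>+ s. ennreal (indicator {0<..<t} s * (1 + s) powr (- \<gamma>)) \<partial>lborel) \<le> ennreal (1 / (\<gamma> - 1))"
    if g: "\<gamma> > 1"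
  proof -
    have "(1 + t) powr (1 - \<gamma>) / (1 - \<gamma>) \<le> 0" using g by (intro divide_nonneg_nonpos) auto
    moreover have "- (1 / (1 - \<gamma>)) = 1 / (\<gamma> - 1)" by (simp add: minus_divide_right)
    ultimately have "(1 + t) powr (1 - \<gamma>) / (1 - \<gamma>) - 1 / (1 - \<gamma>) \<le> 1 / (\<gamma> - 1)" by linarith
    then show ?thesis using ne g by (intro order_trans[OF le]) (auto intro!: ennreal_leI)
  qed
  show "(\<integral>\<^sup>+ s. ennreal (indicator {0<..<t} s * (1 + s) powr (- \<gamma>)) \<partial>lborel) \<le> ennreal (2 * ln t)"
    if g: "\<gamma> = 1"
  proof -
    have "(\<integral>\<^sup>+ s. ennreal ((1 + s) powr (- \<gamma>)) * indicator {0..t} s \<partial>lborel) = ennreal (ln (1 + t) - ln (1 + 0))"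
      by (rule nn_integral_FTC_Icc)
        (use t g in \<open>auto intro!: derivative_eq_intros simp: powr_minus_divide\<close>)
    moreover have "ln (1 + t) \<le> 2 * ln t"
    proof -
      have "2 * t \<le> t * t" using t by (intro mult_right_mono) auto
      then have "1 + t \<le> t * t" using t by linarith
      then have "ln (1 + t) \<le> ln (t * t)" using t by simp
      then show ?thesis using t by (simp add: ln_mult)
    qed
    ultimately show ?thesis by (intro order_trans[OF le]) (auto intro!: ennreal_leI)
  qed
qed

lemma source_decay_late:
  fixes s t :: real
  assumes t: "t \<ge> 1" and s: "t / 2 \<le> s" "s \<le> t"
  shows "(1 + s) powr (- \<gamma>) \<le> 2 powr \<bar>\<gamma>\<bar> * t powr (- \<gamma>)"
    and "2 powr (- \<bar>\<gamma>\<bar>) * t powr (- \<gamma>) \<le> (1 + s) powr (- \<gamma>)"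
proof -
  have b: "t / 2 \<le> 1 + s" "1 + s \<le> 2 * t" using t s by auto
  have e: "(t / 2) powr (- \<gamma>) = 2 powr \<gamma> * t powr (- \<gamma>)" "(2 * t) powr (- \<gamma>) = 2 powr (- \<gamma>) * t powr (- \<gamma>)"
    by (auto simp: powr_divide powr_mult powr_minus field_simps)
  show "(1 + s) powr (- \<gamma>) \<le> 2 powr \<bar>\<gamma>\<bar> * t powr (- \<gamma>)"
  proof (cases "\<gamma> \<ge> 0")
    case True
    then have "(1 + s) powr (- \<gamma>) \<le> (t / 2) powr (- \<gamma>)" using b t by (intro powr_mono2') auto
    then show ?thesis using True by (simp add: e)
  next
    case False
    then have "(1 + s) powr (- \<gamma>) \<le> (2 * t) powr (- \<gamma>)" using b t by (intro powr_mono2) auto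
    then show ?thesis using False unfolding e by simp
  qed
  show "2 powr (- \<bar>\<gamma>\<bar>) * t powr (- \<gamma>) \<le> (1 + s) powr (- \<gamma>)"
  proof (cases "\<gamma> \<ge> 0")
    case True
    then have "(2 * t) powr (- \<gamma>) \<le> (1 + s) powr (- \<gamma>)" using b t by (intro powr_mono2') auto
    then show ?thesis using True unfolding e by simp
  next
    case False
    then have "(t / 2) powr (- \<gamma>) \<le> (1 + s) powr (- \<gamma>)" using b t by (intro powr_mono2) auto
    then show ?thesis using False unfolding e by simp
  qed
qed

text \<open>
  Either \<open>s \<ge> t/2\<close>, and the source is comparable to \<open>t powr (-\<gamma>)\<close>, while the memory kernel has
  total mass of order \<open>T\<^sup>\<alpha>\<close>; or \<open>s < t/2\<close>, and the elapsed time exceeds \<open>t/2 \<ge> T\<close>, so that the memory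
  kernel is of order \<open>t powr (-1-\<alpha>) T powr (2\<alpha>)\<close>, while the source has mass at most \<open>D E\<close>. For
  \<open>\<gamma> < 1\<close> the first contribution dominates because \<open>T \<le> t\<close>.
\<close>
lemma memory_source_upper:
  fixes \<alpha> \<gamma> \<theta> :: real
  assumes \<alpha>: "0 < \<alpha>" and \<theta>: "\<theta> < 1 / 2"
  obtains C where "C > 0" "\<And>t T. t \<ge> 2 \<Longrightarrow> 0 < T \<Longrightarrow> T \<le> t / 2 \<Longrightarrow>
    (\<integral>\<^sup>+ s. ennreal (indicator {0<..<t} s * memory \<alpha> \<theta> T (t - s) * (1 + s) powr (- \<gamma>)) \<partial>lborel)
    \<le> ennreal (C * T powr \<alpha> * decay \<alpha> \<gamma> t (T powr \<alpha>))"
proof -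
  define A where "A = 2 powr \<bar>\<gamma>\<bar> * (1 / (\<alpha> - 2 * \<alpha> * \<theta>) + 1 / \<alpha>)"
  define D where "D = (if \<gamma> < 1 then 2 powr (1 - \<gamma>) / (1 - \<gamma>) else if \<gamma> = 1 then 2 else 1 / (\<gamma> - 1))"
  have d: "\<alpha> - 2 * \<alpha> * \<theta> > 0"
  proof -
    have "\<alpha> * (2 * \<theta>) < \<alpha> * 1" using \<alpha> \<theta> by (intro mult_strict_left_mono) auto
    then show ?thesis by simp
  qed
  have A: "A > 0" unfolding A_def using d \<alpha> by (auto intro!: mult_pos_pos add_pos_pos)
  have D: "D > 0" by (auto simp: D_def)
  show thesis
  proof (rule that[of "A + 2 powr (1 + \<alpha>) * D"])
    show "A + 2 powr (1 + \<alpha>) * D > 0" using A D by (simp add: add_pos_pos)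
    fix t T :: real assume t: "t \<ge> 2" and T: "0 < T" "T \<le> t / 2"
    define E where "E = (if \<gamma> < 1 then t powr (1 - \<gamma>) else if \<gamma> = 1 then ln t else 1)"
    have E: "E \<ge> 0" using t by (auto simp: E_def)
    have src: "(\<integral>\<^sup>+ s. ennreal (indicator {0<..<t} s * (1 + s) powr (- \<gamma>)) \<partial>lborel) \<le> ennreal (D * E)"
      using nn_integral_source_decay[OF t, of \<gamma>] by (cases "\<gamma> < 1"; cases "\<gamma> = 1") (auto simp: D_def E_def)
    have mem: "(\<integral>\<^sup>+ s. ennreal (indicator {0<..<t} s * memory \<alpha> \<theta> T (t - s)) \<partial>lborel) \<le>
      ennreal ((1 / (\<alpha> - 2 * \<alpha> * \<theta>) + 1 / \<alpha>) * T powr \<alpha>)"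
    proof -
      have "(\<integral>\<^sup>+ s. ennreal (indicator {0<..<t} s * memory \<alpha> \<theta> T (t - s)) \<partial>lborel) \<le>
        (\<integral>\<^sup>+ s. ennreal (indicator {0<..} (t - s) * memory \<alpha> \<theta> T (t - s)) \<partial>lborel)"
        by (intro nn_integral_mono) (auto simp: memory_nonneg split: split_indicator)
      also have "\<dots> = (\<integral>\<^sup>+ \<tau>. ennreal (indicator {0<..} \<tau> * memory \<alpha> \<theta> T \<tau>) \<partial>lborel)"
        by (subst (2) nn_integral_real_affine[where c = "-1" and t = t]) auto
      also note nn_integral_memory[OF \<alpha> \<theta> T(1)]
      finally show ?thesis .
    qed
    have "(\<integral>\<^sup>+ s. ennreal (indicator {0<..<t} s * memory \<alpha> \<theta> T (t - s) * (1 + s) powr (- \<gamma>)) \<partial>lborel) \<le>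
      (\<integral>\<^sup>+ s. ennreal (2 powr \<bar>\<gamma>\<bar> * t powr (- \<gamma>)) * ennreal (indicator {0<..<t} s * memory \<alpha> \<theta> T (t - s)) +
        ennreal (2 powr (1 + \<alpha>) * t powr (- 1 - \<alpha>) * T powr (2 * \<alpha>)) * ennreal (indicator {0<..<t} s * (1 + s) powr (- \<gamma>)) \<partial>lborel)"
    proof (rule nn_integral_mono)
      fix s :: real
      show "ennreal (indicator {0<..<t} s * memory \<alpha> \<theta> T (t - s) * (1 + s) powr (- \<gamma>)) \<le>
        ennreal (2 powr \<bar>\<gamma>\<bar> * t powr (- \<gamma>)) * ennreal (indicator {0<..<t} s * memory \<alpha> \<theta> T (t - s)) +
        ennreal (2 powr (1 + \<alpha>) * t powr (- 1 - \<alpha>) * T powr (2 * \<alpha>)) * ennreal (indicator {0<..<t} s * (1 + s) powr (- \<gamma>))"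
      proof (cases "s \<in> {0<..<t}")
        case s: True
        show ?thesis
        proof (cases "t / 2 \<le> s")
          case True
          have "memory \<alpha> \<theta> T (t - s) * (1 + s) powr (- \<gamma>) \<le> memory \<alpha> \<theta> T (t - s) * (2 powr \<bar>\<gamma>\<bar> * t powr (- \<gamma>))"
            using source_decay_late(1)[of t s \<gamma>] True s t by (intro mult_left_mono memory_nonneg) auto
          then have "ennreal (memory \<alpha> \<theta> T (t - s) * (1 + s) powr (- \<gamma>)) \<le> ennreal (2 powr \<bar>\<gamma>\<bar> * t powr (- \<gamma>)) * ennreal (memory \<alpha> \<theta> T (t - s))"
            by (subst ennreal_mult'[symmetric]) (auto intro!: ennreal_leI simp: mult_ac)
          then show ?thesis using s by (auto intro: order_trans)
        next
          case False
          have "memory \<alpha> \<theta> T (t - s) = (t - s) powr (- 1 - \<alpha>) * T powr (2 * \<alpha>)"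
            using False T by (simp add: memory_def)
          also have "(t - s) powr (- 1 - \<alpha>) \<le> (t / 2) powr (- 1 - \<alpha>)"
            using False t \<alpha> by (intro powr_mono2') auto
          also have "(t / 2) powr (- 1 - \<alpha>) = 2 powr (1 + \<alpha>) * t powr (- 1 - \<alpha>)"
          proof -
            have "2 powr (- 1 - \<alpha>) = 1 / 2 powr (1 + \<alpha>)" by (simp add: powr_minus_divide[symmetric] powr_diff powr_add powr_minus field_simps)
            then show ?thesis by (simp add: powr_divide)
          qed
          finally have "memory \<alpha> \<theta> T (t - s) \<le> 2 powr (1 + \<alpha>) * t powr (- 1 - \<alpha>) * T powr (2 * \<alpha>)"
            by (simp add: mult_right_mono)
          then have "memory \<alpha> \<theta> T (t - s) * (1 + s) powr (- \<gamma>) \<le> (2 powr (1 + \<alpha>) * t powr (- 1 - \<alpha>) * T powr (2 * \<alpha>)) * (1 + s) powr (- \<gamma>)"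
            by (rule mult_right_mono) simp
          then have "ennreal (memory \<alpha> \<theta> T (t - s) * (1 + s) powr (- \<gamma>)) \<le> ennreal (2 powr (1 + \<alpha>) * t powr (- 1 - \<alpha>) * T powr (2 * \<alpha>)) * ennreal ((1 + s) powr (- \<gamma>))"
            by (simp add: ennreal_mult'[symmetric] ennreal_leI)
          then show ?thesis using s by (auto intro: order_trans)
        qed
      qed simp
    qed
    also have "\<dots> = ennreal (2 powr \<bar>\<gamma>\<bar> * t powr (- \<gamma>)) * (\<integral>\<^sup>+ s. ennreal (indicator {0<..<t} s * memory \<alpha> \<theta> T (t - s)) \<partial>lborel) +
        ennreal (2 powr (1 + \<alpha>) * t powr (- 1 - \<alpha>) * T powr (2 * \<alpha>)) * (\<integral>\<^sup>+ s. ennreal (indicator {0<..<t} s * (1 + s) powr (- \<gamma>)) \<partial>lborel)"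
      by (subst nn_integral_add) (auto simp: nn_integral_cmult)
    also have "\<dots> \<le> ennreal (2 powr \<bar>\<gamma>\<bar> * t powr (- \<gamma>)) * ennreal ((1 / (\<alpha> - 2 * \<alpha> * \<theta>) + 1 / \<alpha>) * T powr \<alpha>) +
        ennreal (2 powr (1 + \<alpha>) * t powr (- 1 - \<alpha>) * T powr (2 * \<alpha>)) * ennreal (D * E)"
      by (intro add_mono mult_left_mono mem src) auto
    also have "\<dots> = ennreal (A * T powr \<alpha> * t powr (- \<gamma>) + 2 powr (1 + \<alpha>) * D * T powr \<alpha> * (t powr (- 1 - \<alpha>) * T powr \<alpha> * E))"
    proof -
      have "T powr (2 * \<alpha>) = T powr \<alpha> * T powr \<alpha>" by (simp add: powr_add[symmetric])
      then show ?thesis using d \<alpha> D E unfolding A_def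
        by (simp add: ennreal_mult'[symmetric] ennreal_plus[symmetric] add_nonneg_nonneg mult_ac del: ennreal_plus)
    qed
    also have "\<dots> \<le> ennreal ((A + 2 powr (1 + \<alpha>) * D) * T powr \<alpha> * decay \<alpha> \<gamma> t (T powr \<alpha>))"
    proof (rule ennreal_leI)
      have "t powr (- 1 - \<alpha>) * T powr \<alpha> * E \<le> decay \<alpha> \<gamma> t (T powr \<alpha>)"
      proof (cases "\<gamma> < 1")
        case True
        have "T powr \<alpha> \<le> t powr \<alpha>" using T t \<alpha> by (intro powr_mono2) auto
        then have "t powr (- 1 - \<alpha>) * T powr \<alpha> * t powr (1 - \<gamma>) \<le> t powr (- 1 - \<alpha>) * t powr \<alpha> * t powr (1 - \<gamma>)"
          by (intro mult_right_mono mult_left_mono) auto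
        also have "\<dots> = t powr (- \<gamma>)"
          unfolding powr_add[symmetric] by (rule arg_cong[of _ _ "(powr) t"]) simp
        finally show ?thesis using True by (simp add: E_def decay_def)
      next
        case False
        have "t powr (- 1 - \<alpha>) = t powr (- (1 + \<alpha>))" by (rule arg_cong[of _ _ "(powr) t"]) simp
        then show ?thesis using False by (auto simp: E_def decay_def)
      qed
      then have "2 powr (1 + \<alpha>) * D * T powr \<alpha> * (t powr (- 1 - \<alpha>) * T powr \<alpha> * E) \<le> 2 powr (1 + \<alpha>) * D * T powr \<alpha> * decay \<alpha> \<gamma> t (T powr \<alpha>)"
        using D by (intro mult_left_mono) auto
      moreover have "A * T powr \<alpha> * t powr (- \<gamma>) \<le> A * T powr \<alpha> * decay \<alpha> \<gamma> t (T powr \<alpha>)"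
        using A by (intro mult_left_mono decay_ge_powr) auto
      ultimately show "A * T powr \<alpha> * t powr (- \<gamma>) + 2 powr (1 + \<alpha>) * D * T powr \<alpha> * (t powr (- 1 - \<alpha>) * T powr \<alpha> * E) \<le>
        (A + 2 powr (1 + \<alpha>) * D) * T powr \<alpha> * decay \<alpha> \<gamma> t (T powr \<alpha>)"
        by (simp add: algebra_simps)
    qed
    finally show "(\<integral>\<^sup>+ s. ennreal (indicator {0<..<t} s * memory \<alpha> \<theta> T (t - s) * (1 + s) powr (- \<gamma>)) \<partial>lborel)
      \<le> ennreal ((A + 2 powr (1 + \<alpha>) * D) * T powr \<alpha> * decay \<alpha> \<gamma> t (T powr \<alpha>))" .
  qed
qed

text \<open>
  The two contributions of the upper estimate are found again: elapsed times between \<open>T\<close> and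
  \<open>2T\<close> give \<open>t powr (-\<gamma>)\<close>, and sources emitted before \<open>t/2\<close> give the other term of the maximum.
\<close>
lemma memory_source_lower:
  fixes \<alpha> \<gamma> :: real
  assumes \<alpha>: "0 < \<alpha>"
  obtains c where "c > 0" "\<And>t T. t \<ge> 2 \<Longrightarrow> 0 < T \<Longrightarrow> T \<le> t / 4 \<Longrightarrow>
    ennreal (c * T powr (- \<alpha>) * decay \<alpha> \<gamma> t (T powr \<alpha>)) \<le>
    (\<integral>\<^sup>+ s. ennreal (indicator {0<..<t - T} s * (t - s) powr (- 1 - \<alpha>) * (1 + s) powr (- \<gamma>)) \<partial>lborel)"
proof -
  define c1 where "c1 = 2 powr (- 1 - \<alpha>) * 2 powr (- \<bar>\<gamma>\<bar>)"
  define c2 where "c2 = (if \<gamma> = 1 then 1 / 2 else 2 powr (- \<gamma>))"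
  define c where "c = min c1 c2"
  have c: "c > 0" "c \<le> c1" "c \<le> c2" by (auto simp: c_def c1_def c2_def)
  show thesis
  proof (rule that[OF c(1)])
    fix t T :: real assume t: "t \<ge> 2" and T: "0 < T" "T \<le> t / 4"
    let ?I = "\<integral>\<^sup>+ s. ennreal (indicator {0<..<t - T} s * (t - s) powr (- 1 - \<alpha>) * (1 + s) powr (- \<gamma>)) \<partial>lborel"
    have late: "ennreal (c1 * T powr (- \<alpha>) * t powr (- \<gamma>)) \<le> ?I"
    proof -
      have "c1 * T powr (- \<alpha>) * t powr (- \<gamma>) = ((2 * T) powr (- 1 - \<alpha>) * (2 powr (- \<bar>\<gamma>\<bar>) * t powr (- \<gamma>))) * T"
      proof -
        have "T powr (- \<alpha>) = T powr (- 1 - \<alpha>) * T powr 1" unfolding powr_add[symmetric] by simp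
        then show ?thesis using T by (simp add: c1_def powr_mult)
      qed
      then have "ennreal (c1 * T powr (- \<alpha>) * t powr (- \<gamma>)) =
        (\<integral>\<^sup>+ s. ennreal ((2 * T) powr (- 1 - \<alpha>) * (2 powr (- \<bar>\<gamma>\<bar>) * t powr (- \<gamma>))) * indicator {t - 2 * T<..<t - T} s \<partial>lborel)"
      proof -
        have "emeasure lborel {t - 2 * T<..<t - T} = ennreal T" using T by simp
        then show ?thesis
          using \<open>c1 * T powr (- \<alpha>) * t powr (- \<gamma>) = _\<close> T
          by (subst nn_integral_cmult_indicator) (simp_all only: ennreal_mult' powr_ge_zero mult_nonneg_nonneg sets_lborel greaterThanLessThan_borel)
      qed
      also have "\<dots> \<le> ?I"
      proof (rule nn_integral_mono)
        fix s :: real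
        show "ennreal ((2 * T) powr (- 1 - \<alpha>) * (2 powr (- \<bar>\<gamma>\<bar>) * t powr (- \<gamma>))) * indicator {t - 2 * T<..<t - T} s \<le>
          ennreal (indicator {0<..<t - T} s * (t - s) powr (- 1 - \<alpha>) * (1 + s) powr (- \<gamma>))"
        proof (cases "s \<in> {t - 2 * T<..<t - T}")
          case True
          have "(2 * T) powr (- 1 - \<alpha>) * (2 powr (- \<bar>\<gamma>\<bar>) * t powr (- \<gamma>)) \<le> (t - s) powr (- 1 - \<alpha>) * (1 + s) powr (- \<gamma>)"
            using True T t \<alpha> by (intro mult_mono powr_mono2' source_decay_late(2)) auto
          then show ?thesis using True T t by (auto intro!: ennreal_leI)
        qed simp
      qed
      finally show ?thesis .
    qed
    have early: "ennreal (t powr (- 1 - \<alpha>)) * (\<integral>\<^sup>+ s. ennreal ((1 + s) powr (- \<gamma>)) * indicator {0..t / 2} s \<partial>lborel) \<le> ?I"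
    proof -
      have "ennreal (t powr (- 1 - \<alpha>)) * (\<integral>\<^sup>+ s. ennreal ((1 + s) powr (- \<gamma>)) * indicator {0..t / 2} s \<partial>lborel) =
        (\<integral>\<^sup>+ s. ennreal (t powr (- 1 - \<alpha>)) * (ennreal ((1 + s) powr (- \<gamma>)) * indicator {0..t / 2} s) \<partial>lborel)"
        by (rule nn_integral_cmult[symmetric]) auto
      also have "\<dots> \<le> ?I"
      proof (rule nn_integral_mono_AE, rule eventually_mono[OF AE_lborel_singleton[of 0]])
        fix s :: real assume s0: "s \<noteq> 0"
        show "ennreal (t powr (- 1 - \<alpha>)) * (ennreal ((1 + s) powr (- \<gamma>)) * indicator {0..t / 2} s) \<le>
          ennreal (indicator {0<..<t - T} s * (t - s) powr (- 1 - \<alpha>) * (1 + s) powr (- \<gamma>))"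
        proof (cases "s \<in> {0..t / 2}")
          case True
          have "t powr (- 1 - \<alpha>) * (1 + s) powr (- \<gamma>) \<le> (t - s) powr (- 1 - \<alpha>) * (1 + s) powr (- \<gamma>)"
            using True t \<alpha> by (intro mult_right_mono powr_mono2') auto
          then show ?thesis using True T t s0
            by (auto simp: ennreal_mult'[symmetric] intro!: ennreal_leI)
        qed simp
      qed
      finally show ?thesis .
    qed
    have Tpos: "T powr (- \<alpha>) * T powr \<alpha> = 1" using T by (simp add: powr_add[symmetric])
    have te: "t powr (- 1 - \<alpha>) = t powr (- (1 + \<alpha>))" by (rule arg_cong[of _ _ "(powr) t"]) simp
    have first: "ennreal (c * T powr (- \<alpha>) * t powr (- \<gamma>)) \<le> ?I"
      using c by (intro order_trans[OF _ late] ennreal_leI mult_right_mono) auto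
    have le_max: "ennreal (c * T powr (- \<alpha>) * max x y) \<le> ?I"
      if "ennreal (c * T powr (- \<alpha>) * x) \<le> ?I" "ennreal (c * T powr (- \<alpha>) * y) \<le> ?I" for x y
      using that by (auto simp: max_def)
    consider "\<gamma> < 1" | "\<gamma> = 1" | "\<gamma> > 1" by linarith
    then show "ennreal (c * T powr (- \<alpha>) * decay \<alpha> \<gamma> t (T powr \<alpha>)) \<le> ?I"
    proof cases
      case 1
      then show ?thesis using first by (simp add: decay_def)
    next
      case 2
      have "(\<integral>\<^sup>+ s. ennreal ((1 + s) powr (- \<gamma>)) * indicator {0..t / 2} s \<partial>lborel) = ennreal (ln (1 + t / 2) - ln (1 + 0))"
        by (rule nn_integral_FTC_Icc)
          (use t 2 in \<open>auto intro!: derivative_eq_intros simp: powr_minus_divide\<close>)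
      moreover have "c2 * ln t \<le> ln (1 + t / 2)"
      proof -
        have "t \<le> (1 + t / 2) * (1 + t / 2)" by (simp add: algebra_simps)
        then have "ln t \<le> ln ((1 + t / 2) * (1 + t / 2))" using t by (subst ln_le_cancel_iff) auto
        also have "\<dots> = 2 * ln (1 + t / 2)" using t by (subst ln_mult) auto
        finally show ?thesis by (simp add: c2_def 2)
      qed
      ultimately have "ennreal (t powr (- 1 - \<alpha>) * (c2 * ln t)) \<le> ?I"
        by (intro order_trans[OF _ early]) (auto simp: ennreal_mult' intro!: mult_left_mono ennreal_leI)
      moreover have "c * T powr (- \<alpha>) * (t powr (- (1 + \<alpha>)) * T powr \<alpha> * ln t) \<le> t powr (- 1 - \<alpha>) * (c2 * ln t)"
      proof -
        have "c * T powr (- \<alpha>) * (t powr (- (1 + \<alpha>)) * T powr \<alpha> * ln t) = c * (t powr (- 1 - \<alpha>) * ln t) * (T powr (- \<alpha>) * T powr \<alpha>)"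
          unfolding te by (simp only: mult_ac)
        also have "\<dots> \<le> c2 * (t powr (- 1 - \<alpha>) * ln t) * (T powr (- \<alpha>) * T powr \<alpha>)"
          using c t by (intro mult_right_mono) auto
        finally show ?thesis unfolding Tpos by (simp only: mult_ac mult_1)
      qed
      ultimately have "ennreal (c * T powr (- \<alpha>) * (t powr (- (1 + \<alpha>)) * T powr \<alpha> * ln t)) \<le> ?I"
        by (meson ennreal_leI order_trans)
      then have "ennreal (c * T powr (- \<alpha>) * max (t powr (- \<gamma>)) (t powr (- (1 + \<alpha>)) * T powr \<alpha> * ln t)) \<le> ?I"
        by (rule le_max[OF first])
      moreover have "decay \<alpha> \<gamma> t (T powr \<alpha>) = max (t powr (- \<gamma>)) (t powr (- (1 + \<alpha>)) * T powr \<alpha> * ln t)"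
        using 2 by (simp only: decay_def less_irrefl if_False refl if_True)
      ultimately show ?thesis by (simp only:)
    next
      case 3
      have "ennreal c2 \<le> (\<integral>\<^sup>+ s. ennreal c2 * indicator {0..1 :: real} s \<partial>lborel)"
        by (subst nn_integral_cmult_indicator) auto
      also have "\<dots> \<le> (\<integral>\<^sup>+ s. ennreal ((1 + s) powr (- \<gamma>)) * indicator {0..t / 2} s \<partial>lborel)"
        using t 3 by (intro nn_integral_mono) (auto simp: c2_def split: split_indicator intro!: ennreal_leI powr_mono2')
      finally have "ennreal (t powr (- 1 - \<alpha>) * c2) \<le> ?I"
        by (intro order_trans[OF _ early]) (auto simp: ennreal_mult' intro!: mult_left_mono)
      moreover have "c * T powr (- \<alpha>) * (t powr (- (1 + \<alpha>)) * T powr \<alpha>) \<le> t powr (- 1 - \<alpha>) * c2"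
      proof -
        have "c * T powr (- \<alpha>) * (t powr (- (1 + \<alpha>)) * T powr \<alpha>) = c * t powr (- 1 - \<alpha>) * (T powr (- \<alpha>) * T powr \<alpha>)"
          unfolding te by (simp only: mult_ac)
        also have "\<dots> \<le> c2 * t powr (- 1 - \<alpha>) * (T powr (- \<alpha>) * T powr \<alpha>)"
          using c t by (intro mult_right_mono) auto
        finally show ?thesis unfolding Tpos by (simp only: mult_ac mult_1)
      qed
      ultimately have "ennreal (c * T powr (- \<alpha>) * (t powr (- (1 + \<alpha>)) * T powr \<alpha>)) \<le> ?I"
        by (meson ennreal_leI order_trans)
      then have "ennreal (c * T powr (- \<alpha>) * max (t powr (- \<gamma>)) (t powr (- (1 + \<alpha>)) * T powr \<alpha>)) \<le> ?I"
        by (rule le_max[OF first])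
      moreover have "decay \<alpha> \<gamma> t (T powr \<alpha>) = max (t powr (- \<gamma>)) (t powr (- (1 + \<alpha>)) * T powr \<alpha>)"
        using 3 by (simp add: decay_def)
      ultimately show ?thesis by (simp only:)
    qed
  qed
qed

section \<open>Estimates in Lebesgue spaces\<close>

lemma powr_le_one_plus:
  fixes r P :: real
  assumes "0 \<le> r" "1 \<le> P"
  shows "r \<le> r powr P / P + (1 - 1 / P)"
proof (cases "r = 0")
  case True
  then show ?thesis using assms by (simp add: field_simps)
next
  case False
  then have "(r powr P) powr (1 / P) * 1 powr (1 - 1 / P) \<le> 1 / P * r powr P + (1 - 1 / P) * 1"
    using assms by (intro Youngs_inequality_0) auto
  then show ?thesis using assms False by (simp add: powr_powr)
qed

text \<open>
  Young's inequality \<open>K \<le> a powr (1-P) K\<^sup>P / P + a (1 - 1/P)\<close> holds for every \<open>a > 0\<close>. Integrated with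
  \<open>a = w/q\<close> its last term is \<open>w (1 - 1/P)\<close>, which is absorbed on the left. The number \<open>w\<close> is only required to
  lie below the integral, because the integral may be infinite.
\<close>
lemma nn_integral_jensen_powr:
  fixes K :: "'b \<Rightarrow> real" and G :: "'b \<Rightarrow> ennreal"
  assumes [measurable]: "K \<in> borel_measurable M" "G \<in> borel_measurable M"
    and K: "\<And>y. 0 \<le> K y"
    and q: "q > 0" "(\<integral>\<^sup>+ y. G y \<partial>M) \<le> ennreal q"
    and P: "1 \<le> P"
    and w: "0 \<le> w" "ennreal w \<le> (\<integral>\<^sup>+ y. ennreal (K y) * G y \<partial>M)"
  shows "ennreal (w powr P) \<le> ennreal (q powr (P - 1)) * (\<integral>\<^sup>+ y. ennreal (K y powr P) * G y \<partial>M)"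
proof (cases "w = 0")
  case True
  then show ?thesis by simp
next
  case False
  then have w0: "w > 0" using w by simp
  define a where "a = w / q"
  have a: "a > 0" using w0 q by (simp add: a_def)
  define I where "I = (\<integral>\<^sup>+ y. ennreal (K y powr P) * G y \<partial>M)"
  have young: "K y \<le> a powr (1 - P) / P * K y powr P + a * (1 - 1 / P)" for y
  proof -
    have "a * (K y / a) \<le> a * ((K y / a) powr P / P + (1 - 1 / P))"
      using powr_le_one_plus[of "K y / a" P] K[of y] a P by (intro mult_left_mono) auto
    moreover have "a * ((K y / a) powr P / P) = a powr (1 - P) / P * K y powr P"
    proof -
      have "a powr (1 - P) = a / a powr P" using a by (simp add: powr_diff)
      then show ?thesis unfolding powr_divide by (simp only: times_divide_eq_right times_divide_eq_left divide_divide_eq_left mult.commute)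
    qed
    moreover have "a * (K y / a) = K y" using a by simp
    ultimately show ?thesis by (simp only: distrib_left)
  qed
  have nn: "0 \<le> 1 - 1 / P" using P by (simp add: field_simps)
  have "ennreal w \<le> (\<integral>\<^sup>+ y. ennreal (K y) * G y \<partial>M)" by (rule w)
  also have "\<dots> \<le> (\<integral>\<^sup>+ y. ennreal (a powr (1 - P) / P) * (ennreal (K y powr P) * G y) + ennreal (a * (1 - 1 / P)) * G y \<partial>M)"
  proof (rule nn_integral_mono)
    fix y
    have "ennreal (K y) \<le> ennreal (a powr (1 - P) / P) * ennreal (K y powr P) + ennreal (a * (1 - 1 / P))"
      using young[of y] a P nn by (simp add: ennreal_mult'[symmetric] ennreal_plus[symmetric] ennreal_leI del: ennreal_plus)
    then have "ennreal (K y) * G y \<le> (ennreal (a powr (1 - P) / P) * ennreal (K y powr P) + ennreal (a * (1 - 1 / P))) * G y"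
      by (rule mult_right_mono) simp
    then show "ennreal (K y) * G y \<le> ennreal (a powr (1 - P) / P) * (ennreal (K y powr P) * G y) + ennreal (a * (1 - 1 / P)) * G y"
      by (simp add: distrib_right mult.assoc)
  qed
  also have "\<dots> = ennreal (a powr (1 - P) / P) * I + ennreal (a * (1 - 1 / P)) * (\<integral>\<^sup>+ y. G y \<partial>M)"
    unfolding I_def by (subst nn_integral_add) (auto simp: nn_integral_cmult)
  also have "\<dots> \<le> ennreal (a powr (1 - P) / P) * I + ennreal (a * (1 - 1 / P)) * ennreal q"
    by (intro add_left_mono mult_left_mono q) simp
  finally have main: "ennreal w \<le> ennreal (a powr (1 - P) / P) * I + ennreal (w * (1 - 1 / P))"
  proof -
    have "ennreal (a * (1 - 1 / P)) * ennreal q = ennreal (a * (1 - 1 / P) * q)"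
      using q by (intro ennreal_mult''[symmetric]) auto
    also have "a * (1 - 1 / P) * q = w * (1 - 1 / P)" using q by (simp add: a_def)
    finally show "ennreal w \<le> ennreal (a powr (1 - P) / P) * I + ennreal (a * (1 - 1 / P)) * ennreal q \<Longrightarrow> ?thesis"
      by simp
  qed
  show ?thesis
  proof (cases "I = \<infinity>")
    case True
    then show ?thesis using q by (simp add: I_def[symmetric] ennreal_mult_top)
  next
    case False
    then obtain i where i: "I = ennreal i" "i \<ge> 0" by (cases I) auto
    have "ennreal w \<le> ennreal (a powr (1 - P) / P * i + w * (1 - 1 / P))"
      using main i P nn w0 by (simp add: ennreal_mult'[symmetric] ennreal_plus[symmetric] del: ennreal_plus)
    then have "w \<le> a powr (1 - P) / P * i + w * (1 - 1 / P)"
      using i P nn w0 by (subst (asm) ennreal_le_iff) auto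
    then have "w / P \<le> a powr (1 - P) / P * i" by (simp add: algebra_simps)
    then have "w \<le> a powr (1 - P) * i" using P by (simp add: field_simps)
    then have "w powr (P - 1) * w \<le> w powr (P - 1) * (a powr (1 - P) * i)" by (rule mult_left_mono) simp
    moreover have "w powr (P - 1) * w = w powr P" using w0 by (simp add: powr_diff)
    moreover have "w powr (P - 1) * a powr (1 - P) = q powr (P - 1)"
      using w0 q by (simp add: a_def powr_divide powr_diff field_simps)
    ultimately have "w powr P \<le> q powr (P - 1) * i" by (simp add: mult.assoc[symmetric])
    then show ?thesis unfolding I_def[symmetric] i(1) by (simp add: ennreal_mult'[symmetric] ennreal_leI)
  qed
qed

definition ball_profile :: "real \<Rightarrow> real \<Rightarrow> 'a::euclidean_space \<Rightarrow> real" where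
  "ball_profile \<sigma> R z = (if norm z < R then (norm z / R) powr (- \<sigma>) else 0)"

lemma ball_profile_measurable [measurable (raw)]:
  assumes [measurable]: "f \<in> borel_measurable M"
  shows "(\<lambda>z. ball_profile \<sigma> R (f z :: 'a::euclidean_space)) \<in> borel_measurable M"
  unfolding ball_profile_def by measurable

lemma ball_profile_nonneg: "0 \<le> ball_profile \<sigma> R z"
  by (simp add: ball_profile_def)

text \<open>
  Layer-cake formula: \<open>(|z|/R) powr (-\<sigma>)\<close> is \<open>1\<close> plus the integral of \<open>\<sigma> l powr (\<sigma>-1)\<close> over the
  levels \<open>1 \<le> l \<le> R/|z|\<close>. Level \<open>l\<close> is reached on the ball of radius \<open>R/l\<close>, and the volumes
  of these balls are integrable against the levels because \<open>\<sigma> < N\<close>.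
\<close>
lemma nn_integral_ball_profile:
  fixes \<sigma> :: real
  assumes \<sigma>: "0 < \<sigma>" "\<sigma> < real DIM('a::euclidean_space)"
  obtains C where "C > 0" "\<And>R. R > 0 \<Longrightarrow> (\<integral>\<^sup>+ z. ennreal (ball_profile \<sigma> R (z :: 'a)) \<partial>lborel) \<le> ennreal (C * R ^ DIM('a))"
proof -
  define v where "v = unit_ball_vol (real DIM('a))"
  have v: "v > 0" by (simp add: v_def)
  define n where "n = real DIM('a)"
  show thesis
  proof (rule that[of "v * (1 + \<sigma> / (n - \<sigma>))"])
    show "v * (1 + \<sigma> / (n - \<sigma>)) > 0" using v \<sigma> by (auto simp: n_def intro!: mult_pos_pos add_pos_pos)
    fix R :: real assume R: "R > 0"
    have layer: "ennreal (ball_profile \<sigma> R z) \<le> indicator (cball 0 R) z +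
      (\<integral>\<^sup>+ l. ennreal (indicator {1..} l * \<sigma> * l powr (\<sigma> - 1)) * indicator (cball 0 (R / l)) z \<partial>lborel)" if z: "z \<noteq> 0" for z :: 'a
    proof (cases "norm z < R")
      case True
      define b where "b = R / norm z"
      have b: "b > 1" using True z by (simp add: b_def)
      have "(norm z / R) powr (- \<sigma>) = b powr \<sigma>"
        using z R by (simp add: b_def powr_divide powr_minus_divide)
      then have "ennreal (ball_profile \<sigma> R z) = ennreal (b powr \<sigma>)" using True by (simp add: ball_profile_def)
      also have "ennreal (b powr \<sigma>) = 1 + ennreal (b powr \<sigma> - 1 powr \<sigma>)"
      proof -
        have "1 \<le> b powr \<sigma>" using b \<sigma> by (intro ge_one_powr_ge_zero) auto
        then have "ennreal (1 + (b powr \<sigma> - 1)) = ennreal 1 + ennreal (b powr \<sigma> - 1)"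
          by (intro ennreal_plus) auto
        then show ?thesis by simp
      qed
      also have "ennreal (b powr \<sigma> - 1 powr \<sigma>) = (\<integral>\<^sup>+ l. ennreal (\<sigma> * l powr (\<sigma> - 1)) * indicator {1..b} l \<partial>lborel)"
        by (rule nn_integral_FTC_Icc[symmetric, where F = "\<lambda>l. l powr \<sigma>"])
          (use b \<sigma> in \<open>auto intro!: has_real_derivative_powr\<close>)
      also have "\<dots> \<le> (\<integral>\<^sup>+ l. ennreal (indicator {1..} l * \<sigma> * l powr (\<sigma> - 1)) * indicator (cball 0 (R / l)) z \<partial>lborel)"
        by (intro nn_integral_mono) (use z R in \<open>auto simp: b_def field_simps split: split_indicator\<close>)
      finally show ?thesis using True by (simp add: add_left_mono)
    qed (simp add: ball_profile_def)
    have vol: "(\<integral>\<^sup>+ z. indicator (cball 0 r) (z :: 'a) \<partial>lborel) = ennreal (v * r ^ DIM('a))" if "r \<ge> 0" for r :: real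
      using emeasure_cball[OF that, of "0 :: 'a"] by (simp add: v_def)
    have cb: "(\<lambda>(z :: 'a, l). indicator (cball 0 (R / l)) z :: ennreal) \<in> borel_measurable (lborel \<Otimes>\<^sub>M lborel)"
    proof -
      have "(\<lambda>(z :: 'a, l). indicator (cball 0 (R / l)) z :: ennreal) = (\<lambda>(z, l). if norm z \<le> R / l then 1 else 0)"
        by (auto simp: indicator_def fun_eq_iff)
      then show ?thesis by simp
    qed
    have "(\<integral>\<^sup>+ z. ennreal (ball_profile \<sigma> R (z :: 'a)) \<partial>lborel) \<le>
      (\<integral>\<^sup>+ z. indicator (cball 0 R) z + (\<integral>\<^sup>+ l. ennreal (indicator {1..} l * \<sigma> * l powr (\<sigma> - 1)) * indicator (cball 0 (R / l)) (z :: 'a) \<partial>lborel) \<partial>lborel)"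
      by (rule nn_integral_mono_AE, rule eventually_mono[OF AE_lborel_singleton[of 0]]) (rule layer)
    also have "\<dots> = (\<integral>\<^sup>+ z. indicator (cball 0 R) (z :: 'a) \<partial>lborel) +
      (\<integral>\<^sup>+ z. (\<integral>\<^sup>+ l. ennreal (indicator {1..} l * \<sigma> * l powr (\<sigma> - 1)) * indicator (cball 0 (R / l)) (z :: 'a) \<partial>lborel) \<partial>lborel)"
    proof (rule nn_integral_add)
      have "(\<lambda>(z, l). ennreal (indicator {1..} l * \<sigma> * l powr (\<sigma> - 1)) * indicator (cball 0 (R / l)) (z :: 'a)) \<in> borel_measurable (lborel \<Otimes>\<^sub>M lborel)"
        using cb by (simp add: case_prod_unfold)
      then show "(\<lambda>z. \<integral>\<^sup>+ l. ennreal (indicator {1..} l * \<sigma> * l powr (\<sigma> - 1)) * indicator (cball 0 (R / l)) (z :: 'a) \<partial>lborel) \<in> borel_measurable lborel"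
        by (rule lborel.borel_measurable_nn_integral)
    qed (simp add: borel_measurable_indicator)
    also have "(\<integral>\<^sup>+ z. (\<integral>\<^sup>+ l. ennreal (indicator {1..} l * \<sigma> * l powr (\<sigma> - 1)) * indicator (cball 0 (R / l)) (z :: 'a) \<partial>lborel) \<partial>lborel) =
      (\<integral>\<^sup>+ l. (\<integral>\<^sup>+ z. ennreal (indicator {1..} l * \<sigma> * l powr (\<sigma> - 1)) * indicator (cball 0 (R / l)) (z :: 'a) \<partial>lborel) \<partial>lborel)"
      by (rule lborel_pair.Fubini'[symmetric]) (use cb in \<open>simp add: case_prod_unfold\<close>)
    also have "\<dots> = (\<integral>\<^sup>+ l. ennreal (\<sigma> * v * R ^ DIM('a)) * (ennreal (l powr (\<sigma> - 1 - n)) * indicator {1..} l) \<partial>lborel)"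
    proof (intro nn_integral_cong)
      fix l :: real
      show "(\<integral>\<^sup>+ z. ennreal (indicator {1..} l * \<sigma> * l powr (\<sigma> - 1)) * indicator (cball 0 (R / l)) (z :: 'a) \<partial>lborel) =
        ennreal (\<sigma> * v * R ^ DIM('a)) * (ennreal (l powr (\<sigma> - 1 - n)) * indicator {1..} l)"
      proof (cases "l \<ge> 1")
        case True
        have "l powr (\<sigma> - 1) * (v * (R / l) ^ DIM('a)) = v * R ^ DIM('a) * l powr (\<sigma> - 1 - n)"
          using True by (simp add: n_def powr_diff powr_realpow power_divide)
        then have "\<sigma> * l powr (\<sigma> - 1) * (v * (R / l) ^ DIM('a)) = \<sigma> * v * R ^ DIM('a) * l powr (\<sigma> - 1 - n)"
          by (simp only: mult.assoc)
        then show ?thesis using True R \<sigma> v vol[of "R / l"]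
          by (subst nn_integral_cmult) (auto simp: borel_measurable_indicator ennreal_mult'[symmetric] simp del: nn_integral_indicator)
      qed simp
    qed
    also have "\<dots> = ennreal (\<sigma> * v * R ^ DIM('a)) * ennreal (1 / (n - \<sigma>))"
    proof -
      have n: "n - \<sigma> > 0" using \<sigma> by (simp add: n_def)
      have "\<sigma> - 1 - n = - 1 - (n - \<sigma>)" by simp
      then have "(\<integral>\<^sup>+ l. ennreal (l powr (\<sigma> - 1 - n)) * indicator {1..} l \<partial>lborel) = ennreal (1 powr (- (n - \<sigma>)) / (n - \<sigma>))"
        by (simp only: nn_integral_powr_tail[OF n zero_less_one])
      then show ?thesis by (subst nn_integral_cmult) auto
    qed
    also have "(\<integral>\<^sup>+ z. indicator (cball 0 R) (z :: 'a) \<partial>lborel) = ennreal (v * R ^ DIM('a))" using R by (intro vol) auto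
    also have "ennreal (v * R ^ DIM('a)) + ennreal (\<sigma> * v * R ^ DIM('a)) * ennreal (1 / (n - \<sigma>)) = ennreal (v * (1 + \<sigma> / (n - \<sigma>)) * R ^ DIM('a))"
    proof -
      have "n - \<sigma> > 0" using \<sigma> by (simp add: n_def)
      then have "ennreal (v * R ^ DIM('a)) + ennreal (\<sigma> * v * R ^ DIM('a)) * ennreal (1 / (n - \<sigma>)) =
        ennreal (v * R ^ DIM('a) + \<sigma> * v * R ^ DIM('a) * (1 / (n - \<sigma>)))"
        using R v \<sigma> by (simp add: ennreal_mult'[symmetric] ennreal_plus[symmetric] del: ennreal_plus)
      also have "v * R ^ DIM('a) + \<sigma> * v * R ^ DIM('a) * (1 / (n - \<sigma>)) = v * (1 + \<sigma> / (n - \<sigma>)) * R ^ DIM('a)"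
        by (simp add: algebra_simps)
      finally show ?thesis .
    qed
    finally show "(\<integral>\<^sup>+ z. ennreal (ball_profile \<sigma> R (z :: 'a)) \<partial>lborel) \<le> ennreal (v * (1 + \<sigma> / (n - \<sigma>)) * R ^ DIM('a))" .
  qed
qed

lemma enn2real_inverse_exponent:
  assumes "1 \<le> p" "p \<noteq> (\<infinity> :: ennreal)"
  shows "enn2real (1 / p) = 1 / enn2real p" "1 \<le> enn2real p"
proof -
  obtain P where P: "p = ennreal P" "P \<ge> 0" using assms(2) by (cases p) auto
  have "ennreal 1 \<le> ennreal P" using assms(1) P by simp
  then have P1: "P \<ge> 1" using P(2) by (simp only: ennreal_le_iff)
  have "1 / p = ennreal (1 / P)" using divide_ennreal[of 1 P] P P1 by simp
  then show "enn2real (1 / p) = 1 / enn2real p" "1 \<le> enn2real p" using P P1 by simp_all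
qed

lemma Lp_norm_le_of_nn_integral:
  assumes "p \<noteq> \<infinity>" "1 \<le> p" "0 \<le> B"
    and "(\<integral>\<^sup>+ x. ennreal (\<bar>h x\<bar> powr enn2real p) \<partial>M) \<le> ennreal (B powr enn2real p)"
  shows "Lp_norm p M h \<le> ennreal B"
proof -
  define P where "P = enn2real p"
  have P: "P \<ge> 1" using enn2real_inverse_exponent[OF assms(2,1)] by (simp add: P_def)
  define I where "I = (\<integral>\<^sup>+ x. ennreal (\<bar>h x\<bar> powr P) \<partial>M)"
  have I: "I \<le> ennreal (B powr P)" using assms by (simp add: I_def P_def)
  then have fin: "I \<noteq> \<infinity>" by (auto simp: top_unique)
  have "enn2real I \<le> B powr P" using I by (simp add: enn2real_leI)
  then have "enn2real I powr (1 / P) \<le> (B powr P) powr (1 / P)" using P by (intro powr_mono2) auto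
  also have "\<dots> = B" using P assms by (simp add: powr_powr)
  finally show ?thesis using assms fin by (simp add: Lp_norm_def Let_def P_def[symmetric] I_def[symmetric] ennreal_leI)
qed

lemma Lp_norm_le_of_bound:
  fixes h :: "'a::euclidean_space \<Rightarrow> real"
  assumes A: "A \<in> sets lebesgue" "emeasure lebesgue A \<le> ennreal V" "V > 0" and p: "1 \<le> p"
    and m: "h \<in> borel_measurable (lebesgue_on A)"
    and B: "0 \<le> B" "\<And>x. x \<in> A \<Longrightarrow> \<bar>h x\<bar> \<le> B"
  shows "Lp_norm p (lebesgue_on A) h \<le> ennreal (B * V powr enn2real (1 / p))"
proof (cases "p = \<infinity>")
  case True
  have "esssup (lebesgue_on A) (\<lambda>x. ennreal \<bar>h x\<bar>) \<le> ennreal B"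
    using m by (intro esssup_I) (auto intro!: AE_I2 ennreal_leI B(2) simp: space_restrict_space)
  then show ?thesis using True A by (simp add: Lp_norm_def)
next
  case False
  define P where "P = enn2real p"
  have P: "P \<ge> 1" "enn2real (1 / p) = 1 / P" using enn2real_inverse_exponent[OF p False] by (auto simp: P_def)
  show ?thesis
  proof (rule Lp_norm_le_of_nn_integral[OF False p])
    have "(\<integral>\<^sup>+ x. ennreal (\<bar>h x\<bar> powr P) \<partial>lebesgue_on A) \<le> (\<integral>\<^sup>+ x. ennreal (B powr P) \<partial>lebesgue_on A)"
      using B P by (intro nn_integral_mono) (auto simp: space_restrict_space intro!: ennreal_leI powr_mono2)
    also have "\<dots> = ennreal (B powr P) * emeasure lebesgue A"
      using A by (simp add: emeasure_restrict_space space_restrict_space)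
    also have "\<dots> \<le> ennreal (B powr P) * ennreal V" by (intro mult_left_mono A) auto
    also have "\<dots> = ennreal ((B * V powr (1 / P)) powr P)"
    proof -
      have "(V powr (1 / P)) powr P = V" using A(3) P by (simp add: powr_powr)
      then have "(B * V powr (1 / P)) powr P = B powr P * V" by (simp only: powr_mult)
      then show ?thesis by (simp only: ennreal_mult' powr_ge_zero)
    qed
    finally show "(\<integral>\<^sup>+ x. ennreal (\<bar>h x\<bar> powr enn2real p) \<partial>lebesgue_on A) \<le> ennreal ((B * V powr enn2real (1 / p)) powr enn2real p)"
      by (simp add: P_def[symmetric] P(2))
  qed (use B in simp)
qed

lemma Lp_norm_ge_of_bound:
  fixes h :: "'a::euclidean_space \<Rightarrow> real"
  assumes A: "A \<in> sets lebesgue" "ennreal V \<le> emeasure lebesgue A" "V > 0" and p: "1 \<le> p"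
    and B: "0 \<le> B" "\<And>x. x \<in> A \<Longrightarrow> B \<le> \<bar>h x\<bar>"
  shows "ennreal (B * V powr enn2real (1 / p)) \<le> Lp_norm p (lebesgue_on A) h"
proof (cases "p = \<infinity>")
  case True
  have "ennreal B \<le> esssup (lebesgue_on A) (\<lambda>x. ennreal \<bar>h x\<bar>)"
  proof (rule ccontr)
    assume "\<not> ?thesis"
    then have *: "esssup (lebesgue_on A) (\<lambda>x. ennreal \<bar>h x\<bar>) < ennreal B" by (simp only: not_le)
    have "AE x in lebesgue_on A. ennreal \<bar>h x\<bar> \<le> esssup (lebesgue_on A) (\<lambda>x. ennreal \<bar>h x\<bar>)" by (rule esssup_AE)
    then have "AE x in lebesgue_on A. False"
      using AE_space
    proof eventually_elim
      case (elim x)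
      then have "ennreal B \<le> esssup (lebesgue_on A) (\<lambda>x. ennreal \<bar>h x\<bar>)"
      proof -
        have "ennreal B \<le> ennreal \<bar>h x\<bar>" using B(2)[of x] elim by (simp add: space_restrict_space ennreal_leI)
        then show ?thesis using elim(1) by (rule order_trans)
      qed
      then show False using * by (simp add: leD)
    qed
    then have "emeasure lebesgue A = 0"
      using A unfolding eventually_False ae_filter_eq_bot_iff
      by (simp add: emeasure_restrict_space space_restrict_space)
    then show False using A by simp
  qed
  then show ?thesis using True A by (simp add: Lp_norm_def)
next
  case False
  define P where "P = enn2real p"
  have P: "P \<ge> 1" "enn2real (1 / p) = 1 / P" using enn2real_inverse_exponent[OF p False] by (auto simp: P_def)
  define I where "I = (\<integral>\<^sup>+ x. ennreal (\<bar>h x\<bar> powr P) \<partial>lebesgue_on A)"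
  have "ennreal (B powr P * V) = ennreal (B powr P) * ennreal V" by (simp add: ennreal_mult')
  also have "\<dots> \<le> ennreal (B powr P) * emeasure lebesgue A" by (intro mult_left_mono A) auto
  also have "\<dots> = (\<integral>\<^sup>+ x. ennreal (B powr P) \<partial>lebesgue_on A)"
    using A by (simp add: emeasure_restrict_space space_restrict_space)
  also have "\<dots> \<le> I"
    unfolding I_def using B P by (intro nn_integral_mono) (auto simp: space_restrict_space intro!: ennreal_leI powr_mono2)
  finally have I: "ennreal (B powr P * V) \<le> I" .
  show ?thesis
  proof (cases "I = \<infinity>")
    case True
    then show ?thesis using False by (simp add: Lp_norm_def Let_def P_def[symmetric] I_def[symmetric])
  next
    case fin: False
    then have "B powr P * V \<le> enn2real I" using I by (cases I) auto
    then have "(B powr P * V) powr (1 / P) \<le> enn2real I powr (1 / P)" using P A by (intro powr_mono2) auto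
    then have "B * V powr (1 / P) \<le> enn2real I powr (1 / P)"
    proof -
      have "(B powr P) powr (1 / P) = B" using P B(1) by (simp add: powr_powr)
      then have "(B powr P * V) powr (1 / P) = B * V powr (1 / P)" by (simp only: powr_mult)
      then show "(B powr P * V) powr (1 / P) \<le> enn2real I powr (1 / P) \<Longrightarrow> ?thesis" by (simp only:)
    qed
    then show ?thesis using False fin
      by (simp add: Lp_norm_def Let_def P_def[symmetric] I_def[symmetric] P(2) ennreal_leI)
  qed
qed

lemma annulus_sets: "annulus \<nu> \<mu> r \<in> sets borel"
  unfolding annulus_def by measurable

lemma emeasure_annulus:
  fixes \<nu> \<mu> r :: real
  assumes "0 < \<nu>" "\<nu> < \<mu>" "r > 0"
  shows "emeasure lebesgue (annulus \<nu> \<mu> r :: 'a::euclidean_space set) \<le> ennreal (unit_ball_vol (real DIM('a)) * \<mu> ^ DIM('a) * r ^ DIM('a))"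
    and "ennreal (unit_ball_vol (real DIM('a)) * (\<mu> ^ DIM('a) - \<nu> ^ DIM('a)) * r ^ DIM('a)) \<le> emeasure lebesgue (annulus \<nu> \<mu> r :: 'a::euclidean_space set)"
proof -
  have eq: "annulus \<nu> \<mu> r = cball 0 (\<mu> * r) - ball (0 :: 'a) (\<nu> * r)"
    using assms by (auto simp: annulus_def field_simps)
  have sub: "ball (0 :: 'a) (\<nu> * r) \<subseteq> cball 0 (\<mu> * r)"
  proof -
    have "\<nu> * r \<le> \<mu> * r" using assms by (intro mult_right_mono) auto
    then show ?thesis by (meson ball_subset_cball order_trans subset_cball)
  qed
  have e: "emeasure lebesgue (annulus \<nu> \<mu> r :: 'a set) = emeasure lborel (annulus \<nu> \<mu> r :: 'a set)"
    by (simp add: annulus_sets)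
  have "emeasure lborel (annulus \<nu> \<mu> r :: 'a set) \<le> emeasure lborel (cball (0 :: 'a) (\<mu> * r))"
    unfolding eq by (intro emeasure_mono) auto
  then show "emeasure lebesgue (annulus \<nu> \<mu> r :: 'a set) \<le> ennreal (unit_ball_vol (real DIM('a)) * \<mu> ^ DIM('a) * r ^ DIM('a))"
    using assms by (simp add: e emeasure_cball power_mult_distrib mult.assoc)
  have "emeasure lborel (annulus \<nu> \<mu> r :: 'a set) = emeasure lborel (cball (0 :: 'a) (\<mu> * r)) - emeasure lborel (ball (0 :: 'a) (\<nu> * r))"
    unfolding eq using assms by (intro emeasure_Diff sub) (auto simp: emeasure_ball)
  also have "\<dots> = ennreal (unit_ball_vol (real DIM('a)) * (\<mu> * r) ^ DIM('a) - unit_ball_vol (real DIM('a)) * (\<nu> * r) ^ DIM('a))"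
    using assms by (simp add: emeasure_ball emeasure_cball ennreal_minus)
  finally show "ennreal (unit_ball_vol (real DIM('a)) * (\<mu> ^ DIM('a) - \<nu> ^ DIM('a)) * r ^ DIM('a)) \<le> emeasure lebesgue (annulus \<nu> \<mu> r :: 'a set)"
    by (simp add: e power_mult_distrib algebra_simps)
qed

section \<open>The solution as an iterated integral\<close>

lemma AE_lborel_reflect:
  fixes x :: "'a::euclidean_space"
  assumes "AE z in lborel. P z"
  shows "AE y in lborel. P (x - y)"
proof -
  obtain N where N: "{z \<in> space lborel. \<not> P z} \<subseteq> N" "emeasure lborel N = 0" "N \<in> sets lborel"
    using AE_E[OF assms] by blast
  define T where "T = (\<lambda>y :: 'a. x + (-1) *\<^sub>R y)"
  have Tm: "T \<in> measurable borel borel" unfolding T_def by measurable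
  have "lborel = density (distr lborel borel T) (\<lambda>_. ennreal (\<bar>-1\<bar> ^ DIM('a)))"
    unfolding T_def by (rule lborel_affine) simp
  then have "distr lborel borel T = lborel" by (simp add: density_1)
  then have "emeasure lborel (T -` N) = 0"
    using N(2,3) Tm emeasure_distr[of T lborel borel N] by simp
  moreover have "T -` N \<in> sets lborel" using measurable_sets[OF Tm, of N] N(3) by simp
  ultimately have "AE y in lborel. y \<notin> T -` N" by (intro AE_not_in) auto
  then show ?thesis
    by eventually_elim (use N(1) in \<open>auto simp: T_def\<close>)
qed

lemma integral_lebesgue_eq_lborel_AE:
  fixes f g :: "'a::euclidean_space \<Rightarrow> real"
  assumes g: "g \<in> borel_measurable borel" and ae: "AE x in lborel. f x = g x"
  shows "(LINT x|lebesgue. f x) = (LINT x|lborel. g x)"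
proof -
  have gm: "g \<in> borel_measurable lebesgue" using g by (intro measurable_completion) simp
  have ae': "AE x in lebesgue. g x = f x" using ae by (intro AE_completion) (auto elim: eventually_mono)
  have fm: "f \<in> borel_measurable lebesgue" by (rule borel_measurable_AE[OF gm ae'])
  have "(LINT x|lebesgue. f x) = (LINT x|lebesgue. g x)"
    by (rule integral_cong_AE[OF fm gm]) (use ae' in \<open>auto elim: eventually_mono\<close>)
  also have "\<dots> = (LINT x|lborel. g x)" using g by (intro integral_completion) simp
  finally show ?thesis .
qed

lemma abs_integral_le_nn_integral:
  fixes h :: "'b \<Rightarrow> real"
  shows "ennreal \<bar>LINT x|M. h x\<bar> \<le> (\<integral>\<^sup>+ x. ennreal \<bar>h x\<bar> \<partial>M)"
proof (cases "integrable M h")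
  case True
  then show ?thesis using integral_norm_bound_ennreal[OF True] by simp
next
  case False
  then show ?thesis by (simp add: not_integrable_integral_eq)
qed

text \<open>
  The mild solution for a kernel and a source that will be jointly Borel measurable, as Fubini's
  theorem requires. In its definition the kernel is chosen for each time separately.
\<close>
definition duhamel :: "(real \<Rightarrow> 'a::euclidean_space \<Rightarrow> real) \<Rightarrow> ('a \<Rightarrow> real \<Rightarrow> real) \<Rightarrow> 'a \<Rightarrow> real \<Rightarrow> real" where
  "duhamel Y F x t = (LINT s|lborel. indicator {0<..<t} s * (LINT y|lborel. Y (t - s) (x - y) * F y s))"

lemma duhamel_measurable:
  fixes Y :: "real \<Rightarrow> 'a::euclidean_space \<Rightarrow> real"
  assumes [measurable]: "case_prod Y \<in> borel_measurable (borel \<Otimes>\<^sub>M borel)" "case_prod F \<in> borel_measurable (borel \<Otimes>\<^sub>M borel)"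
  shows "(\<lambda>x. duhamel Y F x t) \<in> borel_measurable borel"
  unfolding duhamel_def by measurable

text \<open>
  Changing kernel and source on null sets changes the inner integral for almost no \<open>s\<close>, whatever
  \<open>x\<close> is. The identity therefore holds for every \<open>x\<close>.
\<close>
lemma mild_solution_eq_duhamel:
  fixes f :: "'a::euclidean_space \<Rightarrow> real \<Rightarrow> real"
  assumes Ym[measurable]: "case_prod Y \<in> borel_measurable (borel \<Otimes>\<^sub>M borel)"
    and Fm[measurable]: "case_prod F \<in> borel_measurable (borel \<Otimes>\<^sub>M borel)"
    and Yk: "\<And>t. t > 0 \<Longrightarrow> AE x in lborel. kernel_Y \<alpha> \<beta> t x = Y t x"
    and fF: "AE s in lborel. 0 \<le> s \<longrightarrow> (AE y in lborel. f y s = F y s)"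
  shows "mild_solution \<alpha> \<beta> f x t = duhamel Y F x t"
proof -
  have "mild_solution \<alpha> \<beta> f x t =
    (LINT s|lebesgue. indicator {0<..<t} s * (LINT y|lebesgue. kernel_Y \<alpha> \<beta> (t - s) (x - y) * f y s))"
    by (simp add: mild_solution_def set_lebesgue_integral_def)
  also have "\<dots> = duhamel Y F x t"
    unfolding duhamel_def
  proof (rule integral_lebesgue_eq_lborel_AE)
    show "AE s in lborel. indicator {0<..<t} s * (LINT y|lebesgue. kernel_Y \<alpha> \<beta> (t - s) (x - y) * f y s) =
      indicator {0<..<t} s * (LINT y|lborel. Y (t - s) (x - y) * F y s)"
      using fF
    proof eventually_elim
      case (elim s)
      show ?case
      proof (cases "s \<in> {0<..<t}")
        case True
        then have F: "AE y in lborel. f y s = F y s" and Y: "AE y in lborel. kernel_Y \<alpha> \<beta> (t - s) (x - y) = Y (t - s) (x - y)"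
          using elim AE_lborel_reflect[OF Yk[of "t - s"], of x] by auto
        have "(LINT y|lebesgue. kernel_Y \<alpha> \<beta> (t - s) (x - y) * f y s) = (LINT y|lborel. Y (t - s) (x - y) * F y s)"
        proof (rule integral_lebesgue_eq_lborel_AE)
          show "AE y in lborel. kernel_Y \<alpha> \<beta> (t - s) (x - y) * f y s = Y (t - s) (x - y) * F y s"
            using F Y by eventually_elim simp
        qed measurable
        then show ?thesis by simp
      qed simp
    qed
  qed measurable
  finally show ?thesis .
qed

lemma ex_borel_source:
  fixes f :: "'a::euclidean_space \<Rightarrow> real \<Rightarrow> real"
  assumes f: "(\<lambda>(x, t). f x t) \<in> borel_measurable (lebesgue_on (UNIV \<times> {0..}))"
  obtains F where "case_prod F \<in> borel_measurable (borel \<Otimes>\<^sub>M borel)"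
    "AE s in lborel. 0 \<le> s \<longrightarrow> (AE y in lborel. f y s = F y s)"
proof -
  let ?S = "(UNIV :: 'a set) \<times> {0::real..}"
  have "?S \<in> sets borel" by (intro borel_closed closed_Times) auto
  then have S: "?S \<in> sets lebesgue" by simp
  have "(\<lambda>z. if z \<in> ?S then (\<lambda>(x, t). f x t) z else 0) \<in> borel_measurable lebesgue"
    using f S by (simp add: borel_measurable_if)
  then obtain g where g: "g \<in> borel_measurable lborel"
    and ae: "AE z in lborel. (if z \<in> ?S then (\<lambda>(x, t). f x t) z else 0) = g z"
    using completion_ex_borel_measurable_real by blast
  have gm: "case_prod (\<lambda>y s. g (y, s)) \<in> borel_measurable (borel \<Otimes>\<^sub>M borel)"
    using g by (simp add: borel_prod)
  have ae2: "AE z in (lborel :: 'a measure) \<Otimes>\<^sub>M (lborel :: real measure). (if z \<in> ?S then (\<lambda>(x, t). f x t) z else 0) = g z"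
    using ae unfolding lborel_prod .
  have ae3: "AE w in (lborel :: real measure) \<Otimes>\<^sub>M (lborel :: 'a measure).
      (\<lambda>z. (if z \<in> ?S then (\<lambda>(x, t). f x t) z else 0) = g z) (case w of (s, y) \<Rightarrow> (y, s))"
  proof -
    obtain N where N: "{z \<in> space (lborel \<Otimes>\<^sub>M lborel). \<not> (if z \<in> ?S then (\<lambda>(x, t). f x t) z else 0) = g z} \<subseteq> N"
      "emeasure (lborel \<Otimes>\<^sub>M lborel) N = 0" "N \<in> sets ((lborel :: 'a measure) \<Otimes>\<^sub>M (lborel :: real measure))"
      using AE_E[OF ae2] by blast
    have N': "(if z \<in> ?S then (\<lambda>(x, t). f x t) z else 0) = g z" if "z \<notin> N" for z
    proof (rule ccontr)
      assume "\<not> ?thesis"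
      moreover have "z \<in> space (lborel \<Otimes>\<^sub>M lborel)" by (simp add: space_pair_measure)
      ultimately have "z \<in> N" using N(1) by blast
      then show False using that by simp
    qed
    let ?sw = "\<lambda>(s :: real, y :: 'a). (y, s)"
    have sw: "?sw \<in> measurable (lborel \<Otimes>\<^sub>M lborel) (lborel \<Otimes>\<^sub>M lborel)" by measurable
    have "(lborel :: 'a measure) \<Otimes>\<^sub>M (lborel :: real measure) = distr (lborel \<Otimes>\<^sub>M lborel) (lborel \<Otimes>\<^sub>M lborel) ?sw"
      by (rule lborel_pair.distr_pair_swap)
    then have "emeasure (lborel \<Otimes>\<^sub>M lborel) N = emeasure (distr (lborel \<Otimes>\<^sub>M lborel) (lborel \<Otimes>\<^sub>M lborel) ?sw) N"
      by (rule arg_cong[where f = "\<lambda>M. emeasure M N"])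
    then have "emeasure (lborel \<Otimes>\<^sub>M lborel) (?sw -` N \<inter> space (lborel \<Otimes>\<^sub>M lborel)) = 0"
      using N sw by (simp add: emeasure_distr)
    moreover have "?sw -` N \<inter> space (lborel \<Otimes>\<^sub>M lborel) \<in> sets ((lborel :: real measure) \<Otimes>\<^sub>M (lborel :: 'a measure))"
      by (rule measurable_sets[OF sw N(3)])
    ultimately have "AE w in lborel \<Otimes>\<^sub>M lborel. w \<notin> ?sw -` N \<inter> space (lborel \<Otimes>\<^sub>M lborel)" by (intro AE_not_in) auto
    then show ?thesis
    proof eventually_elim
      case (elim w)
      then have "(snd w, fst w) \<notin> N" by (auto simp: case_prod_unfold space_pair_measure)
      from N'[OF this] show ?case by (cases w) (simp split: if_splits)
    qed
  qed
  have "AE s in lborel. AE y in lborel. (if 0 \<le> s then f y s else 0) = g (y, s)"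
    using lborel_pair.AE_pair[OF ae3] by (simp cong: if_cong)
  then have "AE s in lborel. 0 \<le> s \<longrightarrow> (AE y in lborel. f y s = g (y, s))"
    by eventually_elim auto
  then show ?thesis using that[of "\<lambda>y s. g (y, s)"] gm by blast
qed

text \<open>
  A Bochner integral is bounded by the integral of the absolute value also when it does not exist,
  since its value is then \<open>0\<close>. Upper estimates thus do not ask for integrability.
\<close>
lemma duhamel_le_convolution:
  fixes Y :: "real \<Rightarrow> 'a::euclidean_space \<Rightarrow> real"
  assumes Ym[measurable]: "case_prod Y \<in> borel_measurable (borel \<Otimes>\<^sub>M borel)"
    and Fm[measurable]: "case_prod F \<in> borel_measurable (borel \<Otimes>\<^sub>M borel)"
    and km[measurable]: "k \<in> borel_measurable borel" and Km[measurable]: "K \<in> borel_measurable borel"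
    and nn: "\<And>\<tau> z. 0 \<le> Y \<tau> z" "\<And>\<tau>. 0 \<le> k \<tau>" "\<And>z. 0 \<le> K z"
    and Y: "\<And>\<tau> z. \<tau> > 0 \<Longrightarrow> z \<noteq> 0 \<Longrightarrow> Y \<tau> z \<le> k \<tau> * K z"
  shows "ennreal \<bar>duhamel Y F x t\<bar> \<le>
    (\<integral>\<^sup>+ s. ennreal (indicator {0<..<t} s * k (t - s)) * (\<integral>\<^sup>+ y. ennreal (K (x - y)) * ennreal \<bar>F y s\<bar> \<partial>lborel) \<partial>lborel)"
proof -
  have "ennreal \<bar>duhamel Y F x t\<bar> \<le> (\<integral>\<^sup>+ s. ennreal \<bar>indicator {0<..<t} s * (LINT y|lborel. Y (t - s) (x - y) * F y s)\<bar> \<partial>lborel)"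
    unfolding duhamel_def by (rule abs_integral_le_nn_integral)
  also have "\<dots> \<le> (\<integral>\<^sup>+ s. ennreal (indicator {0<..<t} s * k (t - s)) * (\<integral>\<^sup>+ y. ennreal (K (x - y)) * ennreal \<bar>F y s\<bar> \<partial>lborel) \<partial>lborel)"
  proof (rule nn_integral_mono)
    fix s :: real
    show "ennreal \<bar>indicator {0<..<t} s * (LINT y|lborel. Y (t - s) (x - y) * F y s)\<bar> \<le>
      ennreal (indicator {0<..<t} s * k (t - s)) * (\<integral>\<^sup>+ y. ennreal (K (x - y)) * ennreal \<bar>F y s\<bar> \<partial>lborel)"
    proof (cases "s \<in> {0<..<t}")
      case s: True
      have "ennreal \<bar>LINT y|lborel. Y (t - s) (x - y) * F y s\<bar> \<le> (\<integral>\<^sup>+ y. ennreal \<bar>Y (t - s) (x - y) * F y s\<bar> \<partial>lborel)"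
        by (rule abs_integral_le_nn_integral)
      also have "\<dots> \<le> (\<integral>\<^sup>+ y. ennreal (k (t - s)) * (ennreal (K (x - y)) * ennreal \<bar>F y s\<bar>) \<partial>lborel)"
      proof (rule nn_integral_mono_AE, rule eventually_mono[OF AE_lborel_singleton[of x]])
        fix y :: 'a assume "y \<noteq> x"
        then have "\<bar>Y (t - s) (x - y) * F y s\<bar> \<le> (k (t - s) * K (x - y)) * \<bar>F y s\<bar>"
          using Y[of "t - s" "x - y"] s nn by (auto simp: abs_mult intro!: mult_right_mono)
        then show "ennreal \<bar>Y (t - s) (x - y) * F y s\<bar> \<le> ennreal (k (t - s)) * (ennreal (K (x - y)) * ennreal \<bar>F y s\<bar>)"
          using nn by (simp add: ennreal_mult'[symmetric] mult.assoc ennreal_leI)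
      qed
      also have "\<dots> = ennreal (k (t - s)) * (\<integral>\<^sup>+ y. ennreal (K (x - y)) * ennreal \<bar>F y s\<bar> \<partial>lborel)"
        by (rule nn_integral_cmult) measurable
      finally show ?thesis using s by simp
    qed simp
  qed
  finally show ?thesis .
qed

text \<open>
  On the scale \<open>R\<close> the bound with exponent \<open>\<eta>\<close> is
  \<open>(|z|/R) powr (4\<beta>\<eta>-N)\<close> times a factor free of \<open>z\<close>. For \<open>\<theta> \<le> \<eta> \<le> 1\<close> this
  power is at most \<open>1\<close> outside the ball of radius \<open>R\<close> and at most the power with exponent \<open>\<theta>\<close> inside. One
  profile therefore serves for \<open>\<eta> = \<theta>\<close> and \<open>\<eta> = 1\<close>.
\<close>
lemma kernel_le_memory:
  fixes Y :: "real \<Rightarrow> 'a::euclidean_space \<Rightarrow> real"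
  assumes \<alpha>: "0 < \<alpha>" and \<beta>: "0 < \<beta>" and N: "real DIM('a) > 4 * \<beta>" and \<theta>: "0 < \<theta>" "\<theta> \<le> 1"
    and Y: "\<And>\<theta>. 0 < \<theta> \<Longrightarrow> \<theta> \<le> 1 \<Longrightarrow> \<exists>C>0. \<forall>t>0. \<forall>x. x \<noteq> 0 \<longrightarrow>
       Y t x \<le> C * t powr (\<alpha> - 1 - 2 * \<alpha> * \<theta>) * norm x powr (4 * \<beta> * \<theta> - real DIM('a))"
  obtains C where "C > 0" "\<And>R \<tau> z. R > 0 \<Longrightarrow> \<tau> > 0 \<Longrightarrow> z \<noteq> 0 \<Longrightarrow>
    Y \<tau> z \<le> memory \<alpha> \<theta> (R powr (2 * \<beta> / \<alpha>)) \<tau> * (C * R powr (- real DIM('a)) * (1 + ball_profile (real DIM('a) - 4 * \<beta> * \<theta>) R z))"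
proof -
  define n where "n = real DIM('a)"
  obtain C1 where C1: "C1 > 0" "\<And>t x. t > 0 \<Longrightarrow> x \<noteq> 0 \<Longrightarrow> Y t x \<le> C1 * t powr (\<alpha> - 1 - 2 * \<alpha> * \<theta>) * norm x powr (4 * \<beta> * \<theta> - n)"
    using Y[OF \<theta>] unfolding n_def by blast
  obtain C2 where C2: "C2 > 0" "\<And>t x. t > 0 \<Longrightarrow> x \<noteq> 0 \<Longrightarrow> Y t x \<le> C2 * t powr (\<alpha> - 1 - 2 * \<alpha> * 1) * norm x powr (4 * \<beta> * 1 - n)"
    using Y[of 1] unfolding n_def by auto
  have prof: "norm z powr (4 * \<beta> * \<eta> - n) \<le> R powr (4 * \<beta> * \<eta>) * R powr (- n) * (1 + ball_profile (n - 4 * \<beta> * \<theta>) R z)"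
    if R: "R > 0" and z: "z \<noteq> 0" and \<eta>: "\<theta> \<le> \<eta>" "\<eta> \<le> 1" for R \<eta> and z :: 'a
  proof -
    define b where "b = norm z / R"
    have b: "b > 0" using R z by (simp add: b_def)
    have neg: "4 * \<beta> * \<eta> - n < 0"
    proof -
      have "4 * \<beta> * \<eta> \<le> 4 * \<beta> * 1" using \<eta> \<beta> by (intro mult_left_mono) auto
      then show ?thesis using N by (simp add: n_def)
    qed
    have "b powr (4 * \<beta> * \<eta> - n) \<le> 1 + ball_profile (n - 4 * \<beta> * \<theta>) R z"
    proof (cases "norm z < R")
      case True
      then have "b \<le> 1" using R by (simp add: b_def)
      then have "b powr (4 * \<beta> * \<eta> - n) \<le> b powr (4 * \<beta> * \<theta> - n)"
        using b \<eta> \<beta> by (intro powr_mono') auto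
      then show ?thesis using True by (simp add: ball_profile_def b_def)
    next
      case False
      then have "b \<ge> 1" using R by (simp add: b_def)
      then have "b powr (4 * \<beta> * \<eta> - n) \<le> 1 powr (4 * \<beta> * \<eta> - n)"
        using neg by (intro powr_mono2') auto
      then show ?thesis using ball_profile_nonneg[of "n - 4 * \<beta> * \<theta>" R z] by simp
    qed
    moreover have "norm z powr (4 * \<beta> * \<eta> - n) = R powr (4 * \<beta> * \<eta>) * R powr (- n) * b powr (4 * \<beta> * \<eta> - n)"
    proof -
      have "norm z = R * b" using R by (simp add: b_def)
      then show ?thesis using R by (simp add: powr_mult powr_add[symmetric])
    qed
    ultimately show ?thesis by (simp add: mult_left_mono)
  qed
  define C where "C = max C1 C2"
  have C: "C > 0" "C1 \<le> C" "C2 \<le> C" using C1(1) by (auto simp: C_def)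
  show thesis
  proof (rule that[OF C(1)])
    fix R \<tau> :: real and z :: 'a assume R: "R > 0" and \<tau>: "\<tau> > 0" and z: "z \<noteq> 0"
    define T where "T = R powr (2 * \<beta> / \<alpha>)"
    have T: "T powr (2 * \<alpha> * \<eta>) = R powr (4 * \<beta> * \<eta>)" for \<eta>
      using \<alpha> by (simp add: T_def powr_powr mult.assoc)
    define X where "X = 1 + ball_profile (n - 4 * \<beta> * \<theta>) R z"
    have X: "X \<ge> 0" using ball_profile_nonneg[of "n - 4 * \<beta> * \<theta>" R z] by (simp add: X_def)
    have gen: "Y \<tau> z \<le> \<tau> powr (\<alpha> - 1 - 2 * \<alpha> * \<eta>) * T powr (2 * \<alpha> * \<eta>) * (C * R powr (- n) * X)"
      if le: "Y \<tau> z \<le> D * \<tau> powr (\<alpha> - 1 - 2 * \<alpha> * \<eta>) * norm z powr (4 * \<beta> * \<eta> - n)" and D: "0 \<le> D" "D \<le> C" and \<eta>: "\<theta> \<le> \<eta>" "\<eta> \<le> 1" for D \<eta>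
    proof -
      have "Y \<tau> z \<le> D * \<tau> powr (\<alpha> - 1 - 2 * \<alpha> * \<eta>) * (R powr (4 * \<beta> * \<eta>) * R powr (- n) * X)"
        using prof[OF R z \<eta>] D by (intro order_trans[OF le] mult_left_mono) (auto simp: X_def)
      also have "\<dots> \<le> C * \<tau> powr (\<alpha> - 1 - 2 * \<alpha> * \<eta>) * (R powr (4 * \<beta> * \<eta>) * R powr (- n) * X)"
        using D X by (intro mult_right_mono) auto
      finally show ?thesis unfolding T by (simp only: mult_ac)
    qed
    show "Y \<tau> z \<le> memory \<alpha> \<theta> (R powr (2 * \<beta> / \<alpha>)) \<tau> * (C * R powr (- real DIM('a)) * (1 + ball_profile (real DIM('a) - 4 * \<beta> * \<theta>) R z))"
    proof (cases "\<tau> < T")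
      case True
      then show ?thesis using gen[OF C1(2)[OF \<tau> z]] C1(1) C \<theta> by (simp add: memory_def T_def X_def n_def)
    next
      case False
      have "\<tau> powr (\<alpha> - 1 - 2 * \<alpha> * 1) = \<tau> powr (- 1 - \<alpha>)" by (rule arg_cong[of _ _ "(powr) \<tau>"]) simp
      then show ?thesis using False gen[OF C2(2)[OF \<tau> z]] C2(1) C \<theta> by (simp add: memory_def T_def X_def n_def)
    qed
  qed
qed

lemma Lp_norm_1: "Lp_norm 1 M h = (\<integral>\<^sup>+ x. ennreal \<bar>h x\<bar> \<partial>M)"
  by (simp add: Lp_norm_def Let_def ennreal_enn2real_if)

lemma rate_eq_decay: "rate N \<alpha> \<beta> \<gamma> p g t = g t powr (2 * \<beta> - N * (1 - enn2real (1 / p))) * decay \<alpha> \<gamma> t (g t powr (2 * \<beta>))"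
  by (simp add: rate_def decay_def)

lemma eventually_diffusive_scale_le:
  fixes g :: "real \<Rightarrow> real"
  assumes \<alpha>: "0 < \<alpha>" and \<beta>: "0 < \<beta>" and gpos: "\<And>t. t > 0 \<Longrightarrow> g t > 0"
    and g: "g \<in> o[at_top](\<lambda>t. t powr (\<alpha> / (2 * \<beta>)))" and b: "b > 0" and a: "a > 0"
  shows "\<forall>\<^sub>F t in at_top. (b * g t) powr (2 * \<beta> / \<alpha>) \<le> a * t"
proof -
  define e where "e = a powr (\<alpha> / (2 * \<beta>)) / b"
  have e: "e > 0" using a b by (simp add: e_def)
  have "\<forall>\<^sub>F t in at_top. norm (g t) \<le> e * norm (t powr (\<alpha> / (2 * \<beta>)))"
    by (rule landau_o.smallD[OF g e])
  with eventually_gt_at_top[of 0] show ?thesis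
  proof eventually_elim
    case (elim t)
    have "b * g t \<le> b * (e * t powr (\<alpha> / (2 * \<beta>)))" using elim b by (intro mult_left_mono) auto
    also have "\<dots> = (a * t) powr (\<alpha> / (2 * \<beta>))" using b by (simp add: e_def powr_mult)
    finally have "(b * g t) powr (2 * \<beta> / \<alpha>) \<le> ((a * t) powr (\<alpha> / (2 * \<beta>))) powr (2 * \<beta> / \<alpha>)"
      using b gpos[of t] elim \<alpha> \<beta> by (intro powr_mono2) auto
    also have "\<dots> = a * t" using a elim \<alpha> \<beta> by (simp add: powr_powr)
    finally show ?case .
  qed
qed

section \<open>Convolutions with an integrable density\<close>

text \<open>
  Young's inequality for a kernel in \<open>L\<^sup>p\<close> and a density in \<open>L\<^sup>1\<close>, localised to \<open>A\<close>: by Jensen's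
  inequality the \<open>p\<close>-th power of the convolution is at most \<open>q powr (p-1)\<close> times the convolution of the
  \<open>p\<close>-th power of the kernel with the density, and Tonelli's theorem gives the rest.
\<close>
lemma Lp_norm_convolution_le:
  fixes K :: "'a::euclidean_space \<Rightarrow> real" and G :: "'a \<Rightarrow> ennreal" and u :: "'a \<Rightarrow> real"
  assumes Km[measurable]: "K \<in> borel_measurable borel" and Gm[measurable]: "G \<in> borel_measurable borel"
    and um[measurable]: "u \<in> borel_measurable borel" and A[measurable]: "A \<in> sets borel"
    and K: "\<And>z. 0 \<le> K z" and q: "q > 0" "(\<integral>\<^sup>+ y. G y \<partial>lborel) \<le> ennreal q"
    and p: "1 \<le> p" "p \<noteq> \<infinity>" and B: "B \<ge> 0"
    and u: "\<And>x. x \<in> A \<Longrightarrow> ennreal \<bar>u x\<bar> \<le> (\<integral>\<^sup>+ y. ennreal (K (x - y)) * G y \<partial>lborel)"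
    and KB: "\<And>y. (\<integral>\<^sup>+ x. indicator A x * ennreal (K (x - y) powr enn2real p) \<partial>lborel) \<le> ennreal (B powr enn2real p)"
  shows "Lp_norm p (lebesgue_on A) u \<le> ennreal (q * B)"
proof (rule Lp_norm_le_of_nn_integral[OF p(2,1)])
  define P where "P = enn2real p"
  have P: "P \<ge> 1" using enn2real_inverse_exponent[OF p] by (simp add: P_def)
  have "(\<integral>\<^sup>+ x. ennreal (\<bar>u x\<bar> powr P) \<partial>lebesgue_on A) = (\<integral>\<^sup>+ x. ennreal (\<bar>u x\<bar> powr P) * indicator A x \<partial>lborel)"
    by (simp add: nn_integral_restrict_space nn_integral_completion)
  also have "\<dots> \<le> (\<integral>\<^sup>+ x. ennreal (q powr (P - 1)) * (indicator A x * (\<integral>\<^sup>+ y. ennreal (K (x - y) powr P) * G y \<partial>lborel)) \<partial>lborel)"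
  proof (rule nn_integral_mono)
    fix x :: 'a
    show "ennreal (\<bar>u x\<bar> powr P) * indicator A x \<le> ennreal (q powr (P - 1)) * (indicator A x * (\<integral>\<^sup>+ y. ennreal (K (x - y) powr P) * G y \<partial>lborel))"
    proof (cases "x \<in> A")
      case True
      have "ennreal (\<bar>u x\<bar> powr P) \<le> ennreal (q powr (P - 1)) * (\<integral>\<^sup>+ y. ennreal (K (x - y) powr P) * G y \<partial>lborel)"
        by (rule nn_integral_jensen_powr) (use K q P u[OF True] in auto)
      then show ?thesis using True by simp
    qed simp
  qed
  also have "\<dots> = ennreal (q powr (P - 1)) * (\<integral>\<^sup>+ x. indicator A x * (\<integral>\<^sup>+ y. ennreal (K (x - y) powr P) * G y \<partial>lborel) \<partial>lborel)"
    by (rule nn_integral_cmult) measurable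
  also have "(\<integral>\<^sup>+ x. indicator A x * (\<integral>\<^sup>+ y. ennreal (K (x - y) powr P) * G y \<partial>lborel) \<partial>lborel) =
    (\<integral>\<^sup>+ x. (\<integral>\<^sup>+ y. indicator A x * (ennreal (K (x - y) powr P) * G y) \<partial>lborel) \<partial>lborel)"
    by (intro nn_integral_cong nn_integral_cmult[symmetric]) measurable
  also have "\<dots> = (\<integral>\<^sup>+ y. (\<integral>\<^sup>+ x. indicator A x * (ennreal (K (x - y) powr P) * G y) \<partial>lborel) \<partial>lborel)"
    by (rule lborel_pair.Fubini'[symmetric]) measurable
  also have "\<dots> = (\<integral>\<^sup>+ y. G y * (\<integral>\<^sup>+ x. indicator A x * ennreal (K (x - y) powr P) \<partial>lborel) \<partial>lborel)"
    by (intro nn_integral_cong, subst nn_integral_cmult[symmetric]) (auto simp: mult_ac)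
  also have "\<dots> \<le> (\<integral>\<^sup>+ y. G y * ennreal (B powr P) \<partial>lborel)"
    using KB unfolding P_def by (intro nn_integral_mono mult_left_mono) auto
  also have "\<dots> = (\<integral>\<^sup>+ y. G y \<partial>lborel) * ennreal (B powr P)"
    by (rule nn_integral_multc) measurable
  also have "\<dots> \<le> ennreal q * ennreal (B powr P)" by (intro mult_right_mono q) auto
  also have "ennreal (q powr (P - 1)) * (ennreal q * ennreal (B powr P)) = ennreal ((q * B) powr P)"
  proof -
    have "q powr (P - 1) * q = q powr P" using q by (simp add: powr_diff)
    then have "(q * B) powr P = q powr (P - 1) * (q * B powr P)"
      by (simp add: powr_mult mult.assoc[symmetric])
    then show ?thesis using q by (simp add: ennreal_mult'[symmetric])
  qed
  finally show "(\<integral>\<^sup>+ x. ennreal (\<bar>u x\<bar> powr enn2real p) \<partial>lebesgue_on A) \<le> ennreal ((q * B) powr enn2real p)"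
    by (simp add: P_def mult_left_mono)
qed (use q B in simp)

lemma nn_integral_convolution_swap:
  fixes K :: "'a::euclidean_space \<Rightarrow> real" and F :: "'a \<Rightarrow> real \<Rightarrow> real"
  assumes [measurable]: "K \<in> borel_measurable borel" "case_prod F \<in> borel_measurable (borel \<Otimes>\<^sub>M borel)" "w \<in> borel_measurable borel"
  shows "(\<integral>\<^sup>+ s. ennreal (w s) * (\<integral>\<^sup>+ y. ennreal (K y) * ennreal \<bar>F y s\<bar> \<partial>lborel) \<partial>lborel) =
    (\<integral>\<^sup>+ y. ennreal (K y) * (\<integral>\<^sup>+ s. ennreal (w s) * ennreal \<bar>F y s\<bar> \<partial>lborel) \<partial>lborel)"
proof -
  have "(\<integral>\<^sup>+ s. ennreal (w s) * (\<integral>\<^sup>+ y. ennreal (K y) * ennreal \<bar>F y s\<bar> \<partial>lborel) \<partial>lborel) =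
    (\<integral>\<^sup>+ s. \<integral>\<^sup>+ y. ennreal (w s) * (ennreal (K y) * ennreal \<bar>F y s\<bar>) \<partial>lborel \<partial>lborel)"
    by (intro nn_integral_cong nn_integral_cmult[symmetric]) measurable
  also have "\<dots> = (\<integral>\<^sup>+ y. \<integral>\<^sup>+ s. ennreal (w s) * (ennreal (K y) * ennreal \<bar>F y s\<bar>) \<partial>lborel \<partial>lborel)"
    by (rule lborel_pair.Fubini'[symmetric]) measurable
  also have "\<dots> = (\<integral>\<^sup>+ y. ennreal (K y) * (\<integral>\<^sup>+ s. ennreal (w s) * ennreal \<bar>F y s\<bar> \<partial>lborel) \<partial>lborel)"
    by (intro nn_integral_cong, subst nn_integral_cmult[symmetric]) (auto simp: mult_ac)
  finally show ?thesis .
qed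

lemma nn_integral_lborel_shift:
  fixes h :: "'a::euclidean_space \<Rightarrow> ennreal"
  assumes [measurable]: "h \<in> borel_measurable borel"
  shows "(\<integral>\<^sup>+ x. h (x - y) \<partial>lborel) = (\<integral>\<^sup>+ z. h z \<partial>lborel)"
    and "(\<integral>\<^sup>+ x. h (y - x) \<partial>lborel) = (\<integral>\<^sup>+ z. h z \<partial>lborel)"
proof -
  have "(\<integral>\<^sup>+ z. h z \<partial>lborel) = (\<integral>\<^sup>+ z. h z \<partial>distr lborel borel ((+) (- y)))" by (simp add: lborel_distr_plus)
  then show "(\<integral>\<^sup>+ x. h (x - y) \<partial>lborel) = (\<integral>\<^sup>+ z. h z \<partial>lborel)" by (simp add: nn_integral_distr)
  have "lborel = density (distr lborel borel (\<lambda>x :: 'a. y + (-1) *\<^sub>R x)) (\<lambda>_. ennreal (\<bar>-1\<bar> ^ DIM('a)))"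
    by (rule lborel_affine) simp
  then have "distr lborel borel (\<lambda>x :: 'a. y + (-1) *\<^sub>R x) = lborel" by (simp add: density_1)
  then have "(\<integral>\<^sup>+ z. h z \<partial>lborel) = (\<integral>\<^sup>+ z. h z \<partial>distr lborel borel (\<lambda>x :: 'a. y + (-1) *\<^sub>R x))" by simp
  then show "(\<integral>\<^sup>+ x. h (y - x) \<partial>lborel) = (\<integral>\<^sup>+ z. h z \<partial>lborel)" by (simp add: nn_integral_distr)
qed

lemma ball_profile_powr: "ball_profile \<sigma> R z powr P = ball_profile (\<sigma> * P) R z"
  by (simp add: ball_profile_def powr_powr)

lemma one_plus_powr_le:
  fixes b P :: real
  assumes "b \<ge> 0" "P \<ge> 0"
  shows "(1 + b) powr P \<le> 2 powr P * (1 + b powr P)"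
proof -
  have "(1 + b) powr P \<le> (2 * max 1 b) powr P" using assms by (intro powr_mono2) auto
  also have "\<dots> = 2 powr P * max 1 b powr P" by (simp add: powr_mult)
  also have "max 1 b powr P \<le> 1 + b powr P" by (simp add: max_def)
  finally show ?thesis by (simp add: mult_left_mono)
qed

section \<open>The upper estimate\<close>

text \<open>
  With the separated majorant of the kernel the solution is at most the convolution of the profile
  \<open>K t\<close> with the density \<open>y \<mapsto> \<integral> k t s |F y s| ds\<close>, whose mass is of order \<open>\<Phi> t\<close>. Below the critical
  exponent this is Young's inequality. From the critical exponent on, the singular part of the profile only
  meets source points with \<open>|y| \<ge> R\<close>, where \<open>|F y s|\<close> is at most a multiple of
  \<open>R powr (-n) (1+s) powr (-\<gamma>)\<close>; since the profile has integral of order \<open>R\<^sup>n\<close>, the singular part contributes, up to a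
  constant, no more than the constant part, and the solution is bounded pointwise on the annulus.
\<close>
lemma mild_solution_upper_bound:
  fixes f :: "'a::euclidean_space \<Rightarrow> real \<Rightarrow> real" and p :: ennreal and g :: "real \<Rightarrow> real"
  assumes \<alpha>: "0 < \<alpha>" "\<alpha> < 1" and \<beta>: "0 < \<beta>" "\<beta> \<le> 1" and N: "real DIM('a) > 4 * \<beta>" and p: "1 \<le> p"
    and gpos: "\<And>t. t > 0 \<Longrightarrow> g t > 0" and gtop: "filterlim g at_top at_top"
    and go: "g \<in> o[at_top](\<lambda>t. t powr (\<alpha> / (2 * \<beta>)))"
    and f: "admissible_source \<beta> \<gamma> p f" and \<nu>: "0 < \<nu>" "\<nu> < \<mu>"
  shows "\<exists>C>0. \<exists>t\<^sub>0\<ge>2. \<forall>t\<ge>t\<^sub>0.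
            (\<lambda>x. mild_solution \<alpha> \<beta> f x t) \<in> borel_measurable (lebesgue_on (annulus \<nu> \<mu> (g t))) \<and>
            Lp_norm p (lebesgue_on (annulus \<nu> \<mu> (g t))) (\<lambda>x. mild_solution \<alpha> \<beta> f x t)
              \<le> ennreal (C * rate (real DIM('a)) \<alpha> \<beta> \<gamma> p g t)"
proof -
  define n where "n = real DIM('a)"
  obtain Y :: "real \<Rightarrow> 'a \<Rightarrow> real" where Ym0: "(\<lambda>(t, x). Y t x) \<in> borel_measurable borel"
    and Ynn: "\<And>t x. 0 \<le> Y t x"
    and Yk: "\<And>t. t > 0 \<Longrightarrow> AE x in lborel. kernel_Y \<alpha> \<beta> t x = Y t x"
    and Yup: "\<And>\<theta>. 0 < \<theta> \<Longrightarrow> \<theta> \<le> 1 \<Longrightarrow> \<exists>C>0. \<forall>t>0. \<forall>x. x \<noteq> 0 \<longrightarrow>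
       Y t x \<le> C * t powr (\<alpha> - 1 - 2 * \<alpha> * \<theta>) * norm x powr (4 * \<beta> * \<theta> - real DIM('a))"
    by (rule ex_fundamental_kernel[OF \<alpha> \<beta> N]) (assumption | blast)+
  have Ym[measurable]: "case_prod Y \<in> borel_measurable (borel \<Otimes>\<^sub>M borel)" using Ym0 by (simp add: borel_prod)
  obtain C0 where C0: "C0 > 0" and fL1: "\<And>t. t \<ge> 0 \<Longrightarrow> Lp_norm 1 lebesgue (\<lambda>x. f x t) \<le> ennreal (C0 / (1 + t) powr \<gamma>)"
    using f unfolding admissible_source_def by blast
  obtain F where Fm[measurable]: "case_prod F \<in> borel_measurable (borel \<Otimes>\<^sub>M borel)"
    and fF: "AE s in lborel. 0 \<le> s \<longrightarrow> (AE y in lborel. f y s = F y s)"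
    using ex_borel_source[of f] f unfolding admissible_source_def by blast
  have FL1: "AE s in lborel. 0 \<le> s \<longrightarrow> (\<integral>\<^sup>+ y. ennreal \<bar>F y s\<bar> \<partial>lborel) \<le> ennreal (C0 * (1 + s) powr (- \<gamma>))"
    using fF
  proof eventually_elim
    case (elim s)
    show ?case
    proof
      assume s: "0 \<le> s"
      have "(\<integral>\<^sup>+ y. ennreal \<bar>F y s\<bar> \<partial>lborel) = (\<integral>\<^sup>+ y. ennreal \<bar>f y s\<bar> \<partial>lborel)"
        using elim s by (intro nn_integral_cong_AE) (auto elim: eventually_mono)
      also have "\<dots> = Lp_norm 1 lebesgue (\<lambda>x. f x s)" by (simp add: Lp_norm_1 nn_integral_completion)
      also have "\<dots> \<le> ennreal (C0 * (1 + s) powr (- \<gamma>))"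
        using fL1[OF s] by (simp add: powr_minus divide_inverse)
      finally show "(\<integral>\<^sup>+ y. ennreal \<bar>F y s\<bar> \<partial>lborel) \<le> ennreal (C0 * (1 + s) powr (- \<gamma>))" .
    qed
  qed
  define u where "u t x = mild_solution \<alpha> \<beta> f x t" for t x
  have u: "u t x = duhamel Y F x t" for t x
    unfolding u_def by (rule mild_solution_eq_duhamel[OF Ym Fm Yk fF])
  have um[measurable]: "u t \<in> borel_measurable borel" for t
    unfolding u by (rule duhamel_measurable[OF Ym Fm])
  have um': "u t \<in> borel_measurable (lebesgue_on A)" for t A
    using um[of t] by (intro measurable_restrict_space1 measurable_completion) simp
  \<comment> \<open>\<open>\<theta> < 1/2\<close> keeps the memory kernel integrable at \<open>0\<close>. The profile lies in \<open>L\<^sup>p\<close> near \<open>0\<close> if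
    \<open>\<theta> > n (1 - 1/p) / (4\<beta>)\<close>. The two conditions are compatible exactly if \<open>p < p\<^sub>c\<close>.\<close>
  obtain \<theta> where \<theta>: "0 < \<theta>" "\<theta> < 1 / 2"
    and \<theta>p: "\<not> ennreal (p_crit n \<beta>) \<le> p \<Longrightarrow> p \<noteq> \<infinity> \<and> (n - 4 * \<beta> * \<theta>) * enn2real p < n"
  proof (cases "ennreal (p_crit n \<beta>) \<le> p")
    case True
    then show thesis by (intro that[of "1 / 4"]) auto
  next
    case False
    then have fin: "p \<noteq> \<infinity>" by auto
    define P where "P = enn2real p"
    have P: "P \<ge> 1" "p = ennreal P" using enn2real_inverse_exponent[OF p fin] fin by (auto simp: P_def ennreal_enn2real_if)
    have d: "n - 2 * \<beta> > 0" using N \<beta> by (simp add: n_def)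
    have "P < p_crit n \<beta>"
    proof (rule ccontr)
      assume "\<not> P < p_crit n \<beta>"
      then have "ennreal (p_crit n \<beta>) \<le> p" unfolding P(2) by (intro ennreal_leI) simp
      then show False using False by simp
    qed
    then have "P * (n - 2 * \<beta>) < n" using d by (simp add: p_crit_def field_simps)
    then have "n * (1 - 1 / P) / (4 * \<beta>) < 1 / 2" using P \<beta> by (simp add: field_simps)
    then have "max 0 (n * (1 - 1 / P) / (4 * \<beta>)) < 1 / 2" unfolding max_less_iff_conj by simp
    from dense[OF this] obtain \<theta> where \<theta>: "max 0 (n * (1 - 1 / P) / (4 * \<beta>)) < \<theta>" "\<theta> < 1 / 2"
      by blast
    then have "n * (1 - 1 / P) < 4 * \<beta> * \<theta>" using \<beta> by (simp add: field_simps)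
    then have "(n - 4 * \<beta> * \<theta>) < n / P" by (simp add: algebra_simps)
    then have "(n - 4 * \<beta> * \<theta>) * P < n" using P by (simp add: field_simps)
    then show thesis using that[of \<theta>] \<theta> fin by (simp add: P_def)
  qed
  define \<sigma> where "\<sigma> = n - 4 * \<beta> * \<theta>"
  have \<sigma>: "0 < \<sigma>" "\<sigma> < n"
  proof -
    have "4 * \<beta> * \<theta> < 4 * \<beta> * 1" using \<beta> \<theta> by (intro mult_strict_left_mono) auto
    then show "0 < \<sigma>" using N by (simp add: \<sigma>_def n_def)
    show "\<sigma> < n" using \<beta> \<theta> by (simp add: \<sigma>_def)
  qed
  obtain Ck where Ck: "Ck > 0" and Yle: "\<And>R \<tau> z. R > 0 \<Longrightarrow> \<tau> > 0 \<Longrightarrow> z \<noteq> 0 \<Longrightarrow>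
    Y \<tau> z \<le> memory \<alpha> \<theta> (R powr (2 * \<beta> / \<alpha>)) \<tau> * (Ck * R powr (- n) * (1 + ball_profile \<sigma> R z))"
    using kernel_le_memory[OF \<alpha>(1) \<beta>(1) N \<theta>(1), of Y] Yup \<theta> unfolding n_def \<sigma>_def by auto
  obtain Cm where Cm: "Cm > 0" and mem: "\<And>t T. t \<ge> 2 \<Longrightarrow> 0 < T \<Longrightarrow> T \<le> t / 2 \<Longrightarrow>
    (\<integral>\<^sup>+ s. ennreal (indicator {0<..<t} s * memory \<alpha> \<theta> T (t - s) * (1 + s) powr (- \<gamma>)) \<partial>lborel)
    \<le> ennreal (Cm * T powr \<alpha> * decay \<alpha> \<gamma> t (T powr \<alpha>))"
    using memory_source_upper[OF \<alpha>(1) \<theta>(2), of \<gamma>] by blast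
  \<comment> \<open>The length scale is \<open>c g(t)\<close>, half the inner radius of the annulus: a point of the annulus and a
    point at distance less than \<open>c g(t)\<close> from it have norm at least \<open>c g(t)\<close>.\<close>
  define c where "c = \<nu> / 2"
  have c: "c > 0" using \<nu> by (simp add: c_def)
  define v where "v = unit_ball_vol n"
  have v: "v > 0" by (simp add: v_def n_def)
  define \<Phi> where "\<Phi> t = g t powr (2 * \<beta>) * decay \<alpha> \<gamma> t (g t powr (2 * \<beta>))" for t
  define Cq where "Cq = Cm * c powr (2 * \<beta>) * max 1 (c powr (2 * \<beta>))"
  have Cq: "Cq > 0" using Cm c by (simp add: Cq_def)
  have rate: "rate n \<alpha> \<beta> \<gamma> p g t = g t powr (- n) * g t powr (n * enn2real (1 / p)) * \<Phi> t" for t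
    unfolding rate_eq_decay \<Phi>_def by (simp add: powr_add[symmetric] mult.assoc[symmetric] algebra_simps)
  have ev: "\<forall>\<^sub>F t in at_top. (c * g t) powr (2 * \<beta> / \<alpha>) \<le> 1 / 2 * t"
    by (rule eventually_diffusive_scale_le[OF \<alpha>(1) \<beta>(1) gpos go c]) auto
  have Q: "(\<integral>\<^sup>+ s. ennreal (indicator {0<..<t} s * memory \<alpha> \<theta> ((c * g t) powr (2 * \<beta> / \<alpha>)) (t - s) * (1 + s) powr (- \<gamma>)) \<partial>lborel)
      \<le> ennreal (Cq * \<Phi> t)" if t: "t \<ge> 2" and scale: "(c * g t) powr (2 * \<beta> / \<alpha>) \<le> 1 / 2 * t" for t
  proof -
    define T where "T = (c * g t) powr (2 * \<beta> / \<alpha>)"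
    have gt: "g t > 0" using gpos t by simp
    have T: "T > 0" "T \<le> t / 2" using c gt scale by (auto simp: T_def)
    have Ta: "T powr \<alpha> = c powr (2 * \<beta>) * g t powr (2 * \<beta>)"
      using \<alpha> by (simp add: T_def powr_powr powr_mult)
    have "decay \<alpha> \<gamma> t (T powr \<alpha>) \<le> decay \<alpha> \<gamma> t (max 1 (c powr (2 * \<beta>)) * g t powr (2 * \<beta>))"
      unfolding Ta using t by (intro decay_mono mult_right_mono) auto
    also have "\<dots> \<le> max 1 (c powr (2 * \<beta>)) * decay \<alpha> \<gamma> t (g t powr (2 * \<beta>))"
      using t by (intro decay_scale) auto
    finally have "Cm * T powr \<alpha> * decay \<alpha> \<gamma> t (T powr \<alpha>) \<le>
      Cm * T powr \<alpha> * (max 1 (c powr (2 * \<beta>)) * decay \<alpha> \<gamma> t (g t powr (2 * \<beta>)))"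
      using Cm by (intro mult_left_mono) auto
    also have "\<dots> = Cq * \<Phi> t" unfolding Ta Cq_def \<Phi>_def by (simp only: mult_ac)
    finally show ?thesis
      using mem[OF t T] unfolding T_def[symmetric] by (auto intro: order_trans ennreal_leI)
  qed
  have \<Phi>pos: "\<Phi> t > 0" if "t > 0" for t
    using gpos[OF that] decay_pos[OF that] by (simp add: \<Phi>_def)
  \<comment> \<open>\<open>k\<close> and \<open>K\<close> are the time and the space factor of the majorant of the kernel.\<close>
  define k where "k t s = indicator {0<..<t} s * memory \<alpha> \<theta> ((c * g t) powr (2 * \<beta> / \<alpha>)) (t - s)" for t s
  have km[measurable]: "k t \<in> borel_measurable borel" for t unfolding k_def by measurable
  have knn: "0 \<le> k t s" for t s by (simp add: k_def memory_nonneg)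
  define K where "K t z = Ck * (c * g t) powr (- n) * (1 + ball_profile \<sigma> (c * g t) z)" for t and z :: 'a
  have Km[measurable]: "K t \<in> borel_measurable borel" for t unfolding K_def by measurable
  have Knn: "0 \<le> K t z" for t z using Ck by (simp add: K_def ball_profile_nonneg)
  have maj: "ennreal \<bar>u t x\<bar> \<le> (\<integral>\<^sup>+ s. ennreal (k t s) * (\<integral>\<^sup>+ y. ennreal (K t (x - y)) * ennreal \<bar>F y s\<bar> \<partial>lborel) \<partial>lborel)"
    if t: "t > 0" for t x
    unfolding u k_def
  proof (rule duhamel_le_convolution[OF Ym Fm])
    show "Y \<tau> z \<le> memory \<alpha> \<theta> ((c * g t) powr (2 * \<beta> / \<alpha>)) \<tau> * K t z" if "\<tau> > 0" "z \<noteq> 0" for \<tau> z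
      using Yle[of "c * g t" \<tau> z] that c gpos[OF t] by (simp add: K_def)
  qed (auto simp: Ynn memory_nonneg Knn)
  have kQ: "(\<integral>\<^sup>+ s. ennreal (k t s) * ennreal (D * (1 + s) powr (- \<gamma>)) \<partial>lborel) \<le> ennreal (D * Cq * \<Phi> t)"
    if t: "t \<ge> 2" "(c * g t) powr (2 * \<beta> / \<alpha>) \<le> 1 / 2 * t" and D: "D \<ge> 0" for D t
  proof -
    have "(\<integral>\<^sup>+ s. ennreal (k t s) * ennreal (D * (1 + s) powr (- \<gamma>)) \<partial>lborel) =
      (\<integral>\<^sup>+ s. ennreal D * ennreal (k t s * (1 + s) powr (- \<gamma>)) \<partial>lborel)"
      using D knn[of t] by (intro nn_integral_cong) (simp add: ennreal_mult'[symmetric] mult_ac)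
    also have "\<dots> = ennreal D * (\<integral>\<^sup>+ s. ennreal (k t s * (1 + s) powr (- \<gamma>)) \<partial>lborel)"
      by (rule nn_integral_cmult) measurable
    also have "\<dots> \<le> ennreal D * ennreal (Cq * \<Phi> t)"
      unfolding k_def by (intro mult_left_mono Q t) auto
    also have "\<dots> = ennreal (D * Cq * \<Phi> t)" using D by (simp add: ennreal_mult'[symmetric] mult.assoc)
    finally show ?thesis .
  qed
  have mass: "(\<integral>\<^sup>+ y. \<integral>\<^sup>+ s. ennreal (k t s) * ennreal \<bar>F y s\<bar> \<partial>lborel \<partial>lborel) \<le> ennreal (C0 * Cq * \<Phi> t)"
    if t: "t \<ge> 2" "(c * g t) powr (2 * \<beta> / \<alpha>) \<le> 1 / 2 * t" for t
  proof -
    have "(\<integral>\<^sup>+ y. \<integral>\<^sup>+ s. ennreal (k t s) * ennreal \<bar>F y s\<bar> \<partial>lborel \<partial>lborel) =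
      (\<integral>\<^sup>+ s. ennreal (k t s) * (\<integral>\<^sup>+ y. ennreal \<bar>F y s\<bar> \<partial>lborel) \<partial>lborel)"
      using nn_integral_convolution_swap[of "\<lambda>_. 1" F "k t"] by simp
    also have "\<dots> \<le> (\<integral>\<^sup>+ s. ennreal (k t s) * ennreal (C0 * (1 + s) powr (- \<gamma>)) \<partial>lborel)"
      by (rule nn_integral_mono_AE, rule eventually_mono[OF FL1])
        (auto simp: k_def split: split_indicator intro!: mult_left_mono)
    also have "\<dots> \<le> ennreal (C0 * Cq * \<Phi> t)" by (rule kQ[OF t]) (use C0 in simp)
    finally show ?thesis .
  qed
  have main: "\<exists>C>0. \<forall>\<^sub>F t in at_top. Lp_norm p (lebesgue_on (annulus \<nu> \<mu> (g t))) (u t) \<le> ennreal (C * rate n \<alpha> \<beta> \<gamma> p g t)"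
  proof (cases "ennreal (p_crit n \<beta>) \<le> p")
    case False
    define P where "P = enn2real p"
    have fin: "p \<noteq> \<infinity>" and \<sigma>P: "\<sigma> * P < n" using \<theta>p[OF False] by (auto simp: \<sigma>_def P_def)
    have P: "P \<ge> 1" "enn2real (1 / p) = 1 / P" using enn2real_inverse_exponent[OF p fin] by (auto simp: P_def)
    obtain Cb where Cb: "Cb > 0" and prof: "\<And>R. R > 0 \<Longrightarrow> (\<integral>\<^sup>+ z. ennreal (ball_profile (\<sigma> * P) R (z :: 'a)) \<partial>lborel) \<le> ennreal (Cb * R ^ DIM('a))"
      using nn_integral_ball_profile[of "\<sigma> * P", where 'a = 'a] \<sigma> \<sigma>P P unfolding n_def by auto
    define M where "M = v * \<mu> ^ DIM('a) + Cb * c ^ DIM('a)"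
    have M: "M > 0" using v \<nu> Cb c by (auto simp: M_def intro!: add_pos_pos)
    define C where "C = C0 * Cq * (2 * Ck * c powr (- n) * M powr (1 / P))"
    have C: "C > 0" using C0 Cq Ck c M by (simp add: C_def)
    show ?thesis
    proof (intro exI[of _ C] conjI C)
      show "\<forall>\<^sub>F t in at_top. Lp_norm p (lebesgue_on (annulus \<nu> \<mu> (g t))) (u t) \<le> ennreal (C * rate n \<alpha> \<beta> \<gamma> p g t)"
        using ev eventually_ge_at_top[of 2]
      proof eventually_elim
        case (elim t)
        then have gt: "g t > 0" using gpos by simp
        define A where "A = (annulus \<nu> \<mu> (g t) :: 'a set)"
        have A[measurable]: "A \<in> sets borel" unfolding A_def by (rule annulus_sets)
        define B0 where "B0 = Ck * (c * g t) powr (- n)"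
        have B0: "B0 > 0" using Ck c gt by (simp add: B0_def)
        define B where "B = 2 * B0 * (M * g t ^ DIM('a)) powr (1 / P)"
        have B: "B \<ge> 0" using B0 by (simp add: B_def)
        have BP: "B powr P = B0 powr P * 2 powr P * (M * g t ^ DIM('a))"
        proof -
          have "((M * g t ^ DIM('a)) powr (1 / P)) powr P = M * g t ^ DIM('a)" using P M gt by (simp add: powr_powr)
          then show ?thesis by (simp add: B_def powr_mult mult_ac)
        qed
        have "Lp_norm p (lebesgue_on A) (u t) \<le> ennreal ((C0 * Cq * \<Phi> t) * B)"
        proof (rule Lp_norm_convolution_le[where K = "K t" and G = "\<lambda>y. \<integral>\<^sup>+ s. ennreal (k t s) * ennreal \<bar>F y s\<bar> \<partial>lborel"])
          show "0 < C0 * Cq * \<Phi> t" using C0 Cq \<Phi>pos[of t] elim by simp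
          show "(\<integral>\<^sup>+ y. \<integral>\<^sup>+ s. ennreal (k t s) * ennreal \<bar>F y s\<bar> \<partial>lborel \<partial>lborel) \<le> ennreal (C0 * Cq * \<Phi> t)"
            by (rule mass) (use elim in auto)
          show "ennreal \<bar>u t x\<bar> \<le> (\<integral>\<^sup>+ y. ennreal (K t (x - y)) * (\<integral>\<^sup>+ s. ennreal (k t s) * ennreal \<bar>F y s\<bar> \<partial>lborel) \<partial>lborel)" for x
            using maj[of t x] nn_integral_convolution_swap[of "\<lambda>y. K t (x - y)" F "k t"] elim by simp
          show "(\<integral>\<^sup>+ x. indicator A x * ennreal (K t (x - y) powr enn2real p) \<partial>lborel) \<le> ennreal (B powr enn2real p)" for y
          proof -
            have "(\<integral>\<^sup>+ x. indicator A x * ennreal (K t (x - y) powr P) \<partial>lborel) \<le>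
              (\<integral>\<^sup>+ x. ennreal (B0 powr P * 2 powr P) * (indicator A x + ennreal (ball_profile (\<sigma> * P) (c * g t) (x - y))) \<partial>lborel)"
            proof (rule nn_integral_mono)
              fix x :: 'a
              have "K t (x - y) powr P = B0 powr P * (1 + ball_profile \<sigma> (c * g t) (x - y)) powr P"
                by (simp add: K_def B0_def powr_mult)
              also have "\<dots> \<le> B0 powr P * (2 powr P * (1 + ball_profile (\<sigma> * P) (c * g t) (x - y)))"
                using one_plus_powr_le[of "ball_profile \<sigma> (c * g t) (x - y)" P] P
                by (intro mult_left_mono) (auto simp: ball_profile_nonneg ball_profile_powr)
              finally have "ennreal (K t (x - y) powr P) \<le> ennreal (B0 powr P * 2 powr P * (1 + ball_profile (\<sigma> * P) (c * g t) (x - y)))"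
                by (simp add: ennreal_leI mult.assoc)
              also have "\<dots> = ennreal (B0 powr P * 2 powr P) * (1 + ennreal (ball_profile (\<sigma> * P) (c * g t) (x - y)))"
                by (simp add: ennreal_mult' ennreal_plus ball_profile_nonneg)
              finally show "indicator A x * ennreal (K t (x - y) powr P) \<le> ennreal (B0 powr P * 2 powr P) * (indicator A x + ennreal (ball_profile (\<sigma> * P) (c * g t) (x - y)))"
                by (auto simp: indicator_def)
            qed
            also have "\<dots> = ennreal (B0 powr P * 2 powr P) * (emeasure lborel A + (\<integral>\<^sup>+ x. ennreal (ball_profile (\<sigma> * P) (c * g t) (x - y)) \<partial>lborel))"
              by (simp add: nn_integral_cmult nn_integral_add)
            also have "(\<integral>\<^sup>+ x. ennreal (ball_profile (\<sigma> * P) (c * g t) (x - y)) \<partial>lborel) \<le> ennreal (Cb * (c * g t) ^ DIM('a))"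
              using nn_integral_lborel_shift(1)[of "\<lambda>z. ennreal (ball_profile (\<sigma> * P) (c * g t) z)" y] prof[of "c * g t"] c gt by simp
            also have "emeasure lborel A \<le> ennreal (v * \<mu> ^ DIM('a) * g t ^ DIM('a))"
              using emeasure_annulus(1)[OF \<nu> gt, where 'a = 'a] A by (simp add: A_def v_def n_def)
            also have "ennreal (v * \<mu> ^ DIM('a) * g t ^ DIM('a)) + ennreal (Cb * (c * g t) ^ DIM('a)) = ennreal (M * g t ^ DIM('a))"
            proof -
              have "ennreal (v * \<mu> ^ DIM('a) * g t ^ DIM('a)) + ennreal (Cb * (c * g t) ^ DIM('a)) = ennreal (v * \<mu> ^ DIM('a) * g t ^ DIM('a) + Cb * (c * g t) ^ DIM('a))"
                using v \<nu> gt Cb c by (intro ennreal_plus[symmetric]) auto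
              then show ?thesis by (simp add: M_def power_mult_distrib distrib_right mult.assoc)
            qed
            also have "ennreal (B0 powr P * 2 powr P) * ennreal (M * g t ^ DIM('a)) = ennreal (B powr P)"
              by (simp add: BP ennreal_mult'[symmetric])
            finally show ?thesis by (simp add: P_def mult_left_mono add_mono)
          qed
        qed (use p fin B Knn in auto)
        also have "(C0 * Cq * \<Phi> t) * B = C * rate n \<alpha> \<beta> \<gamma> p g t"
        proof -
          have "(M * g t ^ DIM('a)) powr (1 / P) = M powr (1 / P) * g t powr (n * (1 / P))"
            using gt by (simp add: powr_mult powr_realpow[symmetric] powr_powr n_def)
          moreover have "(c * g t) powr (- n) = c powr (- n) * g t powr (- n)" by (rule powr_mult)
          ultimately show ?thesis unfolding rate P(2) C_def B_def B0_def by (simp only: mult_ac)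
        qed
        finally show ?case by (simp add: A_def)
      qed
    qed
  next
    case True
    obtain C1 R0 where C1: "C1 > 0" and R0: "R0 > 0"
      and fdec: "\<And>x t. R0 \<le> norm x \<Longrightarrow> 0 \<le> t \<Longrightarrow> \<bar>f x t\<bar> \<le> C1 * norm x powr (- n) * (1 + t) powr (- \<gamma>)"
      using f True unfolding admissible_source_def n_def by blast
    obtain Cb where Cb: "Cb > 0" and prof: "\<And>R. R > 0 \<Longrightarrow> (\<integral>\<^sup>+ z. ennreal (ball_profile \<sigma> R (z :: 'a)) \<partial>lborel) \<le> ennreal (Cb * R ^ DIM('a))"
      using nn_integral_ball_profile[of \<sigma>, where 'a = 'a] \<sigma> unfolding n_def by auto
    define D where "D = C0 + C1 * Cb"
    have D: "D > 0" using C0 C1 Cb by (auto simp: D_def intro!: add_pos_pos)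
    define C where "C = Ck * c powr (- n) * D * Cq * (v * \<mu> ^ DIM('a)) powr enn2real (1 / p)"
    have C: "C > 0" using Ck c D Cq v \<nu> by (simp add: C_def)
    have ev2: "\<forall>\<^sub>F t in at_top. R0 / c \<le> g t"
      using gtop by (simp add: filterlim_at_top)
    show ?thesis
    proof (intro exI[of _ C] conjI C)
      show "\<forall>\<^sub>F t in at_top. Lp_norm p (lebesgue_on (annulus \<nu> \<mu> (g t))) (u t) \<le> ennreal (C * rate n \<alpha> \<beta> \<gamma> p g t)"
        using ev ev2 eventually_ge_at_top[of 2]
      proof eventually_elim
        case (elim t)
        then have gt: "g t > 0" using gpos by simp
        define R where "R = c * g t"
        have R: "R > 0" "R0 \<le> R" using elim c gt by (auto simp: R_def field_simps)
        define A where "A = (annulus \<nu> \<mu> (g t) :: 'a set)"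
        have A: "A \<in> sets borel" unfolding A_def by (rule annulus_sets)
        define B where "B = Ck * R powr (- n) * (D * Cq * \<Phi> t)"
        have B: "B \<ge> 0" using Ck D Cq \<Phi>pos[of t] elim by (simp add: B_def)
        have "\<bar>u t x\<bar> \<le> B" if x: "x \<in> A" for x
        proof -
          have xn: "2 * R \<le> norm x" using x gt by (simp add: A_def annulus_def R_def c_def field_simps)
          have inner: "AE s in lborel. 0 \<le> s \<longrightarrow>
            (\<integral>\<^sup>+ y. ennreal (K t (x - y)) * ennreal \<bar>F y s\<bar> \<partial>lborel) \<le> ennreal (Ck * R powr (- n)) * ennreal (D * (1 + s) powr (- \<gamma>))"
            using FL1 fF
          proof eventually_elim
            case (elim s)
            show ?case
            proof
              assume s: "0 \<le> s"
              then have ae: "AE y in lborel. f y s = F y s" using elim by simp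
              have far: "AE y in lborel. ennreal (ball_profile \<sigma> R (x - y)) * ennreal \<bar>F y s\<bar> \<le>
                ennreal (C1 * R powr (- n) * (1 + s) powr (- \<gamma>)) * ennreal (ball_profile \<sigma> R (x - y))"
                using ae
              proof eventually_elim
                case (elim y)
                show ?case
                proof (cases "norm (x - y) < R")
                  case True
                  have "norm x \<le> norm (x - y) + norm y" using norm_triangle_ineq[of "x - y" y] by simp
                  then have yn: "R \<le> norm y" using True xn by simp
                  then have "\<bar>F y s\<bar> \<le> C1 * norm y powr (- n) * (1 + s) powr (- \<gamma>)"
                    using fdec[of y s] R s elim by simp
                  also have "\<dots> \<le> C1 * R powr (- n) * (1 + s) powr (- \<gamma>)"
                    using yn R C1 \<sigma> by (intro mult_right_mono mult_left_mono powr_mono2') auto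
                  finally show ?thesis by (subst mult.commute) (intro mult_right_mono ennreal_leI, auto)
                qed (simp add: ball_profile_def)
              qed
              have "(\<integral>\<^sup>+ y. ennreal (K t (x - y)) * ennreal \<bar>F y s\<bar> \<partial>lborel) =
                (\<integral>\<^sup>+ y. ennreal (Ck * R powr (- n)) * (ennreal \<bar>F y s\<bar> + ennreal (ball_profile \<sigma> R (x - y)) * ennreal \<bar>F y s\<bar>) \<partial>lborel)"
              proof (intro nn_integral_cong)
                fix y
                have "ennreal (K t (x - y)) = ennreal (Ck * R powr (- n)) * (1 + ennreal (ball_profile \<sigma> R (x - y)))"
                  using Ck by (simp add: K_def R_def[symmetric] ennreal_mult' ennreal_plus ball_profile_nonneg)
                then show "ennreal (K t (x - y)) * ennreal \<bar>F y s\<bar> =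
                  ennreal (Ck * R powr (- n)) * (ennreal \<bar>F y s\<bar> + ennreal (ball_profile \<sigma> R (x - y)) * ennreal \<bar>F y s\<bar>)"
                  by (simp only: mult.assoc distrib_right mult_1)
              qed
              also have "\<dots> = ennreal (Ck * R powr (- n)) * ((\<integral>\<^sup>+ y. ennreal \<bar>F y s\<bar> \<partial>lborel) + (\<integral>\<^sup>+ y. ennreal (ball_profile \<sigma> R (x - y)) * ennreal \<bar>F y s\<bar> \<partial>lborel))"
                by (subst nn_integral_cmult, measurable, subst nn_integral_add) auto
              also have "(\<integral>\<^sup>+ y. ennreal (ball_profile \<sigma> R (x - y)) * ennreal \<bar>F y s\<bar> \<partial>lborel) \<le>
                (\<integral>\<^sup>+ y. ennreal (C1 * R powr (- n) * (1 + s) powr (- \<gamma>)) * ennreal (ball_profile \<sigma> R (x - y)) \<partial>lborel)"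
                by (rule nn_integral_mono_AE[OF far])
              also have "\<dots> = ennreal (C1 * R powr (- n) * (1 + s) powr (- \<gamma>)) * (\<integral>\<^sup>+ z. ennreal (ball_profile \<sigma> R (z :: 'a)) \<partial>lborel)"
                using nn_integral_lborel_shift(2)[of "\<lambda>z. ennreal (ball_profile \<sigma> R z)" x] by (subst nn_integral_cmult) auto
              also have "(\<integral>\<^sup>+ z. ennreal (ball_profile \<sigma> R (z :: 'a)) \<partial>lborel) \<le> ennreal (Cb * R ^ DIM('a))"
                by (rule prof[OF R(1)])
              also have "(\<integral>\<^sup>+ y. ennreal \<bar>F y s\<bar> \<partial>lborel) \<le> ennreal (C0 * (1 + s) powr (- \<gamma>))" using elim s by simp
              also have "ennreal (C0 * (1 + s) powr (- \<gamma>)) + ennreal (C1 * R powr (- n) * (1 + s) powr (- \<gamma>)) * ennreal (Cb * R ^ DIM('a)) = ennreal (D * (1 + s) powr (- \<gamma>))"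
              proof -
                have "R powr (- n) * R ^ DIM('a) = 1" using R by (simp add: powr_realpow[symmetric] powr_add[symmetric] n_def)
                then have "C1 * R powr (- n) * (1 + s) powr (- \<gamma>) * (Cb * R ^ DIM('a)) = C1 * Cb * (1 + s) powr (- \<gamma>)"
                  by (metis (no_types, opaque_lifting) mult.assoc mult.commute mult.right_neutral)
                moreover have "ennreal (C1 * R powr (- n) * (1 + s) powr (- \<gamma>)) * ennreal (Cb * R ^ DIM('a)) =
                  ennreal (C1 * R powr (- n) * (1 + s) powr (- \<gamma>) * (Cb * R ^ DIM('a)))"
                  using C1 by (intro ennreal_mult'[symmetric]) auto
                ultimately have "ennreal (C1 * R powr (- n) * (1 + s) powr (- \<gamma>)) * ennreal (Cb * R ^ DIM('a)) = ennreal (C1 * Cb * (1 + s) powr (- \<gamma>))"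
                  by (simp only:)
                moreover have "ennreal (C0 * (1 + s) powr (- \<gamma>)) + ennreal (C1 * Cb * (1 + s) powr (- \<gamma>)) = ennreal (D * (1 + s) powr (- \<gamma>))"
                  using C0 C1 Cb unfolding D_def distrib_right by (intro ennreal_plus[symmetric]) auto
                ultimately show ?thesis by simp
              qed
              finally show "(\<integral>\<^sup>+ y. ennreal (K t (x - y)) * ennreal \<bar>F y s\<bar> \<partial>lborel) \<le> ennreal (Ck * R powr (- n)) * ennreal (D * (1 + s) powr (- \<gamma>))"
                by (simp add: mult_left_mono add_mono)
            qed
          qed
          have "ennreal \<bar>u t x\<bar> \<le> (\<integral>\<^sup>+ s. ennreal (k t s) * (\<integral>\<^sup>+ y. ennreal (K t (x - y)) * ennreal \<bar>F y s\<bar> \<partial>lborel) \<partial>lborel)"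
            by (rule maj) (use elim in simp)
          also have "\<dots> \<le> (\<integral>\<^sup>+ s. ennreal (Ck * R powr (- n)) * (ennreal (k t s) * ennreal (D * (1 + s) powr (- \<gamma>))) \<partial>lborel)"
          proof (rule nn_integral_mono_AE, rule eventually_mono[OF inner])
            fix s assume *: "0 \<le> s \<longrightarrow> (\<integral>\<^sup>+ y. ennreal (K t (x - y)) * ennreal \<bar>F y s\<bar> \<partial>lborel) \<le> ennreal (Ck * R powr (- n)) * ennreal (D * (1 + s) powr (- \<gamma>))"
            show "ennreal (k t s) * (\<integral>\<^sup>+ y. ennreal (K t (x - y)) * ennreal \<bar>F y s\<bar> \<partial>lborel) \<le>
              ennreal (Ck * R powr (- n)) * (ennreal (k t s) * ennreal (D * (1 + s) powr (- \<gamma>)))"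
            proof (cases "0 < s \<and> s < t")
              case True
              then have "ennreal (k t s) * (\<integral>\<^sup>+ y. ennreal (K t (x - y)) * ennreal \<bar>F y s\<bar> \<partial>lborel) \<le>
                ennreal (k t s) * (ennreal (Ck * R powr (- n)) * ennreal (D * (1 + s) powr (- \<gamma>)))"
                using * by (intro mult_left_mono) auto
              then show ?thesis by (simp only: mult_ac)
            qed (simp add: k_def)
          qed
          also have "\<dots> = ennreal (Ck * R powr (- n)) * (\<integral>\<^sup>+ s. ennreal (k t s) * ennreal (D * (1 + s) powr (- \<gamma>)) \<partial>lborel)"
            by (rule nn_integral_cmult) measurable
          also have "\<dots> \<le> ennreal (Ck * R powr (- n)) * ennreal (D * Cq * \<Phi> t)"
            by (intro mult_left_mono kQ) (use elim D in auto)
          also have "\<dots> = ennreal B" using Ck by (simp add: B_def ennreal_mult'[symmetric])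
          finally show ?thesis using B by simp
        qed
        then have "Lp_norm p (lebesgue_on A) (u t) \<le> ennreal (B * (v * \<mu> ^ DIM('a) * g t ^ DIM('a)) powr enn2real (1 / p))"
          using A emeasure_annulus(1)[OF \<nu> gt, where 'a = 'a] v \<nu> gt B um' p
          by (intro Lp_norm_le_of_bound) (auto simp: A_def v_def n_def)
        also have "B * (v * \<mu> ^ DIM('a) * g t ^ DIM('a)) powr enn2real (1 / p) = C * rate n \<alpha> \<beta> \<gamma> p g t"
        proof -
          have "(v * \<mu> ^ DIM('a) * g t ^ DIM('a)) powr enn2real (1 / p) = (v * \<mu> ^ DIM('a)) powr enn2real (1 / p) * g t powr (n * enn2real (1 / p))"
            using gt by (simp add: powr_mult powr_realpow[symmetric] powr_powr n_def)
          moreover have "R powr (- n) = c powr (- n) * g t powr (- n)" unfolding R_def by (rule powr_mult)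
          ultimately show ?thesis unfolding rate C_def B_def by (simp only: mult_ac)
        qed
        finally show ?case by (simp add: A_def)
      qed
    qed
  qed
  then obtain C where C: "C > 0" and evC: "\<forall>\<^sub>F t in at_top. Lp_norm p (lebesgue_on (annulus \<nu> \<mu> (g t))) (u t) \<le> ennreal (C * rate n \<alpha> \<beta> \<gamma> p g t)"
    by blast
  then obtain t0 where "\<And>t. t \<ge> t0 \<Longrightarrow> Lp_norm p (lebesgue_on (annulus \<nu> \<mu> (g t))) (u t) \<le> ennreal (C * rate n \<alpha> \<beta> \<gamma> p g t)"
    by (auto simp: eventually_at_top_linorder)
  then show ?thesis
    using C um' unfolding n_def u_def by (intro exI[of _ C] conjI exI[of _ "max 2 t0"]) auto
qed

section \<open>Sharpness\<close>

lemma pred_in_ball [measurable (raw)]: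
  assumes [measurable]: "f \<in> borel_measurable M"
  shows "Measurable.pred M (\<lambda>x. (f x :: 'a::euclidean_space) \<in> ball c r)"
  unfolding mem_ball by measurable

lemma admissible_unit_ball_source:
  fixes \<beta> \<gamma> :: real and p :: ennreal
  shows "admissible_source \<beta> \<gamma> p (\<lambda>(y :: 'a::euclidean_space) s. (1 + s) powr (- \<gamma>) * indicator (ball 0 1) y)"
  unfolding admissible_source_def
proof (intro conjI impI)
  let ?f = "\<lambda>(y :: 'a) s. (1 + s) powr (- \<gamma>) * indicator (ball 0 1) y"
  have m: "case_prod ?f \<in> borel_measurable borel"
  proof -
    have "case_prod ?f \<in> borel_measurable (borel \<Otimes>\<^sub>M borel)" by measurable
    then show ?thesis by (simp add: borel_prod)
  qed
  show "(\<lambda>(x, t). ?f x t) \<in> borel_measurable (lebesgue_on (UNIV \<times> {0..}))"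
    using m by (intro measurable_restrict_space1 measurable_completion) simp
  define v where "v = unit_ball_vol (real DIM('a))"
  have v: "v > 0" by (simp add: v_def)
  show "\<exists>C\<^sub>0>0. \<forall>t\<ge>0. (\<lambda>x. ?f x t) \<in> borel_measurable lebesgue \<and> Lp_norm 1 lebesgue (\<lambda>x. ?f x t) \<le> ennreal (C\<^sub>0 / (1 + t) powr \<gamma>)"
  proof (intro exI[of _ v] conjI v allI impI)
    fix t :: real assume t: "0 \<le> t"
    show "(\<lambda>x. ?f x t) \<in> borel_measurable lebesgue" by (intro measurable_completion) simp
    have "Lp_norm 1 lebesgue (\<lambda>x. ?f x t) = (\<integral>\<^sup>+ x. ennreal ((1 + t) powr (- \<gamma>)) * indicator (ball 0 1) (x :: 'a) \<partial>lborel)"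
      by (auto simp: Lp_norm_1 nn_integral_completion indicator_def intro!: nn_integral_cong)
    also have "\<dots> = ennreal ((1 + t) powr (- \<gamma>)) * ennreal v"
      using emeasure_ball[of 1 "0 :: 'a"] by (simp add: nn_integral_cmult_indicator v_def)
    finally show "Lp_norm 1 lebesgue (\<lambda>x. ?f x t) \<le> ennreal (v / (1 + t) powr \<gamma>)"
      using v by (simp add: ennreal_mult'[symmetric] powr_minus divide_inverse mult.commute)
  qed
  show "\<exists>C\<^sub>1>0. \<exists>R\<^sub>0>0. \<forall>x t. R\<^sub>0 \<le> norm x \<and> 0 \<le> t \<longrightarrow> \<bar>?f x t\<bar> \<le> C\<^sub>1 * norm x powr (- real DIM('a)) * (1 + t) powr (- \<gamma>)"
    by (intro exI[of _ 1] conjI) (auto simp: indicator_def)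
qed

text \<open>
  Points with \<open>|x| \<ge> 2\<close> have distance at least \<open>1\<close> from the source. There the kernel is bounded in
  space and integrable in time, so that all integrals converge and the real-valued solution is the extended
  nonnegative integral.
\<close>
lemma duhamel_unit_ball_source:
  fixes Y :: "real \<Rightarrow> 'a::euclidean_space \<Rightarrow> real"
  assumes Ym[measurable]: "case_prod Y \<in> borel_measurable (borel \<Otimes>\<^sub>M borel)" and Ynn: "\<And>t x. 0 \<le> Y t x"
    and e: "e > 0" and Y: "\<And>\<tau> z. \<tau> > 0 \<Longrightarrow> 1 \<le> norm z \<Longrightarrow> Y \<tau> z \<le> C * \<tau> powr (e - 1)" and C: "C > 0"
    and t: "t > 0" and x: "2 \<le> norm x"
  shows "ennreal (duhamel Y (\<lambda>y s. (1 + s) powr (- \<gamma>) * indicator (ball 0 1) y) x t) =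
    (\<integral>\<^sup>+ s. ennreal (indicator {0<..<t} s * (1 + s) powr (- \<gamma>)) * (\<integral>\<^sup>+ y. ennreal (Y (t - s) (x - y)) * indicator (ball 0 1) y \<partial>lborel) \<partial>lborel)"
    and "0 \<le> duhamel Y (\<lambda>y s. (1 + s) powr (- \<gamma>) * indicator (ball 0 1) y) x t"
proof -
  define v where "v = unit_ball_vol (real DIM('a))"
  have v: "v > 0" by (simp add: v_def)
  have vol: "emeasure lborel (ball (0 :: 'a) 1) = ennreal v" using emeasure_ball[of 1 "0 :: 'a"] by (simp add: v_def)
  have dist: "1 \<le> norm (x - y)" if "y \<in> ball 0 1" for y
    using norm_triangle_ineq[of "x - y" y] x that by simp
  define J where "J s = (LINT y|lborel. Y (t - s) (x - y) * ((1 + s) powr (- \<gamma>) * indicator (ball 0 1) y))" for s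
  have Jm[measurable]: "J \<in> borel_measurable borel" unfolding J_def by measurable
  have J0: "0 \<le> J s" for s unfolding J_def using Ynn by (intro Bochner_Integration.integral_nonneg) auto
  define I where "I s = (\<integral>\<^sup>+ y. ennreal (Y (t - s) (x - y)) * indicator (ball 0 1) y \<partial>lborel)" for s
  have I: "I s \<le> ennreal (C * (t - s) powr (e - 1) * v)" if s: "s < t" for s
  proof -
    have "I s \<le> (\<integral>\<^sup>+ y. ennreal (C * (t - s) powr (e - 1)) * indicator (ball (0 :: 'a) 1) y \<partial>lborel)"
      unfolding I_def using Y[of "t - s"] s dist
      by (intro nn_integral_mono) (auto simp: indicator_def intro!: ennreal_leI)
    also have "\<dots> = ennreal (C * (t - s) powr (e - 1)) * ennreal v" by (simp add: nn_integral_cmult_indicator vol)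
    finally show ?thesis using C by (simp add: ennreal_mult'[symmetric])
  qed
  have J: "ennreal (J s) = ennreal ((1 + s) powr (- \<gamma>)) * I s" if s: "s < t" for s
  proof -
    have "(\<integral>\<^sup>+ y. ennreal (Y (t - s) (x - y) * ((1 + s) powr (- \<gamma>) * indicator (ball 0 1) y)) \<partial>lborel) =
      (\<integral>\<^sup>+ y. ennreal ((1 + s) powr (- \<gamma>)) * (ennreal (Y (t - s) (x - y)) * indicator (ball 0 1) y) \<partial>lborel)"
      using Ynn by (intro nn_integral_cong) (auto simp: indicator_def ennreal_mult'[symmetric] mult.commute)
    also have "\<dots> = ennreal ((1 + s) powr (- \<gamma>)) * I s"
      unfolding I_def by (rule nn_integral_cmult) measurable
    finally have eq: "(\<integral>\<^sup>+ y. ennreal (Y (t - s) (x - y) * ((1 + s) powr (- \<gamma>) * indicator (ball 0 1) y)) \<partial>lborel) = ennreal ((1 + s) powr (- \<gamma>)) * I s" .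
    have "I s < \<infinity>" using I[OF s] by (rule order.strict_trans1) simp
    then have "ennreal ((1 + s) powr (- \<gamma>)) * I s < \<infinity>" by (simp add: ennreal_mult_less_top)
    then have "integrable lborel (\<lambda>y. Y (t - s) (x - y) * ((1 + s) powr (- \<gamma>) * indicator (ball 0 1) y))"
      using eq Ynn by (intro integrableI_nonneg) auto
    then show ?thesis unfolding eq[symmetric] J_def using Ynn by (intro nn_integral_eq_integral[symmetric]) auto
  qed
  have fin: "(\<integral>\<^sup>+ s. ennreal (indicator {0<..<t} s * J s) \<partial>lborel) < \<infinity>"
  proof -
    define M where "M = max 1 ((1 + t) powr (- \<gamma>))"
    have M: "(1 + s) powr (- \<gamma>) \<le> M" if "0 < s" "s < t" for s
    proof (cases "\<gamma> \<ge> 0")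
      case True
      then have "(1 + s) powr (- \<gamma>) \<le> 1 powr (- \<gamma>)" using that by (intro powr_mono2') auto
      then show ?thesis by (simp add: M_def)
    next
      case False
      then have "(1 + s) powr (- \<gamma>) \<le> (1 + t) powr (- \<gamma>)" using that by (intro powr_mono2) auto
      then show ?thesis by (simp add: M_def)
    qed
    have "(\<integral>\<^sup>+ s. ennreal (indicator {0<..<t} s * J s) \<partial>lborel) \<le> (\<integral>\<^sup>+ s. ennreal (M * C * v) * ennreal (indicator {0..t} (t - s) * (t - s) powr (e - 1)) \<partial>lborel)"
    proof (rule nn_integral_mono)
      fix s :: real
      show "ennreal (indicator {0<..<t} s * J s) \<le> ennreal (M * C * v) * ennreal (indicator {0..t} (t - s) * (t - s) powr (e - 1))"
      proof (cases "s \<in> {0<..<t}")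
        case True
        then have "ennreal (J s) \<le> ennreal ((1 + s) powr (- \<gamma>)) * ennreal (C * (t - s) powr (e - 1) * v)"
          using J[of s] I[of s] by (simp add: mult_left_mono)
        also have "\<dots> \<le> ennreal M * ennreal (C * (t - s) powr (e - 1) * v)"
          using M[of s] True by (intro mult_right_mono ennreal_leI) auto
        finally show ?thesis using True C v by (simp add: ennreal_mult'[symmetric] M_def mult_ac)
      qed simp
    qed
    also have "\<dots> = ennreal (M * C * v) * (\<integral>\<^sup>+ s. ennreal (indicator {0..t} (t - s) * (t - s) powr (e - 1)) \<partial>lborel)"
      by (rule nn_integral_cmult) measurable
    also have "(\<integral>\<^sup>+ s. ennreal (indicator {0..t} (t - s) * (t - s) powr (e - 1)) \<partial>lborel) = (\<integral>\<^sup>+ s. ennreal (indicator {0..t} s * s powr (e - 1)) \<partial>lborel)"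
      using nn_integral_lborel_shift(2)[of "\<lambda>s :: real. ennreal (indicator {0..t} s * s powr (e - 1))" t] by simp
    also have "\<dots> = ennreal (t powr e / e)"
    proof -
      have "((\<lambda>k. k powr (e - 1)) has_integral (t powr (e - 1 + 1) / (e - 1 + 1))) {0..t}"
        by (rule has_integral_powr_from_0) (use e t in auto)
      then show ?thesis by (subst nn_integral_has_integral_lebesgue) auto
    qed
    finally show ?thesis by (auto simp: ennreal_mult_less_top intro: order.strict_trans1)
  qed
  have d: "duhamel Y (\<lambda>y s. (1 + s) powr (- \<gamma>) * indicator (ball 0 1) y) x t = (LINT s|lborel. indicator {0<..<t} s * J s)"
    by (simp add: duhamel_def J_def)
  have "integrable lborel (\<lambda>s. indicator {0<..<t} s * J s)"
    using fin J0 by (intro integrableI_nonneg) auto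
  then have "ennreal (LINT s|lborel. indicator {0<..<t} s * J s) = (\<integral>\<^sup>+ s. ennreal (indicator {0<..<t} s * J s) \<partial>lborel)"
    using J0 by (intro nn_integral_eq_integral[symmetric]) auto
  also have "\<dots> = (\<integral>\<^sup>+ s. ennreal (indicator {0<..<t} s * (1 + s) powr (- \<gamma>)) * I s \<partial>lborel)"
    by (intro nn_integral_cong) (auto simp: J indicator_def)
  finally show "ennreal (duhamel Y (\<lambda>y s. (1 + s) powr (- \<gamma>) * indicator (ball 0 1) y) x t) =
    (\<integral>\<^sup>+ s. ennreal (indicator {0<..<t} s * (1 + s) powr (- \<gamma>)) * (\<integral>\<^sup>+ y. ennreal (Y (t - s) (x - y)) * indicator (ball 0 1) y \<partial>lborel) \<partial>lborel)"
    unfolding d I_def .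
  show "0 \<le> duhamel Y (\<lambda>y s. (1 + s) powr (- \<gamma>) * indicator (ball 0 1) y) x t"
    unfolding d using J0 by (intro Bochner_Integration.integral_nonneg) auto
qed

text \<open>
  Between the unit ball and the annulus distances are at most \<open>b g(t)\<close>. For elapsed times beyond the
  diffusive time \<open>T\<close> of this length the lower bound of the kernel applies, and integrating it over
  these times gives the rate at every point of the annulus.
\<close>
lemma mild_solution_lower_bound:
  fixes \<alpha> \<beta> \<gamma> \<nu> \<mu> :: real and p :: ennreal and g :: "real \<Rightarrow> real"
  assumes \<alpha>: "0 < \<alpha>" "\<alpha> < 1" and \<beta>: "0 < \<beta>" "\<beta> \<le> 1" and N: "real DIM('a::euclidean_space) > 4 * \<beta>" and p: "1 \<le> p"
    and gpos: "\<And>t. t > 0 \<Longrightarrow> g t > 0" and gtop: "filterlim g at_top at_top"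
    and go: "g \<in> o[at_top](\<lambda>t. t powr (\<alpha> / (2 * \<beta>)))"
    and \<nu>: "0 < \<nu>" "\<nu> < \<mu>"
  defines "f \<equiv> \<lambda>(y :: 'a) s. (1 + s) powr (- \<gamma>) * indicator (ball 0 1) y"
  shows "\<exists>c>0. \<exists>t\<^sub>1\<ge>2. \<forall>t\<ge>t\<^sub>1.
            (\<lambda>x. mild_solution \<alpha> \<beta> f x t) \<in> borel_measurable (lebesgue_on (annulus \<nu> \<mu> (g t))) \<and>
            ennreal (c * rate (real DIM('a)) \<alpha> \<beta> \<gamma> p g t) \<le>
            Lp_norm p (lebesgue_on (annulus \<nu> \<mu> (g t))) (\<lambda>x. mild_solution \<alpha> \<beta> f x t)"
proof -
  define n where "n = real DIM('a)"
  obtain Y :: "real \<Rightarrow> 'a \<Rightarrow> real" where Ym0: "(\<lambda>(t, x). Y t x) \<in> borel_measurable borel"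
    and Ynn: "\<And>t x. 0 \<le> Y t x"
    and Yk: "\<And>t. t > 0 \<Longrightarrow> AE x in lborel. kernel_Y \<alpha> \<beta> t x = Y t x"
    and Yup: "\<And>\<theta>. 0 < \<theta> \<Longrightarrow> \<theta> \<le> 1 \<Longrightarrow> \<exists>C>0. \<forall>t>0. \<forall>x. x \<noteq> 0 \<longrightarrow>
       Y t x \<le> C * t powr (\<alpha> - 1 - 2 * \<alpha> * \<theta>) * norm x powr (4 * \<beta> * \<theta> - real DIM('a))"
    and Ylow: "\<exists>c>0. \<forall>t>0. \<forall>x. x \<noteq> 0 \<and> norm x \<le> t powr (\<alpha> / (2 * \<beta>)) \<longrightarrow>
       c * t powr (- 1 - \<alpha>) * norm x powr (4 * \<beta> - real DIM('a)) \<le> Y t x"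
    by (rule ex_fundamental_kernel[OF \<alpha> \<beta> N]) (assumption | blast)+
  have Ym[measurable]: "case_prod Y \<in> borel_measurable (borel \<Otimes>\<^sub>M borel)" using Ym0 by (simp add: borel_prod)
  have fm[measurable]: "case_prod f \<in> borel_measurable (borel \<Otimes>\<^sub>M borel)" unfolding f_def by measurable
  define u where "u t x = mild_solution \<alpha> \<beta> f x t" for t x
  have u: "u t x = duhamel Y f x t" for t x
    unfolding u_def by (rule mild_solution_eq_duhamel[OF Ym fm Yk]) auto
  have um: "u t \<in> borel_measurable (lebesgue_on A)" for t A
    using duhamel_measurable[OF Ym fm, of t] unfolding u
    by (intro measurable_restrict_space1 measurable_completion) simp
  obtain cl where cl: "cl > 0" and low: "\<And>t x. t > 0 \<Longrightarrow> x \<noteq> 0 \<Longrightarrow> norm x \<le> t powr (\<alpha> / (2 * \<beta>)) \<Longrightarrow>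
       cl * t powr (- 1 - \<alpha>) * norm x powr (4 * \<beta> - n) \<le> Y t x"
    using Ylow unfolding n_def by blast
  \<comment> \<open>An exponent below \<open>1/2\<close> leaves a time singularity that is integrable at \<open>0\<close>.\<close>
  obtain Cu where Cu: "Cu > 0" and up: "\<And>t x. t > 0 \<Longrightarrow> x \<noteq> 0 \<Longrightarrow>
       Y t x \<le> Cu * t powr (\<alpha> - 1 - 2 * \<alpha> * (1 / 4)) * norm x powr (4 * \<beta> * (1 / 4) - n)"
    using Yup[of "1 / 4"] unfolding n_def by auto
  have up': "Y \<tau> z \<le> Cu * \<tau> powr (\<alpha> / 2 - 1)" if "\<tau> > 0" "1 \<le> norm z" for \<tau> z
  proof -
    have "Y \<tau> z \<le> Cu * \<tau> powr (\<alpha> - 1 - 2 * \<alpha> * (1 / 4)) * norm z powr (4 * \<beta> * (1 / 4) - n)"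
      using that by (intro up) auto
    also have "\<dots> \<le> Cu * \<tau> powr (\<alpha> - 1 - 2 * \<alpha> * (1 / 4)) * 1"
    proof (intro mult_left_mono)
      have "norm z powr (4 * \<beta> * (1 / 4) - n) \<le> 1 powr (4 * \<beta> * (1 / 4) - n)"
        using that N \<beta> by (intro powr_mono2') (auto simp: n_def)
      then show "norm z powr (4 * \<beta> * (1 / 4) - n) \<le> 1" by simp
    qed (use Cu in simp)
    also have "\<alpha> - 1 - 2 * \<alpha> * (1 / 4) = \<alpha> / 2 - 1" by simp
    finally show ?thesis by simp
  qed
  obtain ct where ct: "ct > 0" and time: "\<And>t T. t \<ge> 2 \<Longrightarrow> 0 < T \<Longrightarrow> T \<le> t / 4 \<Longrightarrow>
    ennreal (ct * T powr (- \<alpha>) * decay \<alpha> \<gamma> t (T powr \<alpha>)) \<le>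
    (\<integral>\<^sup>+ s. ennreal (indicator {0<..<t - T} s * (t - s) powr (- 1 - \<alpha>) * (1 + s) powr (- \<gamma>)) \<partial>lborel)"
    using memory_source_lower[OF \<alpha>(1), of \<gamma>] by blast
  \<comment> \<open>Once \<open>g t \<ge> 1\<close>, points of the annulus and of the unit ball have distance at most \<open>b * g t\<close>.\<close>
  define b where "b = \<mu> + 1"
  have b: "b \<ge> 1" using \<nu> by (simp add: b_def)
  define v where "v = unit_ball_vol n"
  have v: "v > 0" by (simp add: v_def n_def)
  define V where "V = v * (\<mu> ^ DIM('a) - \<nu> ^ DIM('a))"
  have V: "V > 0"
  proof -
    have "\<nu> ^ DIM('a) < \<mu> ^ DIM('a)" using \<nu> by (intro power_strict_mono) auto
    then show ?thesis using v by (simp add: V_def)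
  qed
  define c where "c = cl * v * ct * b powr (4 * \<beta> - n) * b powr (- (2 * \<beta>)) * V powr enn2real (1 / p)"
  have c: "c > 0" using cl v ct b V by (simp add: c_def)
  have ev1: "\<forall>\<^sub>F t in at_top. (b * g t) powr (2 * \<beta> / \<alpha>) \<le> 1 / 4 * t"
    by (rule eventually_diffusive_scale_le[OF \<alpha>(1) \<beta>(1) gpos go]) (use b in auto)
  have ev2: "\<forall>\<^sub>F t in at_top. max 1 (2 / \<nu>) \<le> g t"
    using gtop unfolding filterlim_at_top by blast
  have main: "\<forall>\<^sub>F t in at_top. ennreal (c * rate n \<alpha> \<beta> \<gamma> p g t) \<le> Lp_norm p (lebesgue_on (annulus \<nu> \<mu> (g t))) (u t)"
    using ev1 ev2 eventually_ge_at_top[of 2]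
  proof eventually_elim
    case (elim t)
    then have gt: "g t \<ge> 1" "2 \<le> \<nu> * g t" using \<nu> by (auto simp: field_simps)
    define A where "A = (annulus \<nu> \<mu> (g t) :: 'a set)"
    have A: "A \<in> sets borel" unfolding A_def by (rule annulus_sets)
    define T where "T = (b * g t) powr (2 * \<beta> / \<alpha>)"
    have T: "T > 0" "T \<le> t / 4" using elim b gt by (auto simp: T_def)
    have Ta: "T powr \<alpha> = b powr (2 * \<beta>) * g t powr (2 * \<beta>)" "T powr (- \<alpha>) = b powr (- (2 * \<beta>)) * g t powr (- (2 * \<beta>))"
      using \<alpha> by (auto simp: T_def powr_powr powr_mult)
    have Tb: "T powr (\<alpha> / (2 * \<beta>)) = b * g t" using \<alpha> \<beta> b gt by (simp add: T_def powr_powr)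
    define B where "B = cl * v * (b * g t) powr (4 * \<beta> - n) * (ct * T powr (- \<alpha>) * decay \<alpha> \<gamma> t (g t powr (2 * \<beta>)))"
    have B: "B \<ge> 0" using cl v ct decay_pos[of t \<alpha> \<gamma>] elim by (simp add: B_def less_imp_le)
    have uB: "B \<le> \<bar>u t x\<bar>" if x: "x \<in> A" for x
    proof -
      have xn: "\<nu> * g t \<le> norm x" "norm x \<le> \<mu> * g t"
        using x gt by (auto simp: A_def annulus_def field_simps)
      have x2: "2 \<le> norm x" using xn gt by linarith
      have t0: "t > 0" using elim by simp
      note val = duhamel_unit_ball_source[OF Ym Ynn _ up' Cu t0 x2, of \<gamma>, folded f_def]
      have "ennreal B \<le> ennreal (cl * v * (b * g t) powr (4 * \<beta> - n)) * ennreal (ct * T powr (- \<alpha>) * decay \<alpha> \<gamma> t (T powr \<alpha>))"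
      proof -
        have "g t powr (2 * \<beta>) \<le> T powr \<alpha>"
          unfolding Ta using b \<beta> mult_right_mono[OF ge_one_powr_ge_zero[of b "2 * \<beta>"], of "g t powr (2 * \<beta>)"] by simp
        then have "decay \<alpha> \<gamma> t (g t powr (2 * \<beta>)) \<le> decay \<alpha> \<gamma> t (T powr \<alpha>)" using elim by (intro decay_mono) auto
        then have "B \<le> cl * v * (b * g t) powr (4 * \<beta> - n) * (ct * T powr (- \<alpha>) * decay \<alpha> \<gamma> t (T powr \<alpha>))"
          unfolding B_def using cl v ct by (intro mult_left_mono) auto
        then show ?thesis using cl v by (simp add: ennreal_mult'[symmetric] ennreal_leI)
      qed
      also have "\<dots> \<le> ennreal (cl * v * (b * g t) powr (4 * \<beta> - n)) *
        (\<integral>\<^sup>+ s. ennreal (indicator {0<..<t - T} s * (t - s) powr (- 1 - \<alpha>) * (1 + s) powr (- \<gamma>)) \<partial>lborel)"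
        using elim T by (intro mult_left_mono time) auto
      also have "\<dots> = (\<integral>\<^sup>+ s. ennreal (cl * v * (b * g t) powr (4 * \<beta> - n)) *
        ennreal (indicator {0<..<t - T} s * (t - s) powr (- 1 - \<alpha>) * (1 + s) powr (- \<gamma>)) \<partial>lborel)"
        by (rule nn_integral_cmult[symmetric]) measurable
      also have "\<dots> \<le> (\<integral>\<^sup>+ s. ennreal (indicator {0<..<t} s * (1 + s) powr (- \<gamma>)) * (\<integral>\<^sup>+ y. ennreal (Y (t - s) (x - y)) * indicator (ball 0 1) y \<partial>lborel) \<partial>lborel)"
      proof (rule nn_integral_mono)
        fix s :: real
        show "ennreal (cl * v * (b * g t) powr (4 * \<beta> - n)) * ennreal (indicator {0<..<t - T} s * (t - s) powr (- 1 - \<alpha>) * (1 + s) powr (- \<gamma>)) \<le>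
          ennreal (indicator {0<..<t} s * (1 + s) powr (- \<gamma>)) * (\<integral>\<^sup>+ y. ennreal (Y (t - s) (x - y)) * indicator (ball 0 1) y \<partial>lborel)"
        proof (cases "s \<in> {0<..<t - T}")
          case s: True
          define \<tau> where "\<tau> = t - s"
          have \<tau>: "\<tau> > T" using s by (simp add: \<tau>_def)
          have Yb: "cl * \<tau> powr (- 1 - \<alpha>) * (b * g t) powr (4 * \<beta> - n) \<le> Y \<tau> (x - y)" if y: "y \<in> ball 0 1" for y
          proof -
            have yn: "norm y < 1" using y by simp
            have lo: "1 \<le> norm (x - y)" using norm_triangle_ineq[of "x - y" y] x2 yn by simp
            have hi: "norm (x - y) \<le> b * g t"
            proof -
              have "norm (x - y) \<le> norm x + norm y" by (rule norm_triangle_ineq4)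
              also have "\<dots> \<le> \<mu> * g t + 1 * g t" using xn yn gt by simp
              finally show ?thesis by (simp add: b_def distrib_right)
            qed
            have "b * g t \<le> \<tau> powr (\<alpha> / (2 * \<beta>))"
              unfolding Tb[symmetric] using \<tau> T \<alpha> \<beta> by (intro powr_mono2) auto
            then have "cl * \<tau> powr (- 1 - \<alpha>) * norm (x - y) powr (4 * \<beta> - n) \<le> Y \<tau> (x - y)"
              using lo hi \<tau> T by (intro low) auto
            moreover have "(b * g t) powr (4 * \<beta> - n) \<le> norm (x - y) powr (4 * \<beta> - n)"
              using lo hi N by (intro powr_mono2') (auto simp: n_def)
            then have "cl * \<tau> powr (- 1 - \<alpha>) * (b * g t) powr (4 * \<beta> - n) \<le> cl * \<tau> powr (- 1 - \<alpha>) * norm (x - y) powr (4 * \<beta> - n)"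
              using cl by (intro mult_left_mono) auto
            ultimately show ?thesis by linarith
          qed
          have "ennreal (cl * \<tau> powr (- 1 - \<alpha>) * (b * g t) powr (4 * \<beta> - n)) * ennreal v =
            (\<integral>\<^sup>+ y. ennreal (cl * \<tau> powr (- 1 - \<alpha>) * (b * g t) powr (4 * \<beta> - n)) * indicator (ball (0 :: 'a) 1) y \<partial>lborel)"
            using emeasure_ball[of 1 "0 :: 'a"] by (simp add: nn_integral_cmult_indicator v_def n_def)
          also have "\<dots> \<le> (\<integral>\<^sup>+ y. ennreal (Y \<tau> (x - y)) * indicator (ball 0 1) y \<partial>lborel)"
            using Yb by (intro nn_integral_mono) (auto simp: indicator_def intro!: ennreal_leI)
          finally have *: "ennreal (cl * \<tau> powr (- 1 - \<alpha>) * (b * g t) powr (4 * \<beta> - n)) * ennreal v \<le> (\<integral>\<^sup>+ y. ennreal (Y \<tau> (x - y)) * indicator (ball 0 1) y \<partial>lborel)" .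
          have "ennreal (cl * v * (b * g t) powr (4 * \<beta> - n)) * ennreal (\<tau> powr (- 1 - \<alpha>) * (1 + s) powr (- \<gamma>)) =
            ennreal ((1 + s) powr (- \<gamma>)) * (ennreal (cl * \<tau> powr (- 1 - \<alpha>) * (b * g t) powr (4 * \<beta> - n)) * ennreal v)"
            using cl v by (simp add: ennreal_mult'[symmetric] mult_ac)
          also have "\<dots> \<le> ennreal ((1 + s) powr (- \<gamma>)) * (\<integral>\<^sup>+ y. ennreal (Y \<tau> (x - y)) * indicator (ball 0 1) y \<partial>lborel)"
            by (intro mult_left_mono *) simp
          finally show ?thesis using s T by (simp add: \<tau>_def)
        qed simp
      qed
      also have "\<dots> = ennreal (u t x)" unfolding u by (rule val(1)[symmetric]) (use \<alpha> in auto)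
      finally have "ennreal B \<le> ennreal (u t x)" .
      moreover have "0 \<le> u t x" unfolding u by (rule val(2)) (use \<alpha> in auto)
      ultimately show ?thesis by simp
    qed
    have "ennreal (B * (V * g t ^ DIM('a)) powr enn2real (1 / p)) \<le> Lp_norm p (lebesgue_on A) (u t)"
      using A emeasure_annulus(2)[OF \<nu>, of "g t", where 'a = 'a] V gt B p uB
      by (intro Lp_norm_ge_of_bound) (auto simp: A_def V_def v_def n_def)
    moreover have "B * (V * g t ^ DIM('a)) powr enn2real (1 / p) = c * rate n \<alpha> \<beta> \<gamma> p g t"
    proof -
      have "(V * g t ^ DIM('a)) powr enn2real (1 / p) = V powr enn2real (1 / p) * g t powr (n * enn2real (1 / p))"
        using gt by (simp add: powr_mult powr_realpow[symmetric] powr_powr n_def)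
      moreover have "(b * g t) powr (4 * \<beta> - n) = b powr (4 * \<beta> - n) * g t powr (4 * \<beta> - n)" by (rule powr_mult)
      moreover have "rate n \<alpha> \<beta> \<gamma> p g t = g t powr (4 * \<beta> - n) * g t powr (- (2 * \<beta>)) * g t powr (n * enn2real (1 / p)) * decay \<alpha> \<gamma> t (g t powr (2 * \<beta>))"
        unfolding rate_eq_decay by (simp add: powr_add[symmetric] algebra_simps)
      ultimately show ?thesis unfolding B_def c_def Ta by (simp only: mult_ac)
    qed
    ultimately show ?case by (simp add: A_def)
  qed
  then obtain t1 where "\<And>t. t \<ge> t1 \<Longrightarrow> ennreal (c * rate n \<alpha> \<beta> \<gamma> p g t) \<le> Lp_norm p (lebesgue_on (annulus \<nu> \<mu> (g t))) (u t)"
    by (auto simp: eventually_at_top_linorder)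
  then show ?thesis
    using c um unfolding n_def u_def by (intro exI[of _ c] conjI exI[of _ "max 2 t1"]) auto
qed

theorem theorem1p3:
  fixes \<alpha> \<beta> \<gamma> :: real and p :: ennreal and g :: "real \<Rightarrow> real"
  assumes "0 < \<alpha>" "\<alpha> < 1"
    and "0 < \<beta>" "\<beta> \<le> 1"
    and "real DIM('a::euclidean_space) > 4 * \<beta>"
    and "1 \<le> p"
    and "\<And>t. t > 0 \<Longrightarrow> g t > 0"
    and "filterlim g at_top at_top"
    and "g \<in> o[at_top](\<lambda>t. t powr (\<alpha> / (2 * \<beta>)))"
  shows
    "(\<forall>f :: 'a \<Rightarrow> real \<Rightarrow> real. admissible_source \<beta> \<gamma> p f \<longrightarrow>
       (\<forall>\<nu> \<mu>. 0 < \<nu> \<and> \<nu> < \<mu> \<longrightarrow>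
         (\<exists>C>0. \<exists>t\<^sub>0\<ge>2. \<forall>t\<ge>t\<^sub>0.
            (\<lambda>x. mild_solution \<alpha> \<beta> f x t)
              \<in> borel_measurable (lebesgue_on (annulus \<nu> \<mu> (g t))) \<and>
            Lp_norm p (lebesgue_on (annulus \<nu> \<mu> (g t))) (\<lambda>x. mild_solution \<alpha> \<beta> f x t)
              \<le> ennreal (C * rate (real DIM('a)) \<alpha> \<beta> \<gamma> p g t))))
     \<and>
     (\<forall>\<nu> \<mu>. 0 < \<nu> \<and> \<nu> < \<mu> \<longrightarrow>
       (\<exists>f :: 'a \<Rightarrow> real \<Rightarrow> real. admissible_source \<beta> \<gamma> p f \<and>
         (\<exists>c>0. \<exists>t\<^sub>1\<ge>2. \<forall>t\<ge>t\<^sub>1.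
            (\<lambda>x. mild_solution \<alpha> \<beta> f x t)
              \<in> borel_measurable (lebesgue_on (annulus \<nu> \<mu> (g t))) \<and>
            Lp_norm p (lebesgue_on (annulus \<nu> \<mu> (g t))) (\<lambda>x. mild_solution \<alpha> \<beta> f x t)
              \<ge> ennreal (c * rate (real DIM('a)) \<alpha> \<beta> \<gamma> p g t))))"
proof (intro conjI allI impI)
  fix f :: "'a \<Rightarrow> real \<Rightarrow> real" and \<nu> \<mu> :: real
  assume "admissible_source \<beta> \<gamma> p f" and "0 < \<nu> \<and> \<nu> < \<mu>"
  then show "\<exists>C>0. \<exists>t\<^sub>0\<ge>2. \<forall>t\<ge>t\<^sub>0.
      (\<lambda>x. mild_solution \<alpha> \<beta> f x t) \<in> borel_measurable (lebesgue_on (annulus \<nu> \<mu> (g t))) \<and>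
      Lp_norm p (lebesgue_on (annulus \<nu> \<mu> (g t))) (\<lambda>x. mild_solution \<alpha> \<beta> f x t)
        \<le> ennreal (C * rate (real DIM('a)) \<alpha> \<beta> \<gamma> p g t)"
    using assms by (intro mild_solution_upper_bound) auto
next
  fix \<nu> \<mu> :: real
  assume \<nu>: "0 < \<nu> \<and> \<nu> < \<mu>"
  let ?f = "\<lambda>(y :: 'a) s. (1 + s) powr (- \<gamma>) * indicator (ball 0 1) y"
  have "\<exists>c>0. \<exists>t\<^sub>1\<ge>2. \<forall>t\<ge>t\<^sub>1.
      (\<lambda>x. mild_solution \<alpha> \<beta> ?f x t) \<in> borel_measurable (lebesgue_on (annulus \<nu> \<mu> (g t))) \<and>
      ennreal (c * rate (real DIM('a)) \<alpha> \<beta> \<gamma> p g t) \<le>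
      Lp_norm p (lebesgue_on (annulus \<nu> \<mu> (g t))) (\<lambda>x. mild_solution \<alpha> \<beta> ?f x t)"
    using assms \<nu> by (intro mild_solution_lower_bound) auto
  with admissible_unit_ball_source show
    "\<exists>f :: 'a \<Rightarrow> real \<Rightarrow> real. admissible_source \<beta> \<gamma> p f \<and>
      (\<exists>c>0. \<exists>t\<^sub>1\<ge>2. \<forall>t\<ge>t\<^sub>1.
        (\<lambda>x. mild_solution \<alpha> \<beta> f x t) \<in> borel_measurable (lebesgue_on (annulus \<nu> \<mu> (g t))) \<and>
        ennreal (c * rate (real DIM('a)) \<alpha> \<beta> \<gamma> p g t) \<le>
        Lp_norm p (lebesgue_on (annulus \<nu> \<mu> (g t))) (\<lambda>x. mild_solution \<alpha> \<beta> f x t))"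
    by (intro exI[of _ ?f] conjI)
qed

end
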